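(* Let $N\ge 2$ be an integer, $1<p<N$, $-\infty<\mu<\bar{\mu}=((N-p)/p)^{p}$, $0\le s<p$, $p^{*}(s)=(N-s)p/(N-p)$, and let $B$ be an open finite ball in $\mathbb{R}^{N}$ centered at the origin. For $\lambda\in\mathbb{R}$ consider the equation $$\begin{cases}-\Delta_{p}u-\dfrac{\mu}{|x|^{p}}|u|^{p-2}u=\dfrac{|u|^{p^{*}(s)-2}u}{|x|^{s}}+\lambda|u|^{p-2}u & \text{in }B,\\ u=0 & \text{on }\partial B.\end{cases}$$ If $\lambda\le 0$, then this equation admits no positive radial (weak) solution in $B$. If $\lambda>0$, then this equation admits at most one positive radial (weak) solution in $B$.
   Context: $\Delta_{p}u=\sum_{i=1}^{N}\partial_{x_{i}}(|\nabla u|^{p-2}\partial_{x_{i}}u)$ is the $p$-Laplacian. $W_{0}^{1,p}(B)$ is the completion of $C_{0}^{\infty}(B)$ in the norm $\|\nabla u\|_{L^{p}(B)}$. A (weak) solution is a function $u\in W_{0}^{1,p}(B)$ such that for all $\varphi\in C_{0}^{\infty}(B)$, $$\int_{B}\left(|\nabla u|^{p-2}\nabla u\cdot\nabla\varphi-\frac{\mu}{|x|^{p}}|u|^{p-2}u\varphi-\lambda|u|^{p-2}u\varphi\right)dx=\int_{B}\frac{|u|^{p^{*}(s)-2}u}{|x|^{s}}\varphi\, dx.$$ A radial function in $W_{0}^{1,p}(B)$ is identified with its representative that is continuous on $B\setminus\{0\}$ and written $u(x)=u(r)$, $r=|x|$; "positive" means $u(r)>0$ for every $r>0$ less than the radius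 of $B$. *)

theory Defs
  imports "HOL-Analysis.Analysis"
begin

definition partial_deriv :: "'a::euclidean_space \<Rightarrow> ('a \<Rightarrow> real) \<Rightarrow> 'a \<Rightarrow> real" where
  "partial_deriv b f x = frechet_derivative f (at x) b"

definition grad :: "('a::euclidean_space \<Rightarrow> real) \<Rightarrow> 'a \<Rightarrow> 'a" where
  "grad f x = (\<Sum>b\<in>Basis. partial_deriv b f x *\<^sub>R b)"

primrec Ck :: "nat \<Rightarrow> ('a::euclidean_space \<Rightarrow> real) \<Rightarrow> bool" where
  "Ck 0 f \<longleftrightarrow> continuous_on UNIV f"
| "Ck (Suc k) f \<longleftrightarrow> f differentiable_on UNIV \<and> (\<forall>b\<in>Basis. Ck k (partial_deriv b f))"

text \<open>The space \<open>C\<^sub>0\<^sup>\<infinity>(B)\<close>; its elements are extended by zero to the whole space.\<close>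

definition test_functions :: "'a::euclidean_space set \<Rightarrow> ('a \<Rightarrow> real) set" where
  "test_functions B =
     {\<phi>. (\<forall>k. Ck k \<phi>) \<and> compact (closure {x. \<phi> x \<noteq> 0}) \<and> closure {x. \<phi> x \<noteq> 0} \<subseteq> B}"

text \<open>
  \<open>W0_with_grad p B u g\<close> says that \<open>u\<close> belongs to \<open>W\<^sub>0\<^sup>1\<^sup>,\<^sup>p(B)\<close> and that \<open>g\<close> is its gradient (unique
  almost everywhere). By the Poincare inequality on the bounded set \<open>B\<close>, a sequence of test
  functions that is Cauchy for the norm \<open>\<parallel>\<nabla>\<phi>\<parallel>\<close> in \<open>L\<^sup>p(B)\<close> also converges in \<open>L\<^sup>p(B)\<close>; this
  identifies the abstract completion with the functions \<open>u\<close> obtained as such limits. The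
  extended-valued integrals keep divergent integrals from counting as zero.
\<close>

definition W0_with_grad ::
    "real \<Rightarrow> 'a::euclidean_space set \<Rightarrow> ('a \<Rightarrow> real) \<Rightarrow> ('a \<Rightarrow> 'a) \<Rightarrow> bool" where
  "W0_with_grad p B u g \<longleftrightarrow>
     u \<in> borel_measurable (lebesgue_on B) \<and> g \<in> borel_measurable (lebesgue_on B) \<and>
     (\<exists>\<phi>. (\<forall>n::nat. \<phi> n \<in> test_functions B) \<and>
       (\<lambda>n. \<integral>\<^sup>+x. ennreal (norm (grad (\<phi> n) x - g x) powr p) \<partial>lebesgue_on B) \<longlonglongrightarrow> 0 \<and>
       (\<lambda>n. \<integral>\<^sup>+x. ennreal (\<bar>\<phi> n x - u x\<bar> powr p) \<partial>lebesgue_on B) \<longlonglongrightarrow> 0)"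

definition critical_exponent :: "nat \<Rightarrow> real \<Rightarrow> real \<Rightarrow> real" where
  "critical_exponent N p s = (real N - s) * p / (real N - p)"

text \<open>
  For \<open>p < 2\<close> the expression \<open>\<bar>t\<bar>\<^sup>p\<^sup>-\<^sup>2 t\<close> is read as \<open>0\<close> at \<open>t = 0\<close>, which agrees with
  \<open>0 powr a = 0\<close>. For \<open>u\<close> in \<open>W\<^sub>0\<^sup>1\<^sup>,\<^sup>p(B)\<close> with \<open>B\<close> bounded, \<open>1 < p < N\<close> and \<open>0 \<le> s < p\<close>, both integrands below are
  integrable by the Hardy and Hardy-Sobolev inequalities.
\<close>

definition weak_solution ::
    "real \<Rightarrow> real \<Rightarrow> real \<Rightarrow> real \<Rightarrow> 'a::euclidean_space set \<Rightarrow> ('a \<Rightarrow> real) \<Rightarrow> bool" where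
  "weak_solution p s \<mu> lam B u \<longleftrightarrow>
     (\<exists>g. W0_with_grad p B u g \<and>
       (\<forall>\<phi>\<in>test_functions B.
         (\<integral>x. norm (g x) powr (p - 2) * (g x \<bullet> grad \<phi> x)
              - \<mu> / norm x powr p * \<bar>u x\<bar> powr (p - 2) * u x * \<phi> x
              - lam * \<bar>u x\<bar> powr (p - 2) * u x * \<phi> x \<partial>lebesgue_on B) =
         (\<integral>x. \<bar>u x\<bar> powr (critical_exponent DIM('a) p s - 2) * u x / norm x powr s * \<phi> x
              \<partial>lebesgue_on B)))"

text \<open>
  A radial element of \<open>W\<^sub>0\<^sup>1\<^sup>,\<^sup>p\<close> is represented by the function that is continuous away from the
  origin; the value at the origin is irrelevant.
\<close>

definition positive_radial_solution ::
    "real \<Rightarrow> real \<Rightarrow> real \<Rightarrow> real \<Rightarrow> real \<Rightarrow> ('a::euclidean_space \<Rightarrow> real) \<Rightarrow> bool" where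
  "positive_radial_solution p s \<mu> lam R u \<longleftrightarrow>
     weak_solution p s \<mu> lam (ball 0 R) u \<and>
     continuous_on (ball 0 R - {0}) u \<and>
     (\<forall>x\<in>ball 0 R. \<forall>y\<in>ball 0 R. norm x = norm y \<longrightarrow> u x = u y) \<and>
     (\<forall>x\<in>ball 0 R - {0}. 0 < u x)"

end

(*
  Put t = ln r, w = r^((N-p)/p) u and z = |w' - d w|^(p-2) (w' - d w) with d = (N-p)/p.  Because the
  exponents are critical, the radial equation becomes a planar Hamiltonian system in (w, z) that is
  autonomous except for the term lambda e^(p t) w^(p-1).  Hence its Hamiltonian H satisfies
  H' = lambda e^(p t) w^p; it tends to 0 at r = 0 (finite energy) and to a nonnegative limit at the
  boundary.  This rules out lambda < 0 at once; for lambda = 0 it gives H = 0, which keeps the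
  Riccati variable y = z / w^(p-1) bounded, so that w cannot vanish at the boundary.

  For lambda > 0 let w1, w2 be two solutions and rho = w2 / w1.  Then H2' = rho^p H1'.  If rho had an
  interior maximum at t, integration from r = 0 would give H2 < rho^p H1 at t, whereas y1 = y2 there;
  the Riccati equation then makes y2 - y1 increasing at t, so rho would be increasing just after t.
  If instead the maximum of rho is its limit at the boundary, then H2 - rho^p H1 decreases from 0 to 0,
  so rho is constant, and the equation forces rho = 1.  One of the two cases applies to rho or to 1/rho.

  The weak gradient g of a radial u is identified without polar coordinates.  Difference quotients
  of u along dilations converge in L^1 to g.x, which is therefore radial, and g is orthogonal to every
  rotation field since u is locally a uniform limit of polynomials in |x|^2.
*)

theory Submission
  imports Defs
begin

section \<open>Signed powers\<close>

text \<open>An interior and a boundary maximum of rho do not exhaust the possibilities: the supremum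
  might be approached only as t tends to -infinity. What excludes this is a finite positive limit l
  of rho there. If l is at most the boundary limit, any value of rho above the latter forces an
  interior maximum; otherwise 1/rho is in this situation. The limit exists because y tends at
  -infinity to a zero of the convex function \<open>g\<close> with positive slope, which is the same
  zero for both solutions; the slope is also the growth rate of ln w, so y converges exponentially
  and (ln rho)' is integrable at -infinity. Finite energy makes z small only along a sequence of
  times; the monotonicity of H turns this into a limit of H. A weak solution comes without a second
  derivative, and its gradient is only a class of functions up to null sets. Testing with functions
  of |x|^2 and du Bois-Reymond's lemma show that the flux agrees almost everywhere with a C^1
  function of t, and u is then recovered as a classical solution by inverting the signed
  power.\<close>

definition spow :: "real \<Rightarrow> real \<Rightarrow> real" where
  "spow a x = sgn x * \<bar>x\<bar> powr a"

lemma spow_0 [simp]: "spow a 0 = 0"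
  by (simp add: spow_def)

lemma spow_nonneg: "0 \<le> x \<Longrightarrow> spow a x = x powr a"
  by (cases "x = 0") (auto simp: spow_def)

lemma spow_mult_pos: "0 \<le> c \<Longrightarrow> spow a (x * c) = spow a x * c powr a"
  by (cases "c = 0") (auto simp: spow_def abs_mult powr_mult sgn_mult)

lemma abs_spow: "\<bar>spow a x\<bar> = \<bar>x\<bar> powr a"
  by (auto simp: spow_def abs_mult sgn_if)

lemma spow_spow:
  assumes "a \<noteq> 0" shows "spow b (spow a x) = spow (a * b) x"
  by (cases x "0::real" rule: linorder_cases) (auto simp: spow_def powr_powr abs_mult sgn_mult)

lemma spow_1: "spow 1 x = x"
  by (auto simp: spow_def sgn_if)

lemma spow_inverse:
  assumes "a \<noteq> 0" shows "spow (1 / a) (spow a x) = x" "spow a (spow (1 / a) x) = x"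
  using assms by (auto simp: spow_spow spow_1)

lemma spow_mult_self: "spow a x * x = \<bar>x\<bar> powr (a + 1)"
  by (cases x "0::real" rule: linorder_cases) (auto simp: spow_def powr_add)

text \<open>Translates the form of the nonlinearity used in the weak equation; at 0 both sides are 0
  for every exponent because \<open>0 powr a = 0\<close>.\<close>

lemma powr_minus2_mult: "\<bar>x\<bar> powr (p - 2) * x = spow (p - 1) x"
proof (cases x "0::real" rule: linorder_cases)
  case less
  then have "\<bar>x\<bar> powr (p - 1) = \<bar>x\<bar> powr (p - 2) * \<bar>x\<bar>"
    using powr_add[of "- x" "p - 2" 1] by simp
  with less show ?thesis by (simp add: spow_def)
next
  case greater
  then have "\<bar>x\<bar> powr (p - 1) = \<bar>x\<bar> powr (p - 2) * \<bar>x\<bar>"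
    using powr_add[of x "p - 2" 1] by simp
  with greater show ?thesis by (simp add: spow_def)
qed auto

lemma spow_strict_mono:
  assumes "0 < a" "x < y" shows "spow a x < spow a y"
proof -
  consider "0 \<le> x" | "x < 0" "0 \<le> y" | "y < 0" using assms by linarith
  then show ?thesis
  proof cases
    case 1 then show ?thesis using assms by (simp add: spow_nonneg powr_less_mono2)
  next
    case 2
    then have "spow a x < 0" by (auto simp: spow_def)
    moreover have "0 \<le> spow a y" using 2 by (simp add: spow_nonneg)
    ultimately show ?thesis by linarith
  next
    case 3
    then show ?thesis using assms powr_less_mono2[of a "-y" "-x"] by (simp add: spow_def)
  qed
qed

lemma spow_mono: "0 < a \<Longrightarrow> x \<le> y \<Longrightarrow> spow a x \<le> spow a y"
  using spow_strict_mono[of a x y] by (cases "x = y") auto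

lemma spow_eq_iff: "0 < a \<Longrightarrow> spow a x = spow a y \<longleftrightarrow> x = y"
  using spow_strict_mono[of a x y] spow_strict_mono[of a y x] by (metis less_irrefl linorder_neqE)

lemma has_real_derivative_abs_powr:
  assumes "1 < a"
  shows "((\<lambda>x. \<bar>x\<bar> powr a) has_real_derivative a * spow (a - 1) x) (at x)"
proof (cases x "0::real" rule: linorder_cases)
  case less
  have "((\<lambda>x. (- x) powr a) has_real_derivative a * spow (a - 1) x) (at x)"
    using less by (auto intro!: derivative_eq_intros simp: spow_def powr_diff field_simps)
  then show ?thesis
    by (rule has_field_derivative_transform_within[where d="-x"]) (use less in \<open>auto simp: dist_real_def\<close>)
next
  case equal
  have "((\<lambda>h. \<bar>h\<bar> powr (a - 1)) \<longlongrightarrow> 0) (at 0)"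
    using assms by (auto intro!: tendsto_eq_intros)
  then have "((\<lambda>h. \<bar>h\<bar> powr a / h) \<longlongrightarrow> 0) (at 0)"
  proof (rule Lim_null_comparison[rotated])
    show "\<forall>\<^sub>F h in at 0. norm (\<bar>h\<bar> powr a / h) \<le> \<bar>h\<bar> powr (a - 1)"
      by (auto simp: eventually_at_filter powr_diff)
  qed
  then show ?thesis using equal by (simp add: DERIV_def)
next
  case greater
  have "((\<lambda>x. x powr a) has_real_derivative a * spow (a - 1) x) (at x)"
    using greater by (auto intro!: derivative_eq_intros simp: spow_def powr_diff field_simps)
  then show ?thesis
    by (rule has_field_derivative_transform_within[where d="x"]) (use greater in \<open>auto simp: dist_real_def\<close>)
qed

lemma isCont_spow:
  assumes "0 < a" shows "isCont (spow a) x"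
proof (cases "x = 0")
  case False
  have "isCont (\<lambda>x. x / \<bar>x\<bar> * \<bar>x\<bar> powr a) x" using False by (intro continuous_intros) auto
  moreover have "spow a = (\<lambda>x. x / \<bar>x\<bar> * \<bar>x\<bar> powr a)"
    by (auto simp: spow_def sgn_if fun_eq_iff)
  ultimately show ?thesis by simp
next
  case True
  have "((\<lambda>x. \<bar>x\<bar> powr a) \<longlongrightarrow> 0) (at 0)" using assms by (auto intro!: tendsto_eq_intros)
  then have "((\<lambda>x. spow a x) \<longlongrightarrow> 0) (at 0)"
    by (rule Lim_null_comparison[rotated]) (simp add: abs_spow)
  then show ?thesis using True by (simp add: isCont_def)
qed

lemma continuous_on_spow [continuous_intros]:
  assumes "0 < a" "continuous_on S f" shows "continuous_on S (\<lambda>x. spow a (f x))"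
  using continuous_on_compose2[OF _ assms(2), of UNIV "spow a"] isCont_spow[OF assms(1)]
  by (auto simp: continuous_on_eq_continuous_at)

text \<open>Away from 0 the signed power is differentiable, so exponent 1 works; at 0 it is its own
  modulus of continuity, with exponent \<open>a\<close>, possibly below 1. The bound carries
  exponential closeness of the Riccati variable to its limit over to (ln w)'.\<close>

lemma spow_holder_at:
  assumes "0 < a"
  shows "\<exists>C b r. 0 < C \<and> 0 < b \<and> 0 < r \<and> (\<forall>y. \<bar>y - y0\<bar> < r \<longrightarrow> \<bar>spow a y - spow a y0\<bar> \<le> C * \<bar>y - y0\<bar> powr b)"
proof (cases "y0 = 0")
  case True
  then show ?thesis using assms
    by (intro exI[of _ 1] exI[of _ a] exI[of _ 1]) (auto simp: abs_spow)
next
  case False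
  obtain D where D: "(spow a has_real_derivative D) (at y0)"
  proof (cases "0 < y0")
    case True
    have "((\<lambda>y. y powr a) has_real_derivative a * y0 powr (a - 1)) (at y0)"
      using True by (rule has_real_derivative_powr)
    then have "(spow a has_real_derivative a * y0 powr (a - 1)) (at y0)"
      by (rule has_field_derivative_transform_within[where d="y0"])
         (use True in \<open>auto simp: dist_real_def spow_nonneg\<close>)
    then show ?thesis by (rule that)
  next
    case y0: False
    have "((\<lambda>y. - ((- y) powr a)) has_real_derivative a * (- y0) powr (a - 1)) (at y0)"
      using y0 False by (auto intro!: derivative_eq_intros simp: powr_diff)
    then have "(spow a has_real_derivative a * (- y0) powr (a - 1)) (at y0)"
      by (rule has_field_derivative_transform_within[where d="-y0"])
         (use y0 False in \<open>auto simp: dist_real_def spow_def\<close>)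
    then show ?thesis by (rule that)
  qed
  then have "((\<lambda>y. (spow a y - spow a y0) / (y - y0)) \<longlongrightarrow> D) (at y0)"
    by (simp add: has_field_derivative_iff)
  then have "\<forall>\<^sub>F y in at y0. dist ((spow a y - spow a y0) / (y - y0)) D < 1"
    by (rule tendstoD) simp
  then obtain r where r: "0 < r" "\<And>y. y \<noteq> y0 \<Longrightarrow> dist y y0 < r \<Longrightarrow> dist ((spow a y - spow a y0) / (y - y0)) D < 1"
    unfolding eventually_at by auto
  have "\<bar>spow a y - spow a y0\<bar> \<le> (\<bar>D\<bar> + 1) * \<bar>y - y0\<bar> powr 1" if "\<bar>y - y0\<bar> < r" for y
  proof (cases "y = y0")
    case False
    then have "\<bar>(spow a y - spow a y0) / (y - y0)\<bar> \<le> \<bar>D\<bar> + 1"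
      using r(2)[of y] that unfolding dist_real_def by linarith
    then show ?thesis using False by (simp add: abs_divide field_simps)
  qed auto
  then show ?thesis using r(1) by (intro exI[of _ "\<bar>D\<bar> + 1"] exI[of _ 1] exI[of _ r]) auto
qed

section \<open>Limits of functions with a controlled derivative\<close>

text \<open>In the variable x = exp (e t) the hypothesis becomes a bounded derivative on a bounded
  interval starting at 0; a Lipschitz function extends continuously to the closure, and its value at
  x = 0 is the limit.\<close>

lemma tendsto_at_bot_of_exp_bound:
  fixes f f' :: "real \<Rightarrow> real"
  assumes "\<And>t. t < t0 \<Longrightarrow> (f has_real_derivative f' t) (at t)"
    and "0 < e" and "\<And>t. t < t0 \<Longrightarrow> \<bar>f' t\<bar> \<le> C * exp (e * t)"
  shows "\<exists>l. (f \<longlongrightarrow> l) at_bot"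
proof -
  define g where "g x = f (ln x / e)" for x
  have C: "0 \<le> C" using abs_ge_zero[THEN order_trans, OF assms(3)[of "t0 - 1"]] by (simp add: zero_le_mult_iff)
  let ?X = "{0<..<exp (e * t0)}"
  have D: "(g has_real_derivative f' (ln x / e) * (1 / x / e)) (at x)" "ln x / e < t0" if "x \<in> ?X" for x
  proof -
    show "ln x / e < t0" using that assms(2)
      by (auto simp: field_simps) (metis exp_gt_zero exp_ln ln_exp ln_less_cancel_iff mult.commute)
    then have "(f has_real_derivative f' (ln x / e)) (at (ln x / e))" by (rule assms(1))
    then show "(g has_real_derivative f' (ln x / e) * (1 / x / e)) (at x)"
      unfolding g_def
    proof (rule DERIV_chain2)
      show "((\<lambda>x. ln x / e) has_real_derivative 1 / x / e) (at x)"
        using that assms(2) by (auto intro!: derivative_eq_intros)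
    qed
  qed
  have "(C / e)-lipschitz_on ?X g"
  proof (rule bounded_derivative_imp_lipschitz)
    fix x assume x: "x \<in> ?X"
    show "(g has_derivative (\<lambda>h. f' (ln x / e) * (1 / x / e) * h)) (at x within ?X)"
      using has_field_derivative_at_within[OF D(1)[OF x], of ?X] unfolding has_field_derivative_def .
    have "\<bar>f' (ln x / e)\<bar> \<le> C * x" using assms(3)[OF D(2)[OF x]] x assms(2) by simp
    then have "\<bar>f' (ln x / e) * (1 / x / e)\<bar> \<le> C / e"
      using x assms(2) by (simp add: abs_mult field_simps)
    then show "onorm (\<lambda>h. f' (ln x / e) * (1 / x / e) * h) \<le> C / e"
      by (intro onorm_le) (simp only: real_norm_def abs_mult[of "f' (ln x / e) * (1 / x / e)"], intro mult_right_mono, auto)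
  qed (use C assms(2) in auto)
  then obtain h where h: "(C / e)-lipschitz_on (closure ?X) h" "\<And>x. x \<in> ?X \<Longrightarrow> h x = g x"
    using lipschitz_extend_closure[of "C / e" ?X g] by auto
  have "closure ?X = {0..exp (e * t0)}" by (intro closure_greaterThanLessThan) auto
  then have "(h \<longlongrightarrow> h 0) (at 0 within {0..exp (e * t0)})"
    using lipschitz_on_continuous_on[OF h(1)] by (auto simp: continuous_on_def)
  then have hl: "(h \<longlongrightarrow> h 0) (at_right 0)"
    by (simp add: at_within_Icc_at_right)
  have e0: "filterlim (\<lambda>t. exp (e * t)) (at_right 0) at_bot"
    unfolding filterlim_at
    by (auto intro!: filterlim_compose[OF exp_at_bot] filterlim_tendsto_pos_mult_at_bot[OF tendsto_const assms(2)] filterlim_ident)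
  have "((\<lambda>t. h (exp (e * t))) \<longlongrightarrow> h 0) at_bot"
    by (rule filterlim_compose[OF hl e0])
  moreover have "\<forall>\<^sub>F t in at_bot. h (exp (e * t)) = f t"
    using eventually_gt_at_bot[of t0]
  proof eventually_elim
    case (elim t)
    then show ?case using h(2)[of "exp (e * t)"] assms(2) by (simp add: g_def)
  qed
  ultimately show ?thesis by (blast intro: Lim_transform_eventually)
qed

lemma tendsto_at_left_of_bounded_deriv:
  fixes f f' :: "real \<Rightarrow> real"
  assumes "t0 < T" and "\<And>t. t0 < t \<Longrightarrow> t < T \<Longrightarrow> (f has_real_derivative f' t) (at t)"
    and "\<And>t. t0 < t \<Longrightarrow> t < T \<Longrightarrow> \<bar>f' t\<bar> \<le> C"
  shows "\<exists>l. (f \<longlongrightarrow> l) (at_left T)"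
proof -
  let ?X = "{t0<..<T}"
  have C: "0 \<le> C" using assms(3)[of "(t0 + T) / 2"] assms(1) by auto
  have "C-lipschitz_on ?X f"
  proof (rule bounded_derivative_imp_lipschitz)
    fix x assume x: "x \<in> ?X"
    show "(f has_derivative (\<lambda>h. f' x * h)) (at x within ?X)"
      using assms(2) x by (auto simp: has_field_derivative_def intro: has_derivative_at_withinI)
    show "onorm (\<lambda>h. f' x * h) \<le> C"
      using assms(3)[of x] x by (intro onorm_le) (auto simp: abs_mult intro!: mult_right_mono)
  qed (use C in auto)
  then obtain h where h: "C-lipschitz_on (closure ?X) h" "\<And>x. x \<in> ?X \<Longrightarrow> h x = f x"
    using lipschitz_extend_closure[of C ?X f] by auto
  have "closure ?X = {t0..T}" using assms(1) by (intro closure_greaterThanLessThan) auto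
  then have "(h \<longlongrightarrow> h T) (at T within {t0..T})"
    using lipschitz_on_continuous_on[OF h(1)] assms(1) by (auto simp: continuous_on_def)
  then have "(h \<longlongrightarrow> h T) (at_left T)"
    using assms(1) by (simp add: at_within_Icc_at_left)
  moreover have "\<forall>\<^sub>F t in at_left T. h t = f t"
    using assms(1) h(2) by (auto simp: eventually_at_left_field)
  ultimately show ?thesis by (blast intro: Lim_transform_eventually)
qed

section \<open>The Emden--Fowler system\<close>

text \<open>
  The unknowns are \<open>w = r\<^sup>d u\<close> and \<open>z = r\<^sup>-\<^sup>d F\<close> as functions of \<open>t = ln r\<close>, where \<open>d = (N - p) / p\<close> and
  \<open>F = r\<^sup>N\<^sup>-\<^sup>1 \<bar>u'\<bar>\<^sup>p\<^sup>-\<^sup>2 u'\<close> is the radial flux; \<open>T\<close> is the logarithm of the radius of the ball. The assumption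
  \<open>z_small\<close> is all that is needed of the finiteness of the energy.
\<close>

locale emden_fowler =
  fixes p q d \<mu> lam T :: real and w z :: "real \<Rightarrow> real"
  assumes p: "1 < p" and pq: "p < q" and d: "0 < d"
    and w_pos: "t < T \<Longrightarrow> 0 < w t"
    and w_deriv: "t < T \<Longrightarrow> (w has_real_derivative d * w t + spow (1 / (p - 1)) (z t)) (at t)"
    and z_deriv: "t < T \<Longrightarrow> (z has_real_derivative
          - d * z t - (\<mu> + lam * exp (p * t)) * w t powr (p - 1) - w t powr (q - 1)) (at t)"
    and w_end: "(w \<longlongrightarrow> 0) (at_left T)"
    and w_bot: "(w \<longlongrightarrow> 0) at_bot"
    and z_small: "0 < e \<Longrightarrow> \<exists>t<t0. \<bar>z t\<bar> < e"
begin

text \<open>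
  \<open>H\<close> is the Hamiltonian of the system, \<open>y\<close> the Riccati variable \<open>\<bar>r u' / u\<bar>\<^sup>p\<^sup>-\<^sup>2 (r u' / u)\<close>, and \<open>g\<close> the part
  of \<open>K = H / w\<^sup>p\<close> that depends on \<open>y\<close> only.
\<close>

definition H :: "real \<Rightarrow> real" where
  "H t = (1 - 1 / p) * \<bar>z t\<bar> powr (p / (p - 1)) + d * w t * z t
     + (\<mu> + lam * exp (p * t)) * w t powr p / p + w t powr q / q"

definition y :: "real \<Rightarrow> real" where "y t = z t / w t powr (p - 1)"
definition a :: "real \<Rightarrow> real" where "a t = w t powr (q - p)"
definition K :: "real \<Rightarrow> real" where "K t = H t / w t powr p"
definition g :: "real \<Rightarrow> real" where
  "g s = (1 - 1 / p) * \<bar>s\<bar> powr (p / (p - 1)) + d * s + \<mu> / p"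

abbreviation \<phi> :: "real \<Rightarrow> real" where "\<phi> \<equiv> spow (1 / (p - 1))"

lemma a_pos: "t < T \<Longrightarrow> 0 < a t"
  using w_pos[of t] by (simp add: a_def)

text \<open>The system reads w' = dH/dz, z' = -dH/dw, so the contributions through w and z cancel
  and only the explicit dependence on t, through \<open>exp (p * t)\<close>, remains.\<close>

lemma H_deriv:
  assumes "t < T"
  shows "(H has_real_derivative lam * exp (p * t) * w t powr p) (at t)"
proof -
  note w = w_pos[OF assms]
  have z': "((\<lambda>t. (1 - 1 / p) * \<bar>z t\<bar> powr (p / (p - 1))) has_real_derivative
      \<phi> (z t) * (- d * z t - (\<mu> + lam * exp (p * t)) * w t powr (p - 1) - w t powr (q - 1))) (at t)"
  proof -
    have 1: "1 < p / (p - 1)" "p / (p - 1) - 1 = 1 / (p - 1)" using p by (auto simp: field_simps)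
    have 2: "(1 - 1 / p) * (p / (p - 1)) = 1" using p by (auto simp: field_simps)
    show ?thesis
      by (rule DERIV_cong[OF DERIV_cmult[OF DERIV_chain2[OF has_real_derivative_abs_powr[OF 1(1), unfolded 1(2)] z_deriv[OF assms]]]])
         (simp only: mult.assoc[symmetric] 2 mult_1_left)
  qed
  have wp: "((\<lambda>t. w t powr r) has_real_derivative r * w t powr (r - 1) * (d * w t + \<phi> (z t))) (at t)" for r
    by (rule DERIV_powr[THEN DERIV_cong, OF w_deriv[OF assms] w DERIV_const])
       (use w in \<open>simp add: powr_diff\<close>)
  have dwz: "((\<lambda>t. d * w t * z t) has_real_derivative
      d * (d * w t + \<phi> (z t)) * z t + d * w t * (- d * z t - (\<mu> + lam * exp (p * t)) * w t powr (p - 1) - w t powr (q - 1))) (at t)"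
    by (rule DERIV_cong[OF DERIV_mult[OF DERIV_cmult[OF w_deriv[OF assms]] z_deriv[OF assms]]]) (simp add: algebra_simps)
  have ex: "((\<lambda>t. \<mu> + lam * exp (p * t)) has_real_derivative lam * (p * exp (p * t))) (at t)"
    by (auto intro!: derivative_eq_intros)
  have "(H has_real_derivative \<phi> (z t) * (- d * z t - (\<mu> + lam * exp (p * t)) * w t powr (p - 1) - w t powr (q - 1))
     + (d * (d * w t + \<phi> (z t)) * z t + d * w t * (- d * z t - (\<mu> + lam * exp (p * t)) * w t powr (p - 1) - w t powr (q - 1)))
     + (lam * (p * exp (p * t)) * w t powr p
         + p * w t powr (p - 1) * (d * w t + \<phi> (z t)) * (\<mu> + lam * exp (p * t))) / p
     + q * w t powr (q - 1) * (d * w t + \<phi> (z t)) / q) (at t)"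
    unfolding H_def[abs_def] by (intro DERIV_add z' dwz DERIV_cdivide DERIV_mult ex wp)
  then show ?thesis
    by (rule DERIV_cong) (use p pq in \<open>simp add: add_divide_distrib, simp add: algebra_simps\<close>)
qed

text \<open>The terms of \<open>H\<close> without \<open>z\<close> tend to 0 together with
  \<open>w\<close>; the other two are small at the times supplied by \<open>z_small\<close>.\<close>

lemma H_frequently_small:
  assumes "0 < e" shows "\<exists>t<t0. \<bar>H t\<bar> < e"
proof -
  define F where "F t x = (1 - 1 / p) * \<bar>x\<bar> powr (p / (p - 1)) + d * w t * x" for t x
  define E where "E t = (\<mu> + lam * exp (p * t)) * w t powr p / p + w t powr q / q" for t
  have ex: "((\<lambda>t. exp (p * t)) \<longlongrightarrow> 0) at_bot"
    using p by (auto intro!: filterlim_compose[OF exp_at_bot]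
        filterlim_tendsto_pos_mult_at_bot[OF tendsto_const] filterlim_ident)
  have "(E \<longlongrightarrow> (\<mu> + lam * 0) * 0 powr p / p + 0 powr q / q) at_bot"
    unfolding E_def using p pq w_pos by (intro tendsto_intros w_bot ex) (auto intro!: eventually_mono[OF eventually_gt_at_bot[of T]] less_imp_le)
  then have "(E \<longlongrightarrow> 0) at_bot" by simp
  then have "\<forall>\<^sub>F t in at_bot. \<bar>E t\<bar> < e / 2" 
    using assms by (auto dest!: tendstoD[where e="e/2"])
  moreover have "\<forall>\<^sub>F t in at_bot. \<bar>w t\<bar> < 1" using tendstoD[OF w_bot, of 1] by auto
  ultimately have "\<forall>\<^sub>F t in at_bot. \<bar>E t\<bar> < e / 2 \<and> \<bar>w t\<bar> < 1"
    by eventually_elim auto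
  then obtain t1 where t1: "\<And>t. t \<le> t1 \<Longrightarrow> \<bar>E t\<bar> < e / 2 \<and> \<bar>w t\<bar> < 1"
    unfolding eventually_at_bot_linorder by auto
  have "((\<lambda>x. (1 - 1 / p) * \<bar>x\<bar> powr (p / (p - 1)) + d * \<bar>x\<bar>) \<longlongrightarrow> 0) (nhds (0::real))"
    using p by (auto intro!: tendsto_eq_intros filterlim_ident)
  then have "\<forall>\<^sub>F x in nhds (0::real). \<bar>(1 - 1 / p) * \<bar>x\<bar> powr (p / (p - 1)) + d * \<bar>x\<bar>\<bar> < e / 2"
    using assms by (auto dest!: tendstoD[where e="e/2"])
  then obtain r where r: "0 < r" "\<And>x::real. \<bar>x\<bar> < r \<Longrightarrow> \<bar>(1 - 1 / p) * \<bar>x\<bar> powr (p / (p - 1)) + d * \<bar>x\<bar>\<bar> < e / 2"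
    unfolding eventually_nhds_metric by (auto simp: dist_real_def)
  obtain t where t: "t < min t0 t1" "\<bar>z t\<bar> < r" using z_small[OF r(1)] by blast
  have "\<bar>d * w t * z t\<bar> \<le> d * \<bar>z t\<bar>"
    using t1[of t] t d by (auto simp: abs_mult intro: mult_left_le_one_le mult_right_le_one_le)
  moreover have "0 \<le> (1 - 1 / p) * \<bar>z t\<bar> powr (p / (p - 1))" using p by simp
  ultimately have "\<bar>(1 - 1 / p) * \<bar>z t\<bar> powr (p / (p - 1)) + d * w t * z t\<bar> < e / 2"
    using r(2)[OF t(2)] by linarith
  moreover have "H t = ((1 - 1 / p) * \<bar>z t\<bar> powr (p / (p - 1)) + d * w t * z t) + E t"
    by (simp add: H_def E_def)
  ultimately have "\<bar>H t\<bar> < e" using t1[of t] t by linarith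
  then show ?thesis using t by auto
qed

text \<open>Pure algebra for the Riccati equation: \<open>x\<close>, \<open>v\<close>,
  \<open>m\<close>, \<open>P\<close>, \<open>Q\<close>, \<open>Z\<close> stand for w, z, mu + lam
  e^(pt), w^p, w^q and |z|^(p/(p-1)). Powers such as w^(p-1) enter as \<open>P / x\<close>.\<close>

lemma y_deriv_identity:
  fixes P Q Z :: real
  assumes "P \<noteq> 0" "x \<noteq> 0" "p \<noteq> 0" "q \<noteq> 0"
  shows "((- d * v - m * (P / x) - Q / x) * (P / x)
      - (p - 1) * (P / (x * x)) * (d * x * v + Z)) / ((P / x) * (P / x))
    = - p * (((1 - 1 / p) * Z + d * x * v + m * P / p + Q / q) / P) - (1 - p / q) * (Q / P)"
proof -
  have "((- d * v - m * (P / x) - Q / x) * (P / x)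
      - (p - 1) * (P / (x * x)) * (d * x * v + Z)) / ((P / x) * (P / x))
      = - m - Q / P - p * (d * x * v) / P - (p - 1) * Z / P"
    using assms by (simp add: field_simps)
  also have "\<dots> = - p * (((1 - 1 / p) * Z + d * x * v + m * P / p + Q / q) / P) - (1 - p / q) * (Q / P)"
    using assms by (simp add: field_simps)
  finally show ?thesis .
qed

text \<open>This is y' = -(p-1)|y|^(p/(p-1)) - p d y - mu - lam e^(pt) - w^(q-p), written with
  \<open>K\<close> so that y' < 0 is evident as soon as H > 0.\<close>

lemma y_deriv:
  assumes "t < T"
  shows "(y has_real_derivative - p * K t - (1 - p / q) * a t) (at t)"
proof -
  note w = w_pos[OF assms]
  have wp: "((\<lambda>t. w t powr (p - 1)) has_real_derivative (p - 1) * w t powr (p - 2) * (d * w t + \<phi> (z t))) (at t)"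
    by (rule DERIV_powr[THEN DERIV_cong, OF w_deriv[OF assms] w DERIV_const])
       (use w in \<open>simp add: powr_diff power2_eq_square\<close>)
  have 1: "z t * \<phi> (z t) = \<bar>z t\<bar> powr (p / (p - 1))"
  proof -
    have "1 / (p - 1) + 1 = p / (p - 1)" using p by (simp add: field_simps)
    then show ?thesis using spow_mult_self[of "1 / (p - 1)" "z t"] by (simp add: mult.commute)
  qed
  have 2: "w t powr (p - 1) = w t powr p / w t" "w t powr (q - 1) = w t powr q / w t"
    "w t powr (p - 2) = w t powr p / (w t * w t)" "w t powr (q - p) = w t powr q / w t powr p"
    using w by (simp_all add: powr_diff power2_eq_square)
  let ?P = "w t powr p" and ?Q = "w t powr q" and ?Z = "\<bar>z t\<bar> powr (p / (p - 1))"
  have P: "0 < ?P" using w by simp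
  have "(y has_real_derivative ((- d * z t - (\<mu> + lam * exp (p * t)) * w t powr (p - 1) - w t powr (q - 1)) * w t powr (p - 1)
      - z t * ((p - 1) * w t powr (p - 2) * (d * w t + \<phi> (z t)))) / (w t powr (p - 1) * w t powr (p - 1))) (at t)"
    unfolding y_def[abs_def] by (rule DERIV_divide[OF z_deriv[OF assms] wp]) (use w in auto)
  moreover have "z t * ((p - 1) * w t powr (p - 2) * (d * w t + \<phi> (z t)))
      = (p - 1) * w t powr (p - 2) * (d * w t * z t + ?Z)"
    unfolding 1[symmetric] by (simp add: algebra_simps)
  moreover have "((- d * z t - (\<mu> + lam * exp (p * t)) * (?P / w t) - ?Q / w t) * (?P / w t)
      - (p - 1) * (?P / (w t * w t)) * (d * w t * z t + ?Z)) / ((?P / w t) * (?P / w t))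
    = - p * (((1 - 1 / p) * ?Z + d * w t * z t
     + (\<mu> + lam * exp (p * t)) * ?P / p + ?Q / q) / ?P) - (1 - p / q) * (?Q / ?P)"
    by (rule y_deriv_identity) (use w p pq P in auto)
  ultimately show ?thesis unfolding K_def H_def a_def 2 by (simp only:)
qed

lemma K_eq:
  assumes "t < T"
  shows "K t = g (y t) + lam * exp (p * t) / p + a t / q"
proof -
  note w = w_pos[OF assms]
  have "\<bar>y t\<bar> powr (p / (p - 1)) = \<bar>z t\<bar> powr (p / (p - 1)) / w t powr p"
    using w p by (simp add: y_def abs_divide powr_divide powr_powr)
  moreover have "d * w t * z t / w t powr p = d * y t"
    using w by (simp add: y_def powr_diff)
  moreover have "(\<mu> + lam * exp (p * t)) * w t powr p / p / w t powr p = \<mu> / p + lam * exp (p * t) / p"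
    using w p by (simp add: add_divide_distrib)
  moreover have "w t powr q / q / w t powr p = a t / q"
    using w by (simp add: a_def powr_diff)
  ultimately show ?thesis
    by (simp only: K_def H_def g_def add_divide_distrib times_divide_eq_right[symmetric])
qed

lemma lnw_deriv:
  assumes "t < T"
  shows "((\<lambda>t. ln (w t)) has_real_derivative d + \<phi> (y t)) (at t)"
proof -
  note w = w_pos[OF assms]
  have "z t = y t * w t powr (p - 1)" using w by (simp add: y_def)
  then have "\<phi> (z t) = \<phi> (y t) * w t"
    using w p by (simp add: spow_mult_pos powr_powr)
  then show ?thesis
    by (intro DERIV_cong[OF DERIV_chain2[OF DERIV_ln_divide[OF w] w_deriv[OF assms]]])
       (use w in \<open>simp add: field_simps\<close>)
qed

text \<open>A monotone function that is small at arbitrarily early times is small between them. The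
  direction of monotonicity depends on the sign of \<open>lam\<close>.\<close>

lemma H_tendsto_bot: "(H \<longlongrightarrow> 0) at_bot"
proof (rule tendstoI)
  fix e :: real assume e: "0 < e"
  obtain t1 where t1: "t1 < T" "\<bar>H t1\<bar> < e" using H_frequently_small[OF e] by blast
  have "dist (H t) 0 < e" if t: "t < t1" for t
  proof -
    obtain t2 where t2: "t2 < t" "\<bar>H t2\<bar> < e" using H_frequently_small[OF e] by blast
    consider "0 \<le> lam" | "lam \<le> 0" by linarith
    then show ?thesis
    proof cases
      case 1
      have mono: "H s \<le> H s'" if "s \<le> s'" "s' < T" for s s'
        by (rule DERIV_nonneg_imp_nondecreasing[OF that(1)], rule exI, rule conjI[OF H_deriv])
           (use 1 that in auto)
      show ?thesis using mono[of t2 t] mono[of t t1] t t1 t2 by (auto simp: dist_real_def)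
    next
      case 2
      have mono: "H s \<ge> H s'" if "s \<le> s'" "s' < T" for s s'
        by (rule DERIV_nonpos_imp_nonincreasing[OF that(1)], rule exI, rule conjI[OF H_deriv])
           (use 2 that in \<open>auto intro!: mult_nonpos_nonneg\<close>)
      show ?thesis using mono[of t2 t] mono[of t t1] t t1 t2 by (auto simp: dist_real_def)
    qed
  qed
  then show "\<forall>\<^sub>F t in at_bot. dist (H t) 0 < e"
    using eventually_gt_at_bot eventually_at_bot_dense by blast
qed

section \<open>Limits at the boundary and the convex function g\<close>

text \<open>The factor \<open>exp (d * t)\<close> absorbs the linear term of the equation for
  \<open>z\<close>; what is left of the derivative tends to 0 with \<open>w\<close>, hence is
  bounded near \<open>T\<close>.\<close>

lemma z_end: "\<exists>l. (z \<longlongrightarrow> l) (at_left T)"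
proof -
  let ?f' = "\<lambda>t. - exp (d * t) * ((\<mu> + lam * exp (p * t)) * w t powr (p - 1) + w t powr (q - 1))"
  have D: "((\<lambda>t. exp (d * t) * z t) has_real_derivative ?f' t) (at t)" if "t < T" for t
    by (rule derivative_eq_intros z_deriv[OF that] refl)+ (simp add: algebra_simps)
  have "(?f' \<longlongrightarrow> - exp (d * T) * ((\<mu> + lam * exp (p * T)) * 0 powr (p - 1) + 0 powr (q - 1))) (at_left T)"
    using p pq w_pos
    by (intro tendsto_intros w_end) (auto intro!: eventually_at_leftI[of "T - 1"] less_imp_le)
  then have "\<forall>\<^sub>F t in at_left T. dist (?f' t) 0 < 1"
    by (intro tendstoD) (use p pq in auto)
  then obtain t0 where t0: "t0 < T" "\<And>t. t0 < t \<Longrightarrow> t < T \<Longrightarrow> dist (?f' t) 0 < 1"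
    unfolding eventually_at_left_field by auto
  have "\<exists>l. ((\<lambda>t. exp (d * t) * z t) \<longlongrightarrow> l) (at_left T)"
    by (rule tendsto_at_left_of_bounded_deriv[OF t0(1) D, where C=1])
       (use t0(2) in \<open>auto simp: dist_real_def intro: less_imp_le\<close>)
  then obtain l where "((\<lambda>t. exp (d * t) * z t) \<longlongrightarrow> l) (at_left T)" ..
  then have "((\<lambda>t. exp (- (d * t)) * (exp (d * t) * z t)) \<longlongrightarrow> exp (- (d * T)) * l) (at_left T)"
    by (intro tendsto_intros)
  then show ?thesis by (auto simp: mult.assoc[symmetric] simp flip: exp_add)
qed

definition zT :: real where "zT = (SOME l. (z \<longlongrightarrow> l) (at_left T))"

lemma z_tendsto: "(z \<longlongrightarrow> zT) (at_left T)"
  unfolding zT_def using someI_ex[OF z_end] .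

lemma H_end: "(H \<longlongrightarrow> (1 - 1 / p) * \<bar>zT\<bar> powr (p / (p - 1))) (at_left T)"
proof -
  have "(H \<longlongrightarrow> (1 - 1 / p) * \<bar>zT\<bar> powr (p / (p - 1)) + d * 0 * zT
     + (\<mu> + lam * exp (p * T)) * 0 powr p / p + 0 powr q / q) (at_left T)"
    unfolding H_def[abs_def] using p pq w_pos
    by (intro tendsto_intros w_end z_tendsto) (auto intro!: eventually_at_leftI[of "T - 1"] less_imp_le)
  then show ?thesis using p pq by simp
qed

text \<open>The derivative \<open>d + \<phi>\<close> of \<open>g\<close> is increasing, so
  \<open>g\<close> is convex and lies above its tangent at \<open>s\<close>. With a zero of
  \<open>g\<close> in place of \<open>s'\<close> this bounds the distance from \<open>s\<close> to
  that zero by means of \<open>- g s\<close>.\<close>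

lemma g_strict_decreasing_left:
  assumes "0 < d + \<phi> s" "s < s'" shows "g s + (d + \<phi> s) * (s' - s) \<le> g s'"
proof -
  have 1: "1 < p / (p - 1)" "p / (p - 1) - 1 = 1 / (p - 1)" "(1 - 1 / p) * (p / (p - 1)) = 1"
    using p by (auto simp: field_simps)
  have D: "(g has_real_derivative d + \<phi> x) (at x)" for x
    unfolding g_def[abs_def]
    by (rule derivative_eq_intros has_real_derivative_abs_powr[OF 1(1), unfolded 1(2)] refl)+
       (simp only: mult.assoc[symmetric] 1(3) mult.commute[of _ "1 - 1 / p"], simp)
  obtain x where x: "s < x" "x < s'" "g s' - g s = (s' - s) * (d + \<phi> x)"
    using MVT2[OF assms(2) D] by auto
  have "\<phi> s \<le> \<phi> x" using x p by (intro spow_mono) auto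
  then have "(s' - s) * (d + \<phi> s) \<le> (s' - s) * (d + \<phi> x)" using assms by (intro mult_left_mono) auto
  then show ?thesis using x by (simp add: algebra_simps)
qed

lemma g_large:
  obtains M where "1 \<le> M" "\<And>s. M \<le> \<bar>s\<bar> \<Longrightarrow> (1 - 1 / p) / 2 * \<bar>s\<bar> powr (p / (p - 1)) \<le> g s"
proof -
  define c where "c = (1 - 1 / p) / 2"
  have c: "0 < c" using p by (simp add: c_def)
  \<comment> \<open>\<open>B\<close> is the size |s|^(1/(p-1)) must reach for half of the leading
    term to absorb d s + mu/p; the corresponding |s| is \<open>B powr (p - 1)\<close>.\<close>
  define B where "B = (d + \<bar>\<mu>\<bar> / p) / c"
  have B: "0 \<le> B" using c d p by (simp add: B_def)
  define M where "M = max 1 (B powr (p - 1))"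
  show ?thesis
  proof (rule that)
    show "1 \<le> M" by (simp add: M_def)
    fix s assume s: "M \<le> \<bar>s\<bar>"
    have "B = (B powr (p - 1)) powr (1 / (p - 1))" using B p by (cases "B = 0") (auto simp: powr_powr)
    also have "\<dots> \<le> \<bar>s\<bar> powr (1 / (p - 1))"
      using s p by (intro powr_mono2) (auto simp: M_def)
    finally have "d + \<bar>\<mu>\<bar> / p \<le> c * \<bar>s\<bar> powr (1 / (p - 1))"
      using c by (simp add: B_def field_simps)
    then have 1: "(d + \<bar>\<mu>\<bar> / p) * \<bar>s\<bar> \<le> c * \<bar>s\<bar> powr (1 / (p - 1)) * \<bar>s\<bar>"
      by (rule mult_right_mono) simp
    have "1 / (p - 1) + 1 = p / (p - 1)" using p by (simp add: field_simps)
    then have 2: "\<bar>s\<bar> powr (1 / (p - 1)) * \<bar>s\<bar> = \<bar>s\<bar> powr (p / (p - 1))"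
      using powr_add[of "\<bar>s\<bar>" "1 / (p - 1)" 1] by simp
    have "1 \<le> \<bar>s\<bar>" using s by (simp add: M_def)
    then have "\<bar>\<mu>\<bar> / p * 1 \<le> \<bar>\<mu>\<bar> / p * \<bar>s\<bar>" using p by (intro mult_left_mono) auto
    moreover have "- (d * \<bar>s\<bar>) \<le> d * s" using d mult_left_mono[of "- \<bar>s\<bar>" s d] by simp
    moreover have "- (\<bar>\<mu>\<bar> / p) \<le> \<mu> / p" using p by (simp add: field_simps)
    ultimately have "- (c * \<bar>s\<bar> powr (p / (p - 1))) \<le> d * s + \<mu> / p"
      using 1 unfolding mult.assoc 2 by (simp add: algebra_simps)
    then show "(1 - 1 / p) / 2 * \<bar>s\<bar> powr (p / (p - 1)) \<le> g s"
      by (simp add: g_def c_def field_simps)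
  qed
qed

lemma isCont_g: "isCont g s"
  unfolding g_def[abs_def] using p by (intro continuous_intros) auto

lemma a_bot: "(a \<longlongrightarrow> 0) at_bot"
proof -
  have "((\<lambda>t. w t powr (q - p)) \<longlongrightarrow> 0 powr (q - p)) at_bot"
    using pq w_pos by (intro tendsto_intros w_bot) (auto intro!: eventually_mono[OF eventually_gt_at_bot[of T]] less_imp_le)
  then show ?thesis using pq by (simp add: a_def[abs_def])
qed

lemma a_end: "(a \<longlongrightarrow> 0) (at_left T)"
proof -
  have "((\<lambda>t. w t powr (q - p)) \<longlongrightarrow> 0 powr (q - p)) (at_left T)"
    using pq w_pos by (intro tendsto_intros w_end) (auto intro!: eventually_at_leftI[of "T - 1"] less_imp_le)
  then show ?thesis using pq by (simp add: a_def[abs_def])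
qed

lemma exp_pt_bot: "((\<lambda>t. exp (p * t)) \<longlongrightarrow> 0) at_bot"
  using p by (auto intro!: filterlim_compose[OF exp_at_bot]
        filterlim_tendsto_pos_mult_at_bot[OF tendsto_const] filterlim_ident)

text \<open>The logarithmic derivative of \<open>w\<close> is d + phi(y). If it is bounded below on
  an interval of finite length, ln w stays bounded below, which contradicts w -> 0 at
  \<open>T\<close>.\<close>

lemma not_y_bounded_below_at_end:
  assumes "t0 < T" "\<And>t. t0 < t \<Longrightarrow> t < T \<Longrightarrow> M \<le> y t" shows False
proof -
  let ?C = "d + \<phi> M"
  have "ln (w t0') + ?C * (t - t0') \<le> ln (w t)" if "t0 < t0'" "t0' \<le> t" "t < T" for t t0'
  proof -
    have "ln (w t0') - ?C * t0' \<le> ln (w t) - ?C * t"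
    proof (rule DERIV_nonneg_imp_nondecreasing[OF that(2)])
      fix x assume x: "t0' \<le> x" "x \<le> t"
      have "((\<lambda>t. ln (w t) - ?C * t) has_real_derivative d + \<phi> (y x) - ?C) (at x)"
        using x that by (intro DERIV_diff lnw_deriv DERIV_cmult_Id) auto
      moreover have "0 \<le> d + \<phi> (y x) - ?C"
        using spow_mono[of "1 / (p - 1)" M "y x"] assms(2)[of x] x that p by simp
      ultimately show "\<exists>D. ((\<lambda>t. ln (w t) - ?C * t) has_real_derivative D) (at x) \<and> 0 \<le> D" by blast
    qed
    then show ?thesis by (simp add: algebra_simps)
  qed
  note b = this
  define t1 where "t1 = (t0 + T) / 2"
  have t1: "t0 < t1" "t1 < T" using assms(1) by (auto simp: t1_def)
  have "exp (ln (w t1) + ?C * (t - t1)) \<le> w t" if "t1 \<le> t" "t < T" for t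
  proof -
    have "exp (ln (w t1) + ?C * (t - t1)) \<le> exp (ln (w t))" using b[OF t1(1) that] by simp
    then show ?thesis using w_pos[OF that(2)] by simp
  qed
  then have "\<forall>\<^sub>F t in at_left T. exp (ln (w t1) + ?C * (t - t1)) \<le> w t"
    using t1 by (auto intro!: eventually_at_leftI[of t1])
  moreover have "((\<lambda>t. exp (ln (w t1) + ?C * (t - t1))) \<longlongrightarrow> exp (ln (w t1) + ?C * (T - t1))) (at_left T)"
    by (intro tendsto_intros)
  ultimately have "exp (ln (w t1) + ?C * (T - t1)) \<le> 0"
    using tendsto_le[OF _ w_end] by (metis trivial_limit_at_left_real)
  then show False by simp
qed

section \<open>Nonexistence for nonpositive lambda\<close>

lemma lam_pos: "0 < lam"
proof (rule ccontr)
  assume "\<not> 0 < lam"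
  then have lam: "lam \<le> 0" by simp
  have anti: "H s' \<le> H s" if "s \<le> s'" "s' < T" for s s'
    by (rule DERIV_nonpos_imp_nonincreasing[OF that(1)], rule exI, rule conjI[OF H_deriv])
           (use lam that in \<open>auto intro!: mult_nonpos_nonneg\<close>)
  have H0: "H t = 0" if t: "t < T" for t
  proof (rule antisym)
    show "H t \<le> 0"
      by (rule tendsto_lowerbound[OF H_tendsto_bot])
         (auto intro!: eventually_mono[OF eventually_le_at_bot[of t]] anti t)
    have "(1 - 1 / p) * \<bar>zT\<bar> powr (p / (p - 1)) \<le> H t"
      by (rule tendsto_upperbound[OF H_end])
         (use t in \<open>auto intro!: eventually_at_leftI[of t] anti\<close>)
    then show "0 \<le> H t" using p by (smt (verit) divide_le_eq_1_pos mult_nonneg_nonneg powr_ge_zero)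
  qed
  have "lam = 0"
  proof -
    have "((\<lambda>t. 0) has_real_derivative lam * exp (p * (T - 1)) * w (T - 1) powr p) (at (T - 1))"
      by (rule has_field_derivative_transform_within[OF H_deriv, where d=1]) (auto simp: H0 dist_real_def)
    then have "lam * exp (p * (T - 1)) * w (T - 1) powr p = 0"
      using DERIV_unique[OF _ DERIV_const] by blast
    then show ?thesis using w_pos[of "T - 1"] by simp
  qed
  \<comment> \<open>With H = 0 and lam = 0 the formula for \<open>K\<close> gives g(y) = -a/q < 0,
    whereas \<open>g\<close> is nonnegative far to the left; so y cannot get there.\<close>
  then have ga: "g (y t) = - a t / q" if "t < T" for t
  proof -
    have "K t = 0" using H0[OF that] by (simp add: K_def)
    then show ?thesis using K_eq[OF that] unfolding \<open>lam = 0\<close> by simp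
  qed
  have "\<forall>\<^sub>F t in at_left T. a t < q" using order_tendstoD(2)[OF a_end, of q] p pq by auto
  then obtain t0 where t0: "t0 < T" "\<And>t. t0 < t \<Longrightarrow> t < T \<Longrightarrow> a t < q"
    unfolding eventually_at_left_field by auto
  obtain M0 where M0: "1 \<le> M0" "\<And>s. M0 \<le> \<bar>s\<bar> \<Longrightarrow> (1 - 1 / p) / 2 * \<bar>s\<bar> powr (p / (p - 1)) \<le> g s"
    using g_large by blast
  have M: "0 \<le> g s" if "s \<le> - M0" for s
    using order_trans[OF _ M0(2)[of s], of 0] M0(1) that p by simp
  define M where "M = - M0"
  note M = M[folded M_def]
  have "M \<le> y t" if "t0 < t" "t < T" for t
  proof (rule ccontr)
    assume "\<not> M \<le> y t"
    then have "0 \<le> g (y t)" using M by simp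
    then show False using ga[OF that(2)] a_pos[OF that(2)] p pq by (simp add: divide_simps)
  qed
  then show False using not_y_bounded_below_at_end[OF t0(1)] by blast
qed

section \<open>Asymptotics at both ends for positive lambda\<close>

lemma H_pos: "t < T \<Longrightarrow> 0 < H t"
proof -
  assume t: "t < T"
  have mono: "H s < H s'" if "s < s'" "s' < T" for s s'
    by (rule DERIV_pos_imp_increasing[OF that(1)], rule exI, rule conjI[OF H_deriv])
       (use lam_pos that w_pos in \<open>auto simp: less_imp_neq[symmetric]\<close>)
  have "0 \<le> H (t - 1)"
    by (rule tendsto_upperbound[OF H_tendsto_bot])
       (use t in \<open>auto intro!: eventually_mono[OF eventually_gt_at_bot[of "t - 1"]] less_imp_le[OF mono]\<close>)
  also have "\<dots> < H t" using mono t by simp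
  finally show ?thesis .
qed

lemma K_pos: "t < T \<Longrightarrow> 0 < K t"
  using H_pos w_pos[of t] by (simp add: K_def)

lemma y_strict_antimono:
  assumes "s < s'" "s' < T" shows "y s' < y s"
proof (rule DERIV_neg_imp_decreasing[OF assms(1)], rule exI, rule conjI[OF y_deriv])
  fix x assume x: "s \<le> x" "x \<le> s'"
  have "0 < p * K x" "0 < (1 - p / q) * a x"
    using K_pos[of x] a_pos[of x] x assms p pq by auto
  then show "- p * K x - (1 - p / q) * a x < 0" by linarith
qed (use assms in auto)

text \<open>The limit of \<open>H\<close> at \<open>T\<close> is positive and depends on
  \<open>zT\<close> only, which excludes 0. A positive \<open>zT\<close> would make y nonnegative
  near \<open>T\<close>, which is incompatible with w -> 0.\<close>

lemma zT_neg: "zT < 0"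
proof -
  have mono: "H s \<le> H s'" if "s \<le> s'" "s' < T" for s s'
    by (rule DERIV_nonneg_imp_nondecreasing[OF that(1)], rule exI, rule conjI[OF H_deriv])
       (use lam_pos that in auto)
  have "H (T - 1) \<le> (1 - 1 / p) * \<bar>zT\<bar> powr (p / (p - 1))"
    by (rule tendsto_lowerbound[OF H_end])
       (auto intro!: eventually_at_leftI[of "T - 1"] mono)
  then have "zT \<noteq> 0" using H_pos[of "T - 1"] by auto
  moreover have "\<not> 0 < zT"
  proof
    assume "0 < zT"
    then have "\<forall>\<^sub>F t in at_left T. 0 < z t" using order_tendstoD(1)[OF z_tendsto] by blast
    then obtain t0 where t0: "t0 < T" "\<And>t. t0 < t \<Longrightarrow> t < T \<Longrightarrow> 0 < z t"
      unfolding eventually_at_left_field by auto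
    have "0 \<le> y t" if "t0 < t" "t < T" for t
      using t0(2)[OF that] w_pos[OF that(2)] by (simp add: y_def)
    then show False using not_y_bounded_below_at_end[OF t0(1)] by blast
  qed
  ultimately show ?thesis by linarith
qed

lemma y_deriv_eq:
  assumes "t < T"
  shows "- p * K t - (1 - p / q) * a t = - (p * g (y t) + lam * exp (p * t) + a t)"
  using K_eq[OF assms] p pq by (simp add: field_simps)

text \<open>The superlinear term of the Riccati equation would make a large value of
  \<open>y\<close> blow up at a finite earlier time.\<close>

lemma y_bounded_above: "\<exists>M. \<forall>t<T. y t < M"
proof -
  obtain M where M: "1 \<le> M" "\<And>s. M \<le> \<bar>s\<bar> \<Longrightarrow> (1 - 1 / p) / 2 * \<bar>s\<bar> powr (p / (p - 1)) \<le> g s"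
    using g_large by blast
  have "y t0 < M" if t0: "t0 < T" for t0
  proof (rule ccontr)
    assume "\<not> y t0 < M"
    then have yM: "M \<le> y t" if "t \<le> t0" for t
      using y_strict_antimono[of t t0] that t0 by (cases "t = t0") auto
    \<comment> \<open>This power linearises y' <= -((p-1)/2) y^(p/(p-1)): along it the derivative is
      at least 1/2.\<close>
    let ?v = "\<lambda>t. y t powr (- (1 / (p - 1)))"
    have v: "?v t - t / 2 \<le> ?v t0 - t0 / 2" if "t \<le> t0" for t
    proof (rule DERIV_nonneg_imp_nondecreasing[OF that])
      fix x assume x: "t \<le> x" "x \<le> t0"
      have y1: "1 \<le> y x" using yM[of x] x M by simp
      let ?D = "- p * K x - (1 - p / q) * a x"
      have "- (1 / (p - 1)) - 1 = - (p / (p - 1))" using p by (simp add: field_simps)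
      then have D: "(?v has_real_derivative (- (1 / (p - 1))) * y x powr (- (p / (p - 1))) * ?D) (at x)"
        using DERIV_chain2[OF has_real_derivative_powr[of "y x" "- (1 / (p - 1))"] y_deriv[of x]] y1 x t0 by simp
      have "(1 - 1 / p) / 2 * y x powr (p / (p - 1)) \<le> g (y x)"
        using M(2)[of "y x"] yM[of x] x y1 by simp
      then have "p * ((1 - 1 / p) / 2 * y x powr (p / (p - 1))) \<le> p * g (y x)"
        using p by (intro mult_left_mono) auto
      moreover have "?D \<le> - (p * g (y x))"
      proof -
        have "x < T" using x t0 by simp
        moreover have "0 < lam * exp (p * x)" using lam_pos by simp
        ultimately show ?thesis using y_deriv_eq[of x] a_pos[of x] by linarith
      qed
      moreover have "p * ((1 - 1 / p) / 2) = (p - 1) / 2" using p by (simp add: field_simps)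
      ultimately have "(p - 1) / 2 * y x powr (p / (p - 1)) \<le> - ?D"
        by (simp only: mult.assoc[symmetric])
      then have "(1 / (p - 1)) * y x powr (- (p / (p - 1))) * ((p - 1) / 2 * y x powr (p / (p - 1)))
          \<le> (1 / (p - 1)) * y x powr (- (p / (p - 1))) * - ?D"
        using p by (intro mult_left_mono) auto
      moreover have "(1 / (p - 1)) * y x powr (- (p / (p - 1))) * ((p - 1) / 2 * y x powr (p / (p - 1))) = 1 / 2"
        using p y1 by (simp add: powr_minus)
      ultimately have "0 \<le> (- (1 / (p - 1))) * y x powr (- (p / (p - 1))) * ?D - 1 / 2"
        by (simp only: mult_minus_left mult_minus_right)
      moreover have "((\<lambda>t. ?v t - t / 2) has_real_derivative
          (- (1 / (p - 1))) * y x powr (- (p / (p - 1))) * ?D - 1 / 2) (at x)"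
        by (intro DERIV_diff D DERIV_cdivide DERIV_ident)
      ultimately show "\<exists>D. ((\<lambda>t. ?v t - t / 2) has_real_derivative D) (at x) \<and> 0 \<le> D" by blast
    qed
    \<comment> \<open>At this earlier time the linear upper bound for \<open>?v\<close> has dropped
      to -1.\<close>
    have "0 \<le> ?v (t0 - 2 * ?v t0 - 2)" by simp
    moreover have "?v (t0 - 2 * ?v t0 - 2) \<le> -1"
      using v[of "t0 - 2 * ?v t0 - 2"] by (simp add: field_simps)
    ultimately show False by linarith
  qed
  then show ?thesis by blast
qed

definition y0 :: real where "y0 = Sup (y ` {..<T})"

lemma bdd_above_y: "bdd_above (y ` {..<T})"
proof -
  obtain M where "\<forall>t<T. y t < M" using y_bounded_above by blast
  then show ?thesis by (intro bdd_aboveI2[of _ _ M]) (auto intro: less_imp_le)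
qed

lemma y_less_y0: "t < T \<Longrightarrow> y t < y0"
proof -
  assume t: "t < T"
  have "y (t - 1) \<le> y0" unfolding y0_def using t bdd_above_y by (intro cSup_upper) auto
  then show ?thesis using y_strict_antimono[of "t - 1" t] t by simp
qed

lemma y_bot: "(y \<longlongrightarrow> y0) at_bot"
proof (rule order_tendstoI)
  fix c assume "c < y0"
  then obtain t1 where t1: "t1 < T" "c < y t1"
    unfolding y0_def by (subst (asm) less_cSup_iff) (use bdd_above_y in \<open>auto intro!: exI[of _ "T - 1"]\<close>)
  show "\<forall>\<^sub>F t in at_bot. c < y t"
    using eventually_gt_at_bot[of t1] by eventually_elim (use y_strict_antimono t1 in fastforce)
next
  fix c assume "y0 < c"
  then show "\<forall>\<^sub>F t in at_bot. y t < c"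
    by (intro eventually_mono[OF eventually_gt_at_bot[of T]]) (use y_less_y0 in fastforce)
qed

text \<open>Otherwise (ln w)' = d + phi(y) would be nonpositive everywhere, since y < y0, and w
  could not tend to 0 at -infinity. The number is the exponential rate of w there.\<close>

lemma gamma_pos: "0 < d + \<phi> y0"
proof (rule ccontr)
  assume n: "\<not> 0 < d + \<phi> y0"
  have le: "ln (w (T - 1)) \<le> ln (w t)" if "t \<le> T - 1" for t
  proof (rule DERIV_nonpos_imp_nonincreasing[OF that], rule exI, rule conjI[OF lnw_deriv])
    fix x assume "t \<le> x" "x \<le> T - 1"
    then show "d + \<phi> (y x) \<le> 0" using spow_mono[of "1 / (p - 1)" "y x" y0] y_less_y0[of x] p n by simp
  qed auto
  have "w (T - 1) \<le> 0"
  proof (rule tendsto_lowerbound[OF w_bot])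
    show "\<forall>\<^sub>F t in at_bot. w (T - 1) \<le> w t"
      using eventually_le_at_bot[of "T - 1"]
      by eventually_elim (use le w_pos in fastforce)
  qed simp
  then show False using w_pos[of "T - 1"] by simp
qed

text \<open>The limit of K > 0 gives g(y0) >= 0. If g(y0) were positive, y' would stay below a
  negative constant near -infinity and y would exceed its supremum.\<close>

lemma g_y0: "g y0 = 0"
proof -
  have gy: "((\<lambda>t. g (y t)) \<longlongrightarrow> g y0) at_bot"
    by (rule isCont_tendsto_compose[OF isCont_g y_bot])
  have "((\<lambda>t. g (y t) + lam * exp (p * t) / p + a t / q) \<longlongrightarrow> g y0 + lam * 0 / p + 0 / q) at_bot"
    using p pq by (intro tendsto_intros gy exp_pt_bot a_bot) auto
  then have "0 \<le> g y0 + lam * 0 / p + 0 / q"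
  proof (rule tendsto_lowerbound)
    show "\<forall>\<^sub>F t in at_bot. 0 \<le> g (y t) + lam * exp (p * t) / p + a t / q"
      using eventually_gt_at_bot[of T] by eventually_elim (use K_eq K_pos in \<open>metis less_imp_le\<close>)
  qed simp
  then have "0 \<le> g y0" by simp
  moreover have "\<not> 0 < g y0"
  proof
    assume pos: "0 < g y0"
    then have "\<forall>\<^sub>F t in at_bot. g y0 / 2 < g (y t)"
      using order_tendstoD(1)[OF gy, of "g y0 / 2"] by simp
    with eventually_gt_at_bot[of T] have "\<forall>\<^sub>F t in at_bot. t < T \<and> g y0 / 2 < g (y t)"
      by eventually_elim auto
    then obtain t1 where t1: "\<And>t. t \<le> t1 \<Longrightarrow> t < T \<and> g y0 / 2 < g (y t)"
      unfolding eventually_at_bot_linorder by auto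
    let ?c = "p * g y0 / 2"
    have c: "0 < ?c" using p pos by simp
    have "y t1 + ?c * t1 \<le> y t + ?c * t" if "t \<le> t1" for t
    proof (rule DERIV_nonpos_imp_nonincreasing[OF that])
      fix x assume x: "t \<le> x" "x \<le> t1"
      have "((\<lambda>t. y t + ?c * t) has_real_derivative (- p * K x - (1 - p / q) * a x) + ?c) (at x)"
        using x t1 by (intro DERIV_add y_deriv DERIV_cmult_Id) auto
      moreover have "(- p * K x - (1 - p / q) * a x) + ?c \<le> 0"
      proof -
        have "p * (g y0 / 2) \<le> p * g (y x)" using t1[of x] x p by (intro mult_left_mono) auto
        moreover have "0 \<le> lam * exp (p * x)" using lam_pos by simp
        ultimately show ?thesis using y_deriv_eq[of x] a_pos[of x] t1[of x] x by simp
      qed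
      ultimately show "\<exists>D. ((\<lambda>t. y t + ?c * t) has_real_derivative D) (at x) \<and> D \<le> 0" by blast
    qed
    note low = this
    \<comment> \<open>The backward time after which the linear lower bound for \<open>y\<close>
      reaches \<open>y0\<close>.\<close>
    define h where "h = (y0 - y t1) / ?c"
    have h: "0 \<le> h" "?c * h = y0 - y t1" using y_less_y0[of t1] t1[of t1] c by (auto simp: h_def)
    have "y t1 + ?c * t1 \<le> y (t1 - h) + ?c * (t1 - h)" using low[of "t1 - h"] h by simp
    moreover have "?c * (t1 - h) = ?c * t1 - ?c * h" by (rule right_diff_distrib)
    ultimately have "y0 \<le> y (t1 - h)" using h(2) by linarith
    moreover have "t1 - h < T" using h t1[of "t1 - h"] by simp
    ultimately show False using y_less_y0 by fastforce
  qed
  ultimately show ?thesis by simp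
qed

text \<open>
  Since \<open>K > 0\<close>, the distance of \<open>y\<close> to the zero \<open>y0\<close> of \<open>g\<close> is controlled by \<open>a + e\<^sup>p\<^sup>t\<close>, which decays
  exponentially. This makes the logarithmic derivative of the quotient of two solutions integrable
  at \<open>-\<infinity>\<close>.
\<close>

lemma phi_y_exp_bound:
  "\<exists>C e t1. 0 < C \<and> 0 < e \<and> t1 < T \<and> (\<forall>t<t1. \<bar>\<phi> (y t) - \<phi> y0\<bar> \<le> C * exp (e * t))"
proof -
  \<comment> \<open>Half of the limiting rate of ln w; near -infinity the actual rate exceeds it, so
    w is at most a constant times e^(ct).\<close>
  define c where "c = (d + \<phi> y0) / 2"
  have c: "0 < c" using gamma_pos by (simp add: c_def)
  obtain Ch b r where Ch: "0 < Ch" "0 < b" "0 < r"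
    "\<And>s. \<bar>s - y0\<bar> < r \<Longrightarrow> \<bar>\<phi> s - \<phi> y0\<bar> \<le> Ch * \<bar>s - y0\<bar> powr b"
    using spow_holder_at[of "1 / (p - 1)" y0] p by auto
  have "((\<lambda>t. \<phi> (y t)) \<longlongrightarrow> \<phi> y0) at_bot"
    by (rule isCont_tendsto_compose[OF isCont_spow y_bot]) (use p in auto)
  then have "\<forall>\<^sub>F t in at_bot. \<phi> y0 - c < \<phi> (y t)"
    by (rule order_tendstoD(1)) (use c in simp)
  moreover have "\<forall>\<^sub>F t in at_bot. y0 - r < y t"
    by (rule order_tendstoD(1)[OF y_bot]) (use Ch in simp)
  moreover note eventually_gt_at_bot[of "min 0 T"]
  ultimately have "\<forall>\<^sub>F t in at_bot. \<phi> y0 - c < \<phi> (y t) \<and> y0 - r < y t \<and> t < min 0 T"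
    by eventually_elim auto
  then obtain t1 where t1: "\<And>t. t \<le> t1 \<Longrightarrow> \<phi> y0 - c < \<phi> (y t) \<and> y0 - r < y t \<and> t < min 0 T"
    unfolding eventually_at_bot_linorder by auto
  have lw: "ln (w t) - c * t \<le> ln (w t1) - c * t1" if "t \<le> t1" for t
  proof (rule DERIV_nonneg_imp_nondecreasing[OF that])
    fix x assume x: "t \<le> x" "x \<le> t1"
    have "((\<lambda>t. ln (w t) - c * t) has_real_derivative (d + \<phi> (y x)) - c) (at x)"
      using x t1[of x] by (intro DERIV_diff lnw_deriv DERIV_cmult_Id) auto
    moreover have "0 \<le> d + \<phi> (y x) - c" using t1[of x] x by (simp add: c_def field_simps)
    ultimately show "\<exists>D. ((\<lambda>t. ln (w t) - c * t) has_real_derivative D) (at x) \<and> 0 \<le> D" by blast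
  qed
  define A where "A = exp ((q - p) * (ln (w t1) - c * t1))"
  have A: "0 < A" by (simp add: A_def)
  \<comment> \<open>The slower of the decay rates of \<open>a\<close> and of
    \<open>exp (p * t)\<close>; for negative t it gives the larger exponential.\<close>
  define e0 where "e0 = min ((q - p) * c) p"
  have e0: "0 < e0" using c p pq by (simp add: e0_def)
  define C1 where "C1 = (A / q + lam / p) / c"
  have C1: "0 < C1" using A lam_pos p pq c by (simp add: C1_def add_pos_pos)
  have bound: "\<bar>y t - y0\<bar> \<le> C1 * exp (e0 * t)" if t: "t < t1" for t
  proof -
    have tT: "t < T" "t < 0" using t1[of t] t by auto
    have "a t = exp ((q - p) * ln (w t))" using w_pos[OF tT(1)] by (simp add: a_def powr_def)
    also have "\<dots> \<le> exp ((q - p) * (ln (w t1) - c * t1 + c * t))"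
      using lw[of t] t pq by simp
    also have "\<dots> = A * exp ((q - p) * c * t)" by (simp add: A_def algebra_simps flip: exp_add)
    also have "\<dots> \<le> A * exp (e0 * t)"
      using A tT(2) by (simp add: e0_def mult_right_mono_neg)
    finally have a: "a t / q \<le> A / q * exp (e0 * t)" using p pq by (simp add: divide_right_mono)
    have "lam * exp (p * t) \<le> lam * exp (e0 * t)"
      using lam_pos tT(2) by (simp add: e0_def mult_right_mono_neg)
    then have b: "lam * exp (p * t) / p \<le> lam / p * exp (e0 * t)" using p by (simp add: divide_right_mono)
    have phi: "c \<le> d + \<phi> (y t)" using t1[of t] t by (simp add: c_def field_simps)
    \<comment> \<open>Tangent inequality at \<open>y t\<close> together with g(y0) = 0. Positivity
      of \<open>K\<close> then bounds -g(y) by a/q + lam e^(pt)/p.\<close>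
    then have "g (y t) + (d + \<phi> (y t)) * (y0 - y t) \<le> 0"
      using g_strict_decreasing_left[of "y t" y0] y_less_y0[OF tT(1)] c g_y0 by simp
    moreover have "c * (y0 - y t) \<le> (d + \<phi> (y t)) * (y0 - y t)"
      using phi y_less_y0[OF tT(1)] by (intro mult_right_mono) auto
    ultimately have "c * (y0 - y t) \<le> (A / q + lam / p) * exp (e0 * t)"
      using a b K_pos[OF tT(1)] K_eq[OF tT(1)] by (simp add: distrib_right)
    then have "y0 - y t \<le> C1 * exp (e0 * t)"
      using c by (simp add: C1_def field_simps)
    then show ?thesis using y_less_y0[OF tT(1)] by simp
  qed
  have "\<bar>\<phi> (y t) - \<phi> y0\<bar> \<le> Ch * C1 powr b * exp ((b * e0) * t)" if t: "t < t1" for t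
  proof -
    have "\<bar>\<phi> (y t) - \<phi> y0\<bar> \<le> Ch * \<bar>y t - y0\<bar> powr b"
      using Ch(4)[of "y t"] t1[of t] t y_less_y0[of t] by simp
    also have "\<dots> \<le> Ch * (C1 * exp (e0 * t)) powr b"
      using Ch bound[OF t] by (intro mult_left_mono powr_mono2) auto
    also have "\<dots> = Ch * C1 powr b * exp ((b * e0) * t)"
      using C1 by (simp add: powr_mult exp_powr_real mult_ac)
    finally show ?thesis .
  qed
  then show ?thesis using Ch C1 e0 t1[of t1] by (intro exI[of _ "Ch * C1 powr b"] exI[of _ "b * e0"] exI[of _ t1]) auto
qed

end

subsection \<open>Comparison of two solutions\<close>

locale emden_fowler_pair =
  s1: emden_fowler p q d \<mu> lam T w1 z1 + s2: emden_fowler p q d \<mu> lam T w2 z2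
  for p q d \<mu> lam T w1 z1 w2 z2
begin

definition r :: "real \<Rightarrow> real" where "r t = w2 t / w1 t"

lemma r_pos: "t < T \<Longrightarrow> 0 < r t"
  using s1.w_pos[of t] s2.w_pos[of t] by (simp add: r_def)

lemma ln_r_deriv:
  assumes "t < T" shows "((\<lambda>t. ln (w2 t) - ln (w1 t)) has_real_derivative s1.\<phi> (s2.y t) - s1.\<phi> (s1.y t)) (at t)"
  using DERIV_diff[OF s2.lnw_deriv[OF assms] s1.lnw_deriv[OF assms]] by simp

lemma ln_r: "t < T \<Longrightarrow> ln (r t) = ln (w2 t) - ln (w1 t)"
  using s1.w_pos[of t] s2.w_pos[of t] by (simp add: r_def ln_div)

lemma isCont_r: "t < T \<Longrightarrow> isCont r t"
  unfolding r_def[abs_def] using s1.w_pos[of t] DERIV_isCont[OF s1.w_deriv] DERIV_isCont[OF s2.w_deriv]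
  by (intro continuous_intros) auto

lemma w2_powr: "t < T \<Longrightarrow> w2 t powr p = r t powr p * w1 t powr p"
  using s1.w_pos[of t] s2.w_pos[of t] by (simp add: r_def powr_divide)

text \<open>By w2^p = r^p w1^p the two Hamiltonian derivatives are proportional, and the comparison
  of \<open>r t\<close> with \<open>c\<close> decides the sign.\<close>

lemma H_comb_deriv:
  assumes "t < T"
  shows "((\<lambda>s. s2.H s - c powr p * s1.H s) has_real_derivative
     lam * exp (p * t) * w1 t powr p * (r t powr p - c powr p)) (at t)"
  by (rule DERIV_cong[OF DERIV_diff[OF s2.H_deriv DERIV_cmult[OF s1.H_deriv]]])
     (use assms in \<open>auto simp: w2_powr algebra_simps\<close>)

lemma H_comb_bot: "((\<lambda>s. s2.H s - c * s1.H s) \<longlongrightarrow> 0) at_bot"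
  using tendsto_diff[OF s2.H_tendsto_bot tendsto_mult[OF tendsto_const s1.H_tendsto_bot, of c]] by simp

lemma H_comb_antimono:
  assumes "\<And>s. s < T \<Longrightarrow> r s \<le> c" "s \<le> s'" "s' < T"
  shows "s2.H s' - c powr p * s1.H s' \<le> s2.H s - c powr p * s1.H s"
proof (rule DERIV_nonpos_imp_nonincreasing[OF assms(2)], rule exI, rule conjI[OF H_comb_deriv])
  fix x assume x: "s \<le> x" "x \<le> s'"
  then have "r x powr p \<le> c powr p"
    using assms r_pos[of x] s1.p by (intro powr_mono2) auto
  then show "lam * exp (p * x) * w1 x powr p * (r x powr p - c powr p) \<le> 0"
    using s1.lam_pos by (intro mult_nonneg_nonpos) auto
qed (use assms in auto)

text \<open>The combination starts from 0 at -infinity and never increases; just after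
  \<open>t\<close>, where r < c, it decreases strictly.\<close>

lemma H_comb_neg:
  assumes c: "\<And>s. s < T \<Longrightarrow> r s \<le> c" and t: "t < t0" "t0 < T" "r t < c"
  shows "s2.H t0 - c powr p * s1.H t0 < 0"
proof -
  let ?F = "\<lambda>s. s2.H s - c powr p * s1.H s"
  have "?F t \<le> 0"
    by (rule tendsto_lowerbound[OF H_comb_bot])
       (use t in \<open>auto intro!: eventually_mono[OF eventually_le_at_bot[of t]] H_comb_antimono c\<close>)
  moreover have "lam * exp (p * t) * w1 t powr p * (r t powr p - c powr p) < 0"
    using s1.lam_pos s1.w_pos[of t] r_pos[of t] t s1.p powr_less_mono2[of p "r t" c]
    by (intro mult_pos_neg) auto
  then obtain e where e: "0 < e" "\<And>h. 0 < h \<Longrightarrow> h < e \<Longrightarrow> ?F (t + h) < ?F t"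
    using DERIV_neg_dec_right[OF H_comb_deriv[of t c]] t by auto
  define h where "h = min (e / 2) (t0 - t)"
  have h: "0 < h" "h < e" "t + h \<le> t0" using e t by (auto simp: h_def)
  have "?F t0 \<le> ?F (t + h)" using H_comb_antimono[of c "t + h" t0] c h t by auto
  ultimately show ?thesis using e(2)[OF h(1,2)] by linarith
qed

lemma no_interior_max:
  assumes t0: "t0 < T" and max: "\<And>t. t < T \<Longrightarrow> r t \<le> r t0" and t: "t < t0" "r t < r t0"
  shows False
proof -
  \<comment> \<open>The Hamiltonian inequality at \<open>t0\<close> divided by w2^p = r^p
    w1^p.\<close>
  have K: "s2.K t0 < s1.K t0"
  proof -
    have "s2.H t0 < r t0 powr p * s1.H t0" using H_comb_neg[OF max t(1) t0 t(2)] by simp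
    then have "s2.H t0 / (r t0 powr p * w1 t0 powr p) < r t0 powr p * s1.H t0 / (r t0 powr p * w1 t0 powr p)"
      using r_pos[OF t0] s1.w_pos[OF t0] by (intro divide_strict_right_mono) auto
    then show ?thesis using r_pos[OF t0] by (simp add: s1.K_def s2.K_def w2_powr[OF t0])
  qed
  have "s1.\<phi> (s2.y t0) - s1.\<phi> (s1.y t0) = 0"
  proof (rule DERIV_local_max[OF ln_r_deriv[OF t0], of "T - t0"], goal_cases)
    case 2
    show ?case
    proof (intro allI impI)
      fix s assume "\<bar>t0 - s\<bar> < T - t0"
      then have s: "s < T" by linarith
      have "ln (r s) \<le> ln (r t0)" using max[OF s] r_pos[OF s] r_pos[OF t0] by simp
      then show "ln (w2 s) - ln (w1 s) \<le> ln (w2 t0) - ln (w1 t0)" using ln_r s t0 by simp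
    qed
  qed (use t0 in auto)
  then have y: "s2.y t0 = s1.y t0" using s1.p spow_eq_iff[of "1 / (p - 1)"] by simp
  \<comment> \<open>At the same t and the same y, the values of \<open>K\<close> can differ only
    through a/q.\<close>
  have Ka: "s2.K t0 - s1.K t0 = (s2.a t0 - s1.a t0) / q"
    unfolding s1.K_eq[OF t0] s2.K_eq[OF t0] y by (simp add: diff_divide_distrib)
  with K have "(s2.a t0 - s1.a t0) / q < 0" by linarith
  then have a: "s2.a t0 < s1.a t0" using s1.p s1.pq by (simp add: divide_less_0_iff)
  have "((\<lambda>t. s2.y t - s1.y t) has_real_derivative
    (- p * s2.K t0 - (1 - p / q) * s2.a t0) - (- p * s1.K t0 - (1 - p / q) * s1.a t0)) (at t0)"
    by (intro DERIV_diff s1.y_deriv s2.y_deriv t0)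
  \<comment> \<open>\<open>K\<close> and \<open>a\<close> are both smaller for the second solution,
    and both enter y' with a negative coefficient.\<close>
  moreover have "0 < (- p * s2.K t0 - (1 - p / q) * s2.a t0) - (- p * s1.K t0 - (1 - p / q) * s1.a t0)"
  proof -
    have "p * s2.K t0 < p * s1.K t0" using K s1.p by simp
    moreover have "(1 - p / q) * s2.a t0 < (1 - p / q) * s1.a t0" using a s1.p s1.pq by simp
    ultimately show ?thesis by linarith
  qed
  ultimately obtain e where e: "0 < e" "\<And>h. 0 < h \<Longrightarrow> h < e \<Longrightarrow> s2.y t0 - s1.y t0 < s2.y (t0 + h) - s1.y (t0 + h)"
    using DERIV_pos_inc_right by blast
  define h where "h = min (e / 2) ((T - t0) / 2)"
  have h: "0 < h" "h < e" "t0 + h < T" using e t0 by (auto simp: h_def min_def field_simps)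
  have "ln (w2 t0) - ln (w1 t0) < ln (w2 (t0 + h)) - ln (w1 (t0 + h))"
  proof (rule DERIV_pos_imp_increasing_open[of t0 "t0 + h"])
    fix x assume x: "t0 < x" "x < t0 + h"
    have "s1.y x < s2.y x" using e(2)[of "x - t0"] x h y by simp
    then have "0 < s1.\<phi> (s2.y x) - s1.\<phi> (s1.y x)" using spow_strict_mono s1.p by simp
    then show "\<exists>D. ((\<lambda>t. ln (w2 t) - ln (w1 t)) has_real_derivative D) (at x) \<and> 0 < D"
      using ln_r_deriv[of x] x h by auto
  next
    show "continuous_on {t0..t0 + h} (\<lambda>t. ln (w2 t) - ln (w1 t))"
      using h by (intro continuous_at_imp_continuous_on ballI DERIV_isCont[OF ln_r_deriv]) auto
  qed (use h in simp)
  then have "ln (r t0) < ln (r (t0 + h))" using ln_r t0 h by simp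
  then have "r t0 < r (t0 + h)" using r_pos t0 h by simp
  then show False using max[OF h(3)] by simp
qed

section \<open>Limits of the quotient of two solutions at both ends\<close>

definition rT :: real where "rT = s1.\<phi> s2.zT / s1.\<phi> s1.zT"

lemma phi_zT_neg: "s1.\<phi> s1.zT < 0" "s1.\<phi> s2.zT < 0"
  using s1.zT_neg s2.zT_neg by (auto simp: spow_def)

lemma rT_pos: "0 < rT"
  unfolding rT_def using phi_zT_neg by (rule divide_neg_neg[rotated])

text \<open>L'Hopital's rule: both functions vanish at \<open>T\<close>, and as w -> 0 their
  derivatives tend to phi of the limits of z, which are nonzero.\<close>

lemma r_end: "(r \<longlongrightarrow> rT) (at_left T)"
proof -
  have D1: "((\<lambda>t. d * w1 t + s1.\<phi> (z1 t)) \<longlongrightarrow> d * 0 + s1.\<phi> s1.zT) (at_left T)"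
    using s1.p by (intro tendsto_intros s1.w_end isCont_tendsto_compose[OF isCont_spow s1.z_tendsto]) auto
  have D2: "((\<lambda>t. d * w2 t + s1.\<phi> (z2 t)) \<longlongrightarrow> d * 0 + s1.\<phi> s2.zT) (at_left T)"
    using s1.p by (intro tendsto_intros s2.w_end isCont_tendsto_compose[OF isCont_spow s2.z_tendsto]) auto
  have ev: "\<forall>\<^sub>F t in at_left T. t < T" by (auto intro!: eventually_at_leftI[of "T - 1"])
  show ?thesis unfolding r_def[abs_def]
  proof (rule lhopital_left[OF s2.w_end s1.w_end])
    show "\<forall>\<^sub>F t in at_left T. w1 t \<noteq> 0" using ev by eventually_elim (use s1.w_pos in fastforce)
    show "\<forall>\<^sub>F t in at_left T. d * w1 t + s1.\<phi> (z1 t) \<noteq> 0"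
      using order_tendstoD(2)[OF D1, of 0] phi_zT_neg by (auto elim: eventually_mono)
    show "\<forall>\<^sub>F t in at_left T. (w2 has_real_derivative d * w2 t + s1.\<phi> (z2 t)) (at t)"
      using ev by eventually_elim (rule s2.w_deriv)
    show "\<forall>\<^sub>F t in at_left T. (w1 has_real_derivative d * w1 t + s1.\<phi> (z1 t)) (at t)"
      using ev by eventually_elim (rule s1.w_deriv)
    show "((\<lambda>t. (d * w2 t + s1.\<phi> (z2 t)) / (d * w1 t + s1.\<phi> (z1 t))) \<longlongrightarrow> rT) (at_left T)"
      using tendsto_divide[OF D2 D1] phi_zT_neg by (simp add: rT_def)
  qed
qed

text \<open>Only the |z|^(p/(p-1)) terms of the Hamiltonians survive at \<open>T\<close>, and
  \<open>rT\<close> is exactly the ratio for which they cancel.\<close>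

lemma H_comb_end: "((\<lambda>s. s2.H s - rT powr p * s1.H s) \<longlongrightarrow> 0) (at_left T)"
proof -
  have "rT powr p * \<bar>s1.zT\<bar> powr (p / (p - 1)) = \<bar>s2.zT\<bar> powr (p / (p - 1))"
  proof -
    have "rT = \<bar>s2.zT\<bar> powr (1 / (p - 1)) / \<bar>s1.zT\<bar> powr (1 / (p - 1))"
      using s1.zT_neg s2.zT_neg by (simp add: rT_def spow_def)
    then have "rT powr p = \<bar>s2.zT\<bar> powr (p / (p - 1)) / \<bar>s1.zT\<bar> powr (p / (p - 1))"
      by (simp only: powr_divide powr_ge_zero powr_powr times_divide_eq_left mult_1_left)
    then show ?thesis using s1.zT_neg by simp
  qed
  then show ?thesis
    using tendsto_diff[OF s2.H_end tendsto_mult[OF tendsto_const s1.H_end, of "rT powr p"]]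
    by (simp add: mult.left_commute)
qed

text \<open>A strict inequality somewhere would make the combination negative and nonincreasing from
  then on, against its limit 0 at \<open>T\<close>.\<close>

lemma const_of_le_rT:
  assumes le: "\<And>t. t < T \<Longrightarrow> r t \<le> rT" and t: "t < T" shows "r t = rT"
proof (rule ccontr)
  assume "r t \<noteq> rT"
  then have lt: "r t < rT" using le[OF t] by simp
  define t0 where "t0 = (t + T) / 2"
  have t0: "t < t0" "t0 < T" using t by (auto simp: t0_def)
  have "0 \<le> s2.H t0 - rT powr p * s1.H t0"
    by (rule tendsto_upperbound[OF H_comb_end])
       (use t0 in \<open>auto intro!: eventually_at_leftI[of t0] H_comb_antimono le\<close>)
  then show False using H_comb_neg[OF le t0 lt] by simp
qed

text \<open>Both numbers are zeros of \<open>g\<close>, which does not depend on the solution, and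
  the slope of \<open>g\<close> is positive at each; a convex function has at most one such
  zero.\<close>

lemma y0_eq: "s1.y0 = s2.y0"
proof -
  have "\<not> s1.y0 < s2.y0"
  proof
    assume lt: "s1.y0 < s2.y0"
    then have "(d + s1.\<phi> s1.y0) * (s2.y0 - s1.y0) \<le> 0"
      using s1.g_strict_decreasing_left[OF s1.gamma_pos lt] s1.g_y0 s2.g_y0
      by (simp add: s1.g_def s2.g_def)
    then show False using lt s1.gamma_pos by (simp add: mult_le_0_iff)
  qed
  moreover have "\<not> s2.y0 < s1.y0"
  proof
    assume lt: "s2.y0 < s1.y0"
    then have "(d + s1.\<phi> s2.y0) * (s1.y0 - s2.y0) \<le> 0"
      using s2.g_strict_decreasing_left[OF s2.gamma_pos lt] s1.g_y0 s2.g_y0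
      by (simp add: s1.g_def s2.g_def)
    then show False using lt s2.gamma_pos by (simp add: mult_le_0_iff)
  qed
  ultimately show ?thesis by simp
qed

text \<open>(ln r)' = phi(y2) - phi(y1), where both terms approach the same limit exponentially
  fast.\<close>

lemma r_bot: "\<exists>l. (r \<longlongrightarrow> l) at_bot"
proof -
  obtain C1 e1 t1 where 1: "0 < C1" "0 < e1" "t1 < T" "\<And>t. t < t1 \<Longrightarrow> \<bar>s1.\<phi> (s1.y t) - s1.\<phi> s1.y0\<bar> \<le> C1 * exp (e1 * t)"
    using s1.phi_y_exp_bound by blast
  obtain C2 e2 t2 where 2: "0 < C2" "0 < e2" "t2 < T" "\<And>t. t < t2 \<Longrightarrow> \<bar>s1.\<phi> (s2.y t) - s1.\<phi> s1.y0\<bar> \<le> C2 * exp (e2 * t)"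
    using s2.phi_y_exp_bound y0_eq by metis
  define e where "e = min e1 e2"
  \<comment> \<open>Negative times allow both exponentials to be replaced by the one with the
    smaller rate.\<close>
  define t0 where "t0 = min 0 (min t1 t2)"
  have "\<exists>l. ((\<lambda>t. ln (w2 t) - ln (w1 t)) \<longlongrightarrow> l) at_bot"
  proof (rule tendsto_at_bot_of_exp_bound[where e=e and C="C1 + C2" and ?t0.0=t0])
    fix t assume t: "t < t0"
    then show "((\<lambda>t. ln (w2 t) - ln (w1 t)) has_real_derivative s1.\<phi> (s2.y t) - s1.\<phi> (s1.y t)) (at t)"
      using 1 by (intro ln_r_deriv) (auto simp: t0_def)
    have "C1 * exp (e1 * t) \<le> C1 * exp (e * t)" "C2 * exp (e2 * t) \<le> C2 * exp (e * t)"
      using 1 2 t by (auto simp: t0_def e_def mult_right_mono_neg)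
    then show "\<bar>s1.\<phi> (s2.y t) - s1.\<phi> (s1.y t)\<bar> \<le> (C1 + C2) * exp (e * t)"
      using 1(4)[of t] 2(4)[of t] t by (simp add: t0_def distrib_right)
  qed (use 1 2 in \<open>simp add: e_def\<close>)
  then obtain l where "((\<lambda>t. ln (w2 t) - ln (w1 t)) \<longlongrightarrow> l) at_bot" ..
  then have "((\<lambda>t. exp (ln (w2 t) - ln (w1 t))) \<longlongrightarrow> exp l) at_bot" by (rule tendsto_exp)
  moreover have "\<forall>\<^sub>F t in at_bot. exp (ln (w2 t) - ln (w1 t)) = r t"
    using eventually_gt_at_bot[of T]
    by eventually_elim (use r_pos in \<open>simp flip: ln_r\<close>)
  ultimately show ?thesis by (blast intro: Lim_transform_eventually)
qed

text \<open>A value above \<open>rT\<close> exceeds both end limits, so the supremum of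
  \<open>r\<close> is attained inside, at a point with a smaller value to its left.\<close>

lemma no_excess:
  assumes l: "(r \<longlongrightarrow> l) at_bot" "l \<le> rT" and t: "t < T"
  shows "r t \<le> rT"
proof (rule ccontr)
  assume "\<not> r t \<le> rT"
  then have rt: "rT < r t" by simp
  obtain A where A: "\<And>s. s \<le> A \<Longrightarrow> r s < r t"
    using order_tendstoD(2)[OF l(1), of "r t"] rt l(2) unfolding eventually_at_bot_linorder by auto
  obtain B where B: "B < T" "\<And>s. B < s \<Longrightarrow> s < T \<Longrightarrow> r s < r t"
    using order_tendstoD(2)[OF r_end rt] unfolding eventually_at_left_field by auto
  have At: "A < t" using A[of t] by (meson less_irrefl not_less)
  have Bt: "t \<le> B" using B(2)[of t] t by (meson less_irrefl not_less)
  have "continuous_on {A..B} r"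
    using B by (intro continuous_at_imp_continuous_on ballI isCont_r) auto
  then obtain m where m: "m \<in> {A..B}" "\<And>s. s \<in> {A..B} \<Longrightarrow> r s \<le> r m"
    using continuous_attains_sup[of "{A..B}" r] At Bt by force
  have rtm: "r t \<le> r m" using m(2)[of t] At Bt by simp
  have max: "r s \<le> r m" if "s < T" for s
  proof -
    consider "s \<le> A" | "s \<in> {A..B}" | "B < s" by force
    then show ?thesis by cases (use A[of s] B(2)[of s] m rtm that in force)+
  qed
  have "A \<noteq> m" using A[of A] rtm by auto
  then have "A < m" "r A < r m" using A[of A] m(1) rtm by auto
  then show False using no_interior_max[of m A] max m(1) B(1) by auto
qed

text \<open>A constant quotient has zero logarithmic derivative, so the Riccati variables agree;
  comparing their equations gives a1 = a2, and \<open>w\<close> is a power of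
  \<open>a\<close>.\<close>

lemma eq_of_const:
  assumes c: "\<And>t. t < T \<Longrightarrow> r t = c" and t: "t < T" shows "w2 t = w1 t"
proof -
  have y: "s2.y t = s1.y t" if t: "t < T" for t
  proof -
    have "((\<lambda>t. ln c) has_real_derivative s1.\<phi> (s2.y t) - s1.\<phi> (s1.y t)) (at t)"
      by (rule has_field_derivative_transform_within[OF ln_r_deriv[OF t], where d="T - t"])
         (use t c in \<open>auto simp: dist_real_def ln_r[symmetric]\<close>)
    then have "s1.\<phi> (s2.y t) - s1.\<phi> (s1.y t) = 0" using DERIV_unique DERIV_const by blast
    then show ?thesis using s1.p spow_eq_iff[of "1 / (p - 1)"] by simp
  qed
  have "(s1.y has_real_derivative - p * s2.K t - (1 - p / q) * s2.a t) (at t)"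
    by (rule has_field_derivative_transform_within[OF s2.y_deriv[OF t], where d="T - t"])
       (use t y in \<open>auto simp: dist_real_def\<close>)
  then have "- p * s2.K t - (1 - p / q) * s2.a t = - p * s1.K t - (1 - p / q) * s1.a t"
    using DERIV_unique s1.y_deriv[OF t] by blast
  then have "s2.a t = s1.a t"
    unfolding s1.y_deriv_eq[OF t] s2.y_deriv_eq[OF t] y[OF t] by (simp add: s1.g_def s2.g_def)
  moreover have "s1.a t powr (1 / (q - p)) = w1 t" "s2.a t powr (1 / (q - p)) = w2 t"
    using s1.w_pos[OF t] s2.w_pos[OF t] s1.pq by (simp_all add: s1.a_def s2.a_def powr_powr)
  ultimately show ?thesis by simp
qed

theorem w_eq:
  assumes t: "t < T" shows "w2 t = w1 t"
proof -
  interpret sw: emden_fowler_pair p q d \<mu> lam T w2 z2 w1 z1 ..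
  obtain l where l: "(r \<longlongrightarrow> l) at_bot" using r_bot by blast
  obtain l' where l': "(sw.r \<longlongrightarrow> l') at_bot" using sw.r_bot by blast
  have swr: "sw.r t = 1 / r t" for t by (simp add: r_def sw.r_def)
  have "((\<lambda>t. r t * sw.r t) \<longlongrightarrow> l * l') at_bot" by (intro tendsto_mult l l')
  moreover have "\<forall>\<^sub>F t in at_bot. r t * sw.r t = 1"
    using eventually_gt_at_bot[of T] by eventually_elim (use r_pos in \<open>force simp: swr\<close>)
  ultimately have "((\<lambda>t. 1) \<longlongrightarrow> l * l') (at_bot :: real filter)" by (rule Lim_transform_eventually)
  then have ll: "l * l' = 1" by (simp add: tendsto_const_iff)
  have rr: "sw.rT = 1 / rT" by (simp add: rT_def sw.rT_def)
  have "0 \<le> l"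
    by (rule tendsto_lowerbound[OF l]) (auto intro!: eventually_mono[OF eventually_gt_at_bot[of T]] less_imp_le[OF r_pos])
  with ll have l0: "0 < l" by (cases "l = 0") auto
  show ?thesis
  proof (cases "l \<le> rT")
    case True
    then show ?thesis using eq_of_const[OF const_of_le_rT t] no_excess[OF l] by blast
  next
    \<comment> \<open>Exchanging the solutions replaces r by 1/r, which inverts both end limits and
      reverses their order.\<close>
    case False
    have "l' = 1 / l" using ll l0 by (simp add: field_simps)
    then have "l' \<le> sw.rT" using False rT_pos l0 rr by (simp add: frac_le)
    then show ?thesis using sw.eq_of_const[OF sw.const_of_le_rT t] sw.no_excess[OF l'] by metis
  qed
qed

end

section \<open>Continuously differentiable functions and dilations\<close>

text \<open>The gradient is an explicit argument, so that products and compositions carry it along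
  without evaluating \<open>frechet_derivative\<close>.\<close>

definition C1 :: "('a::euclidean_space \<Rightarrow> real) \<Rightarrow> ('a \<Rightarrow> 'a) \<Rightarrow> bool" where
  "C1 f Df \<longleftrightarrow> continuous_on UNIV Df \<and> (\<forall>x. (f has_derivative (\<lambda>h. Df x \<bullet> h)) (at x))"

lemma C1_D: "C1 f Df \<Longrightarrow> (f has_derivative (\<lambda>h. Df x \<bullet> h)) (at x)"
  by (simp add: C1_def)

lemma C1_continuous_D: "C1 f Df \<Longrightarrow> continuous_on UNIV Df"
  by (simp add: C1_def)

lemma C1_continuous: "C1 f Df \<Longrightarrow> continuous_on UNIV f"
  by (meson C1_D has_derivative_continuous continuous_at_imp_continuous_on)

lemma C1_diff: "C1 f Df \<Longrightarrow> C1 g Dg \<Longrightarrow> C1 (\<lambda>x. f x - g x) (\<lambda>x. Df x - Dg x)"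
  unfolding C1_def by (auto intro!: continuous_intros derivative_eq_intros simp: inner_diff_left)

lemma C1_mult: "C1 f Df \<Longrightarrow> C1 g Dg \<Longrightarrow> C1 (\<lambda>x. f x * g x) (\<lambda>x. f x *\<^sub>R Dg x + g x *\<^sub>R Df x)"
  using C1_continuous[of f Df] C1_continuous[of g Dg]
  unfolding C1_def by (auto intro!: continuous_intros derivative_eq_intros simp: inner_add_left)

lemma C1_inner: "C1 (\<lambda>x. x \<bullet> b) (\<lambda>x. b)"
  unfolding C1_def by (auto intro!: derivative_eq_intros simp: inner_commute)

lemma C1_chain:
  assumes "C1 f Df" and "\<And>t. (h has_real_derivative h' t) (at t)" and "continuous_on UNIV h'"
  shows "C1 (\<lambda>x. h (f x)) (\<lambda>x. h' (f x) *\<^sub>R Df x)"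
proof -
  have "((\<lambda>x. h (f x)) has_derivative (\<lambda>k. (h' (f x) *\<^sub>R Df x) \<bullet> k)) (at x)" for x
    using has_derivative_compose[OF C1_D[OF assms(1), of x] assms(2)[of "f x", unfolded has_field_derivative_def]]
    by simp
  moreover have "continuous_on UNIV (\<lambda>x. h' (f x) *\<^sub>R Df x)"
    by (intro continuous_intros continuous_on_compose2[OF assms(3) C1_continuous[OF assms(1)]] C1_continuous_D[OF assms(1)]) auto
  ultimately show ?thesis unfolding C1_def by blast
qed

lemma C1_norm_sq: "C1 (\<lambda>x. x \<bullet> x) (\<lambda>x. 2 *\<^sub>R x)"
  unfolding C1_def by (auto intro!: continuous_intros derivative_eq_intros simp: inner_commute)

lemma C1_deriv_eq_0:
  assumes "C1 f Df" "open S" "x \<in> S" "\<And>y. y \<in> S \<Longrightarrow> f y = 0"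
  shows "Df x = 0"
proof -
  have "((\<lambda>_. 0) has_derivative (\<lambda>h. Df x \<bullet> h)) (at x)"
    by (rule has_derivative_transform_within_open[OF C1_D[OF assms(1)] assms(2,3)]) (use assms in auto)
  then have "(\<lambda>h. Df x \<bullet> h) = (\<lambda>h. 0)"
    using has_derivative_unique has_derivative_const by blast
  then have "Df x \<bullet> Df x = 0" by metis
  then show ?thesis by simp
qed

lemma test_function_C1:
  fixes \<phi> :: "'a::euclidean_space \<Rightarrow> real"
  assumes "Ck (Suc (Suc k)) \<phi>"
  shows "C1 \<phi> (grad \<phi>)"
proof -
  have d: "\<phi> differentiable (at x)" for x
    using assms by (auto simp: differentiable_on_def)
  have "frechet_derivative \<phi> (at x) h = grad \<phi> x \<bullet> h" for x h
  proof -
    interpret linear "frechet_derivative \<phi> (at x)"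
      using linear_frechet_derivative[OF d] .
    have "frechet_derivative \<phi> (at x) h = frechet_derivative \<phi> (at x) (\<Sum>b\<in>Basis. (h \<bullet> b) *\<^sub>R b)"
      by (simp add: euclidean_representation)
    then show ?thesis
      by (simp add: sum scale grad_def partial_deriv_def inner_sum_left) (simp add: inner_commute mult.commute)
  qed
  then have "(\<phi> has_derivative (\<lambda>h. grad \<phi> x \<bullet> h)) (at x)" for x
    using d[of x] by (simp add: frechet_derivative_works) presburger
  moreover have "continuous_on UNIV (partial_deriv b \<phi>)" if "b \<in> Basis" for b
    using assms that by (auto intro: differentiable_imp_continuous_on)
  then have "continuous_on UNIV (grad \<phi>)"
    unfolding grad_def[abs_def] by (intro continuous_intros) auto
  ultimately show ?thesis by (simp add: C1_def)
qed

lemma C1_grad: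
  assumes "C1 f Df" shows "grad f = Df"
proof
  fix x
  have "frechet_derivative f (at x) = (\<lambda>h. Df x \<bullet> h)"
    using C1_D[OF assms, of x] by (rule frechet_derivative_at[symmetric])
  then show "grad f x = Df x"
    by (simp add: grad_def partial_deriv_def euclidean_representation)
qed

lemma grad_inner_Basis:
  assumes "b \<in> Basis" shows "grad f x \<bullet> b = partial_deriv b f x"
  using assms by (simp add: grad_def inner_sum_left inner_Basis if_distrib[of "\<lambda>t. _ * t"] sum.delta cong: if_cong)

lemma integrable_continuous_bounded_support:
  fixes f :: "'a::euclidean_space \<Rightarrow> 'b::{banach, second_countable_topology}"
  assumes "continuous_on UNIV f" "\<And>x. M \<le> norm x \<Longrightarrow> f x = 0"
  shows "integrable lborel f"
proof -
  have "integrable lborel (\<lambda>x. indicator (cball 0 M) x *\<^sub>R f x)"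
    by (intro borel_integrable_compact continuous_on_subset[OF assms(1)]) auto
  moreover have "(\<lambda>x. indicator (cball 0 M) x *\<^sub>R f x) = f"
    using assms(2) by (auto simp: indicator_def fun_eq_iff)
  ultimately show ?thesis by simp
qed

lemma C1_deriv_support:
  assumes "C1 F DF" "\<And>x. M \<le> norm x \<Longrightarrow> F x = 0" "M < norm x"
  shows "DF x = 0"
  by (rule C1_deriv_eq_0[OF assms(1), of "- cball 0 M"]) (use assms in auto)

lemma continuous_bounded_support_bounded:
  fixes f :: "'a::euclidean_space \<Rightarrow> 'b::real_normed_vector"
  assumes "continuous_on UNIV f" "\<And>x. M < norm x \<Longrightarrow> f x = 0"
  shows "\<exists>C>0. \<forall>x. norm (f x) \<le> C"
proof -
  have "compact (f ` cball 0 M)"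
    by (intro compact_continuous_image continuous_on_subset[OF assms(1)]) auto
  then obtain C where C: "0 < C" "\<And>x. x \<in> cball 0 M \<Longrightarrow> norm (f x) \<le> C"
    using compact_imp_bounded bounded_pos by (metis image_eqI)
  have "norm (f x) \<le> C" for x
    using C assms(2)[of x] by (cases "norm x \<le> M") auto
  then show ?thesis using C(1) by blast
qed

section \<open>Integration by parts and dilations on the whole space\<close>

text \<open>Translation invariance makes the integral of every difference quotient in direction
  \<open>v\<close> vanish; the quotients converge to the derivative and are dominated by a Lipschitz
  bound.\<close>

lemma integral_C1_deriv_eq_0:
  fixes F :: "'a::euclidean_space \<Rightarrow> real"
  assumes F: "C1 F DF" and M: "\<And>x. M \<le> norm x \<Longrightarrow> F x = 0"
  shows "(\<integral>x. DF x \<bullet> v \<partial>lborel) = 0"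
proof -
  note DF0 = C1_deriv_support[OF F M]
  have "\<exists>C>0. \<forall>x. norm (DF x) \<le> C"
    by (rule continuous_bounded_support_bounded[OF C1_continuous_D[OF F]]) (rule DF0)
  then obtain C where C: "0 < C" "\<And>x. norm (DF x) \<le> C" by auto
  have iF: "integrable lborel F" using integrable_continuous_bounded_support[OF C1_continuous[OF F] M] .
  have [measurable]: "F \<in> borel_measurable borel" "DF \<in> borel_measurable borel"
    using C1_continuous[OF F] C1_continuous_D[OF F] by (auto intro: borel_measurable_continuous_onI)
  define s where "s n x = (F (inverse (real (Suc n)) *\<^sub>R v + x) - F x) * real (Suc n)" for n x
  have tr: "integrable lborel (\<lambda>x. F (h + x))" "(\<integral>x. F (h + x) \<partial>lborel) = (\<integral>x. F x \<partial>lborel)" for h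
  proof -
    have "integrable (distr lborel borel ((+) h)) F" using iF by (simp add: lborel_distr_plus)
    then show "integrable lborel (\<lambda>x. F (h + x))" by (subst (asm) integrable_distr_eq) auto
    have "(\<integral>x. F x \<partial>(distr lborel borel ((+) h))) = (\<integral>x. F (h + x) \<partial>lborel)"
      by (rule integral_distr) auto
    then show "(\<integral>x. F (h + x) \<partial>lborel) = (\<integral>x. F x \<partial>lborel)" by (simp add: lborel_distr_plus)
  qed
  have s0: "(\<integral>x. s n x \<partial>lborel) = 0" for n
    unfolding s_def integral_mult_left_zero
    by (subst Bochner_Integration.integral_diff[OF tr(1) iF]) (simp add: tr(2))
  have lip: "\<bar>F (h + x) - F x\<bar> \<le> C * norm h" for h x
  proof -
    have "norm (F (h + x) - F x) \<le> C * norm (h + x - x)"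
      by (rule differentiable_bound[of UNIV F "\<lambda>x k. DF x \<bullet> k"])
         (use C C1_D[OF F] in \<open>auto intro!: onorm_le order_trans[OF Cauchy_Schwarz_ineq2] mult_right_mono\<close>)
    then show ?thesis by simp
  qed
  have "(\<lambda>n. \<integral>x. s n x \<partial>lborel) \<longlonglongrightarrow> (\<integral>x. DF x \<bullet> v \<partial>lborel)"
  \<comment> \<open>The shifts have length at most \<open>norm v\<close>, so all quotients are
    supported in this larger ball.\<close>
  proof (rule integral_dominated_convergence[where w="\<lambda>x. indicator (cball 0 (M + norm v)) x *\<^sub>R (C * norm v)"])
    show "integrable lborel (\<lambda>x. indicator (cball (0::'a) (M + norm v)) x *\<^sub>R (C * norm v))"
      by (intro borel_integrable_compact continuous_intros) auto
    show "AE x in lborel. (\<lambda>n. s n x) \<longlonglongrightarrow> DF x \<bullet> v"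
    proof (rule AE_I2)
      fix x
      have "((\<lambda>t. F (x + t *\<^sub>R v)) has_derivative (\<lambda>t. DF x \<bullet> (t *\<^sub>R v))) (at 0)"
        by (rule has_derivative_compose[of "\<lambda>t. x + t *\<^sub>R v" "\<lambda>t. t *\<^sub>R v" 0 UNIV F])
           (use C1_D[OF F, of x] in \<open>auto intro!: derivative_eq_intros\<close>)
      then have "((\<lambda>t. F (x + t *\<^sub>R v)) has_real_derivative DF x \<bullet> v) (at 0)"
        by (rule has_derivative_imp_has_field_derivative) simp
      then have L: "((\<lambda>t. (F (x + t *\<^sub>R v) - F x) / t) \<longlongrightarrow> DF x \<bullet> v) (at 0)"
        by (simp add: DERIV_def)
      have "filterlim (\<lambda>n. inverse (real (Suc n))) (at 0) sequentially"
        using LIMSEQ_inverse_real_of_nat by (auto simp: filterlim_at)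
      from filterlim_compose[OF L this] show "(\<lambda>n. s n x) \<longlonglongrightarrow> DF x \<bullet> v"
        by (simp add: s_def add.commute divide_inverse)
    qed
    show "AE x in lborel. norm (s n x) \<le> indicator (cball 0 (M + norm v)) x *\<^sub>R (C * norm v)" for n
    proof (rule AE_I2)
      fix x
      let ?h = "inverse (real (Suc n)) *\<^sub>R v"
      have hv: "norm ?h \<le> norm v" 
        using mult_right_mono[of "inverse (real (Suc n))" 1 "norm v"] by (simp add: inverse_le_1_iff)
      show "norm (s n x) \<le> indicator (cball 0 (M + norm v)) x *\<^sub>R (C * norm v)"
      proof (cases "x \<in> cball 0 (M + norm v)")
        case True
        have "norm (s n x) = \<bar>F (?h + x) - F x\<bar> * real (Suc n)" by (simp add: s_def abs_mult)
        also have "\<dots> \<le> C * norm ?h * real (Suc n)" by (intro mult_right_mono lip) auto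
        also have "\<dots> = C * norm v" by simp
        finally show ?thesis using True by simp
      next
        case False
        then have "M \<le> norm x" "M \<le> norm (?h + x)"
          using hv norm_ge_zero[of v] norm_triangle_ineq4[of "?h + x" ?h] by (auto simp del: norm_ge_zero norm_scaleR)
        then show ?thesis using M False by (simp add: s_def)
      qed
    qed
  qed (auto simp: s_def)
  then show ?thesis using s0 by (simp add: LIMSEQ_const_iff)
qed

text \<open>The change of variables contributes the factor c^(-N), at most 1.\<close>

lemma nn_integral_dilation_le:
  fixes f :: "'a::euclidean_space \<Rightarrow> ennreal"
  assumes [measurable]: "f \<in> borel_measurable borel" and "1 \<le> c"
  shows "(\<integral>\<^sup>+x. f (c *\<^sub>R x) \<partial>lborel) \<le> (\<integral>\<^sup>+x. f x \<partial>lborel)"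
proof -
  have "(\<integral>\<^sup>+x. f x \<partial>lborel) = (\<integral>\<^sup>+x. f x \<partial>(density (distr lborel borel (\<lambda>x. 0 + c *\<^sub>R x)) (\<lambda>_. ennreal (\<bar>c\<bar> ^ DIM('a)))))"
    using lborel_affine[of c "0::'a"] assms(2) by simp
  also have "\<dots> = (\<integral>\<^sup>+x. ennreal (\<bar>c\<bar> ^ DIM('a)) * f (c *\<^sub>R x) \<partial>lborel)"
    by (simp add: nn_integral_density nn_integral_distr)
  finally have "(\<integral>\<^sup>+x. f x \<partial>lborel) = (\<integral>\<^sup>+x. ennreal (\<bar>c\<bar> ^ DIM('a)) * f (c *\<^sub>R x) \<partial>lborel)" .
  moreover have "1 \<le> ennreal (\<bar>c\<bar> ^ DIM('a))"
    using assms(2) by (simp add: one_le_power flip: ennreal_1)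
  then have "f (c *\<^sub>R x) \<le> ennreal (\<bar>c\<bar> ^ DIM('a)) * f (c *\<^sub>R x)" for x
    using mult_right_mono[of 1 "ennreal (\<bar>c\<bar> ^ DIM('a))" "f (c *\<^sub>R x)"] by simp
  ultimately show ?thesis by (simp add: nn_integral_mono)
qed

lemma dilation_path_deriv:
  assumes "C1 f Df"
  shows "((\<lambda>\<sigma>. f (exp \<sigma> *\<^sub>R x)) has_real_derivative Df (exp \<sigma> *\<^sub>R x) \<bullet> (exp \<sigma> *\<^sub>R x)) (at \<sigma>)"
proof -
  have "((\<lambda>\<sigma>. f (exp \<sigma> *\<^sub>R x)) has_derivative (\<lambda>t. Df (exp \<sigma> *\<^sub>R x) \<bullet> ((t * exp \<sigma>) *\<^sub>R x))) (at \<sigma>)"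
    by (rule has_derivative_compose[of "\<lambda>\<sigma>. exp \<sigma> *\<^sub>R x" "\<lambda>t. (t * exp \<sigma>) *\<^sub>R x" \<sigma> UNIV f])
       (use C1_D[OF assms] in \<open>auto intro!: derivative_eq_intros\<close>)
  then show ?thesis by (rule has_derivative_imp_has_field_derivative) simp
qed

text \<open>f(e^s x) - f(x) is the integral over [0, s] of Df.x evaluated at e^sigma x. Tonelli and
  the contraction of the L^1 norm under expansion of the argument give a bound linear in s; applied
  to differences of test functions it controls their dilation quotients uniformly in s.\<close>

lemma dilation_difference_le:
  fixes f :: "'a::euclidean_space \<Rightarrow> real"
  assumes f: "C1 f Df" and s: "0 \<le> s"
  shows "(\<integral>\<^sup>+x. ennreal \<bar>f (exp s *\<^sub>R x) - f x\<bar> \<partial>lborel) \<le> ennreal s * (\<integral>\<^sup>+x. ennreal \<bar>Df x \<bullet> x\<bar> \<partial>lborel)"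
proof -
  have cD: "continuous_on UNIV Df" and cf: "continuous_on UNIV f"
    using C1_continuous_D[OF f] C1_continuous[OF f] by auto
  have [measurable]: "Df \<in> borel_measurable borel" "f \<in> borel_measurable borel"
    using cD cf by (auto intro: borel_measurable_continuous_onI)
  let ?k = "\<lambda>x. Df x \<bullet> x"
  have "ennreal \<bar>f (exp s *\<^sub>R x) - f x\<bar> \<le> (\<integral>\<^sup>+\<sigma>. ennreal \<bar>?k (exp \<sigma> *\<^sub>R x) * indicator {0..s} \<sigma>\<bar> \<partial>lborel)" for x
  proof -
    have B: "has_bochner_integral lborel (\<lambda>\<sigma>. ?k (exp \<sigma> *\<^sub>R x) * indicator {0..s} \<sigma>) (f (exp s *\<^sub>R x) - f (exp 0 *\<^sub>R x))"
    proof (rule has_bochner_integral_FTC_Icc_real[OF s])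
      show "((\<lambda>\<sigma>. f (exp \<sigma> *\<^sub>R x)) has_real_derivative ?k (exp \<sigma> *\<^sub>R x)) (at \<sigma>)" for \<sigma>
        using dilation_path_deriv[OF f] by simp
      have "continuous_on UNIV (\<lambda>\<sigma>. ?k (exp \<sigma> *\<^sub>R x))"
        by (intro continuous_intros continuous_on_compose2[OF cD]) auto
      then show "isCont (\<lambda>\<sigma>. ?k (exp \<sigma> *\<^sub>R x)) \<sigma>" for \<sigma>
        by (simp add: continuous_on_eq_continuous_at)
    qed
    then have "f (exp s *\<^sub>R x) - f x = (\<integral>\<sigma>. ?k (exp \<sigma> *\<^sub>R x) * indicator {0..s} \<sigma> \<partial>lborel)"
      by (simp add: has_bochner_integral_integral_eq)
    also have "ennreal (norm \<dots>) \<le> (\<integral>\<^sup>+\<sigma>. ennreal (norm (?k (exp \<sigma> *\<^sub>R x) * indicator {0..s} \<sigma>)) \<partial>lborel)"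
      by (rule integral_norm_bound_ennreal) (use B in \<open>auto simp: has_bochner_integral_iff\<close>)
    finally show ?thesis by simp
  qed
  then have "(\<integral>\<^sup>+x. ennreal \<bar>f (exp s *\<^sub>R x) - f x\<bar> \<partial>lborel)
      \<le> (\<integral>\<^sup>+x. (\<integral>\<^sup>+\<sigma>. ennreal \<bar>?k (exp \<sigma> *\<^sub>R x) * indicator {0..s} \<sigma>\<bar> \<partial>lborel) \<partial>lborel)"
    by (intro nn_integral_mono)
  also have "\<dots> = (\<integral>\<^sup>+\<sigma>. (\<integral>\<^sup>+x. ennreal \<bar>?k (exp \<sigma> *\<^sub>R x) * indicator {0..s} \<sigma>\<bar> \<partial>lborel) \<partial>lborel)"
    by (rule lborel_pair.Fubini') measurable
  also have "\<dots> \<le> (\<integral>\<^sup>+\<sigma>. (\<integral>\<^sup>+x. ennreal \<bar>?k x\<bar> \<partial>lborel) * indicator {0..s} \<sigma> \<partial>lborel)"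
  proof (rule nn_integral_mono)
    fix \<sigma> :: real
    show "(\<integral>\<^sup>+x. ennreal \<bar>?k (exp \<sigma> *\<^sub>R x) * indicator {0..s} \<sigma>\<bar> \<partial>lborel) \<le> (\<integral>\<^sup>+x. ennreal \<bar>?k x\<bar> \<partial>lborel) * indicator {0..s} \<sigma>"
      using nn_integral_dilation_le[of "\<lambda>x. ennreal \<bar>?k x\<bar>" "exp \<sigma>"] by (cases "\<sigma> \<in> {0..s}") auto
  qed
  also have "\<dots> = ennreal s * (\<integral>\<^sup>+x. ennreal \<bar>?k x\<bar> \<partial>lborel)"
    using s by (subst nn_integral_cmult_indicator) (auto simp: mult.commute)
  finally show ?thesis .
qed

lemma dilation_quotient_uniform:
  fixes f :: "'a::euclidean_space \<Rightarrow> real"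
  assumes f: "C1 f Df" and M: "\<And>x. M \<le> norm x \<Longrightarrow> f x = 0" and e: "0 < e" and M0: "0 < M"
  shows "\<exists>s0>0. \<forall>s x. 0 < s \<longrightarrow> s < s0 \<longrightarrow>
    \<bar>(f (exp s *\<^sub>R x) - f x) / s - Df x \<bullet> x\<bar> \<le> e * indicator (cball (0::'a) M) x"
proof -
  let ?k = "\<lambda>x. Df x \<bullet> x"
  have cD: "continuous_on UNIV Df" using C1_continuous_D[OF f] .
  \<comment> \<open>For s < 1 the intermediate points of the mean value theorem lie in this ball
    when \<open>norm x \<le> M\<close>.\<close>
  have "uniformly_continuous_on (cball 0 (exp 1 * M)) ?k"
    by (intro compact_uniformly_continuous continuous_intros continuous_on_subset[OF cD]) auto
  then obtain d where d: "0 < d" "\<And>x y. norm x \<le> exp 1 * M \<Longrightarrow> norm y \<le> exp 1 * M \<Longrightarrow> dist x y < d \<Longrightarrow> dist (?k x) (?k y) < e"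
    unfolding uniformly_continuous_on_def using e by (metis mem_cball_0)
  have "((\<lambda>s. (exp s - 1) * M) \<longlongrightarrow> 0) (at_right (0::real))"
    by (auto intro!: tendsto_eq_intros)
  then have "\<forall>\<^sub>F s in at_right (0::real). (exp s - 1) * M < d"
    by (rule order_tendstoD(2)) (use d in auto)
  then obtain s1 where s1: "0 < s1" "\<And>s::real. 0 < s \<Longrightarrow> s < s1 \<Longrightarrow> (exp s - 1) * M < d"
    unfolding eventually_at_right_field by auto
  have "\<bar>(f (exp s *\<^sub>R x) - f x) / s - ?k x\<bar> \<le> e * indicator (cball (0::'a) M) x"
    if s: "0 < s" "s < min s1 1" for s :: real and x :: 'a
  proof (cases "norm x \<le> M")
    case True
    obtain \<xi> where \<xi>: "0 < \<xi>" "\<xi> < s" "f (exp s *\<^sub>R x) - f (exp 0 *\<^sub>R x) = (s - 0) * ?k (exp \<xi> *\<^sub>R x)"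
      using MVT2[OF s(1) dilation_path_deriv[OF f]] by blast
    have e1: "1 \<le> exp \<xi>" "exp \<xi> \<le> exp 1" using \<xi> s by auto
    have "dist (exp \<xi> *\<^sub>R x) x = norm ((exp \<xi> - 1) *\<^sub>R x)" by (simp add: dist_norm scaleR_diff_left)
    also have "\<dots> \<le> (exp \<xi> - 1) * M" using e1 True by (simp add: mult_left_mono)
    also have "\<dots> < d" using s1(2)[of \<xi>] \<xi> s by simp
    finally have 1: "dist (exp \<xi> *\<^sub>R x) x < d" .
    have "norm (exp \<xi> *\<^sub>R x) \<le> exp 1 * M" using e1 True M0 by (simp add: mult_mono)
    moreover have "norm x \<le> exp 1 * M"
      using True M0 by (smt (verit, best) exp_ge_add_one_self mult_le_cancel_right1)
    ultimately have "dist (?k (exp \<xi> *\<^sub>R x)) (?k x) < e" using d(2) 1 by blast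
    then show ?thesis using \<xi>(3) s True by (simp add: dist_real_def)
  next
    case False
    have "M \<le> norm (exp s *\<^sub>R x)"
      using False s M0 by (smt (verit, best) exp_ge_add_one_self mult_le_cancel_right1 norm_scaleR abs_exp_cancel norm_ge_zero)
    then show ?thesis using False M[of x] M C1_deriv_support[OF f M] by simp
  qed
  then show ?thesis using s1(1) by (intro exI[of _ "min s1 1"]) auto
qed

section \<open>Polar coordinates in the variable ln |x|\<close>

text \<open>Both measures assign to the half-line up to \<open>a\<close> the volume of the ball of
  radius \<open>exp a\<close>, and half-lines generate the Borel sets. For radial integrands this
  takes the place of polar coordinates.\<close>

lemma distr_ln_norm:
  "distr (lborel :: 'a::euclidean_space measure) borel (\<lambda>x. ln (norm x)) =
   density lborel (\<lambda>t. ennreal (real DIM('a) * unit_ball_vol (real DIM('a)) * exp (real DIM('a) * t)))"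
  (is "?M = density lborel ?f")
proof (rule measure_eqI_generator_eq[where E="range (\<lambda>a. {..a::real})" and \<Omega>=UNIV and A="\<lambda>n. {..real n}"])
  let ?N = "real DIM('a)" and ?c = "unit_ball_vol (real DIM('a))"
  have c: "0 \<le> ?c" by simp
  have l: "ln r \<le> a \<longleftrightarrow> r \<le> exp a" if "0 < r" for r a :: real
    using ln_le_cancel_iff[of r "exp a"] that by simp
  have 1: "emeasure ?M {..a} = ennreal (?c * exp (?N * a))" for a
  proof -
    have "emeasure ?M {..a} = emeasure lborel {x::'a. ln (norm x) \<le> a}"
      by (subst emeasure_distr) (auto simp: vimage_def)
    also have "\<dots> = emeasure lborel (cball (0::'a) (exp a))"
    proof (rule emeasure_eq_AE)
      \<comment> \<open>Because \<open>ln 0 = 0\<close>, the origin is always in the ball but not in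
        the other set when a < 0; it is a null set.\<close>
      have "AE x in lborel. x \<noteq> (0::'a)" by (rule AE_lborel_singleton)
      then show "AE x in lborel. (x \<in> {x::'a. ln (norm x) \<le> a}) = (x \<in> cball (0::'a) (exp a))"
        by eventually_elim (simp add: l)
    qed auto
    also have "\<dots> = ennreal (?c * exp a ^ DIM('a))" by (rule emeasure_cball) simp
    finally show ?thesis by (simp add: exp_of_nat_mult)
  qed
  have 2: "emeasure (density lborel ?f) {..a} = ennreal (?c * exp (?N * a))" for a
  proof -
    have "emeasure (density lborel ?f) {..a} = (\<integral>\<^sup>+t. ?f t * indicator {..a} t \<partial>lborel)"
      by (rule emeasure_density) auto
    \<comment> \<open>Reflection gives the half-line from -a upwards, on which the antiderivative
      tends to 0.\<close>
    also have "\<dots> = (\<integral>\<^sup>+t. ennreal (?N * ?c * exp (?N * (- t))) * indicator {- a..} t \<partial>lborel)"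
      by (subst nn_integral_real_affine[where c="-1" and t=0]) (auto intro!: nn_integral_cong simp: indicator_def)
    also have "\<dots> = ennreal (0 - (- ?c * exp (?N * (- (- a)))))"
    proof (rule nn_integral_FTC_atLeast)
      show "((\<lambda>t. - ?c * exp (?N * - t)) has_real_derivative ?N * ?c * exp (?N * - t)) (at t)" for t
        by (auto intro!: derivative_eq_intros)
      have "((\<lambda>t. exp (?N * - t)) \<longlongrightarrow> 0) at_top"
        by (intro filterlim_compose[OF exp_at_bot] filterlim_tendsto_pos_mult_at_bot[OF tendsto_const] filterlim_uminus_at_bot_at_top) auto
      from tendsto_mult[OF tendsto_const this, of "- ?c"]
      show "((\<lambda>t. - ?c * exp (?N * - t)) \<longlongrightarrow> 0) at_top" by simp
    qed auto
    finally show ?thesis by simp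
  qed
  show "emeasure ?M X = emeasure (density lborel ?f) X" if "X \<in> range (\<lambda>a. {..a})" for X
    using that 1 2 by auto
  show "Int_stable (range (\<lambda>a::real. {..a}))"
    by (auto simp: Int_stable_def)
  show "(\<Union>n. {..real n}) = UNIV" using real_arch_simple by auto
  show "emeasure ?M {..real n} \<noteq> \<infinity>" for n by (simp add: 1)
qed (auto simp: borel_eq_atMost)

section \<open>Gradients of radial Sobolev functions\<close>

lemma DERIV_max0_square: "((\<lambda>s::real. (max 0 s)\<^sup>2) has_real_derivative 2 * max 0 s) (at s)"
proof (cases s "0::real" rule: linorder_cases)
  case less
  have "((\<lambda>s::real. 0) has_real_derivative 2 * max 0 s) (at s)" using less by simp
  then show ?thesis
    by (rule has_field_derivative_transform_within[where d="-s"]) (use less in \<open>auto simp: dist_real_def\<close>)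
next
  case equal
  have "((\<lambda>h::real. \<bar>h\<bar>) \<longlongrightarrow> 0) (at 0)" by (auto intro!: tendsto_eq_intros)
  then have "((\<lambda>h::real. (max 0 h)\<^sup>2 / h) \<longlongrightarrow> 0) (at 0)"
    by (rule Lim_null_comparison[rotated]) (auto simp: eventually_at_filter max_def power2_eq_square)
  then show ?thesis using equal by (simp add: DERIV_def)
next
  case greater
  have "((\<lambda>s::real. s\<^sup>2) has_real_derivative 2 * max 0 s) (at s)"
    using greater by (auto intro!: derivative_eq_intros)
  then show ?thesis
    by (rule has_field_derivative_transform_within[where d="s"]) (use greater in \<open>auto simp: dist_real_def\<close>)
qed

lemma abs_arctan_le_2: "\<bar>arctan t\<bar> \<le> 2"
  using arctan_lbound[of t] arctan_ubound[of t] pi_less_4 by (simp add: abs_le_iff)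

text \<open>In the derivative arctan x + x/(1 + x^2) the two terms are at most 2 and 1 in absolute
  value.\<close>

lemma mult_arctan_lipschitz: "\<bar>s * arctan s - t * arctan t\<bar> \<le> 3 * \<bar>s - t\<bar>"
proof -
  have "norm (s * arctan s - t * arctan t) \<le> 3 * norm (s - t)"
  proof (rule field_differentiable_bound[of UNIV])
    fix x :: real
    show "((\<lambda>s. s * arctan s) has_field_derivative arctan x + x * inverse (1 + x\<^sup>2)) (at x within UNIV)"
      by (auto intro!: derivative_eq_intros simp: algebra_simps)
    have "0 \<le> (\<bar>x\<bar> - 1)\<^sup>2" by simp
    then have "\<bar>x\<bar> \<le> 1 + x\<^sup>2" by (simp add: power2_diff)
    moreover have "0 < 1 + x\<^sup>2" by (simp add: add_pos_nonneg)
    ultimately have "\<bar>x\<bar> * inverse (1 + x\<^sup>2) \<le> 1" by (simp add: field_simps)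
    then have "\<bar>x * inverse (1 + x\<^sup>2)\<bar> \<le> 1" using \<open>0 < 1 + x\<^sup>2\<close> by (simp add: abs_mult)
    then show "norm (arctan x + x * inverse (1 + x\<^sup>2)) \<le> 3"
      using abs_arctan_le_2[of x] by (simp add: abs_le_iff)
  qed auto
  then show ?thesis by simp
qed

text \<open>The component of \<open>v\<close> along the infinitesimal rotation at \<open>x\<close> in the plane of \<open>b\<close> and \<open>c\<close>.\<close>

definition rotd :: "'a::euclidean_space \<Rightarrow> 'a \<Rightarrow> 'a \<Rightarrow> 'a \<Rightarrow> real" where
  "rotd b c x v = (x \<bullet> b) * (v \<bullet> c) - (x \<bullet> c) * (v \<bullet> b)"

lemma rotd_diff: "rotd b c x (v - w) = rotd b c x v - rotd b c x w"
  by (simp add: rotd_def inner_diff_left algebra_simps)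

lemma rotd_add: "rotd b c x (v + w) = rotd b c x v + rotd b c x w"
  by (simp add: rotd_def inner_add_left algebra_simps)

lemma rotd_scaleR: "rotd b c x (t *\<^sub>R v) = t * rotd b c x v"
  by (simp add: rotd_def algebra_simps)

lemma rotd_self: "rotd b c x x = 0"
  by (simp add: rotd_def)

lemma abs_rotd_le:
  assumes "b \<in> Basis" "c \<in> Basis" shows "\<bar>rotd b c x v\<bar> \<le> 2 * norm x * norm v"
proof -
  have "\<bar>(x \<bullet> b) * (v \<bullet> c)\<bar> \<le> norm x * norm v" "\<bar>(x \<bullet> c) * (v \<bullet> b)\<bar> \<le> norm x * norm v"
    using assms by (auto simp: abs_mult intro!: mult_mono Basis_le_norm)
  then show ?thesis unfolding rotd_def by linarith
qed

lemma continuous_on_rotd: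
  "continuous_on S f \<Longrightarrow> continuous_on S (\<lambda>x. rotd b c x (f x))"
  unfolding rotd_def by (intro continuous_intros)

lemma C1_inner_mult:
  assumes "C1 F DF" shows "C1 (\<lambda>x. (x \<bullet> b) * F x) (\<lambda>x. (x \<bullet> b) *\<^sub>R DF x + F x *\<^sub>R b)"
  using C1_mult[OF C1_inner assms] .

text \<open>The rotation field is divergence free: for b different from c, the c-derivative of (x.b)
  F is (x.b) times the c-derivative of F, so each half of the integrand is a derivative.\<close>

lemma integral_rotd_C1_eq_0:
  fixes F :: "'a::euclidean_space \<Rightarrow> real"
  assumes F: "C1 F DF" and M: "\<And>x. M \<le> norm x \<Longrightarrow> F x = 0" and b: "b \<in> Basis" "c \<in> Basis" "b \<noteq> c"
  shows "(\<integral>x. rotd b c x (DF x) \<partial>lborel) = 0"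
proof -
  have cD: "continuous_on UNIV DF" and cF: "continuous_on UNIV F"
    using C1_continuous_D[OF F] C1_continuous[OF F] by auto
  have DF0: "DF x = 0" if "M + 1 \<le> norm x" for x
    using C1_deriv_support[OF F M] that by simp
  have z: "(\<integral>x. (x \<bullet> b) * (DF x \<bullet> c) \<partial>lborel) = 0" if "b \<in> Basis" "c \<in> Basis" "b \<noteq> c" for b c :: 'a
    using integral_C1_deriv_eq_0[OF C1_inner_mult[OF F, of b], of M c] M that
    by (simp add: inner_add_left inner_Basis)
  have i: "integrable lborel (\<lambda>x. (x \<bullet> b) * (DF x \<bullet> c))" for b c :: 'a
    by (rule integrable_continuous_bounded_support[where M="M + 1"])
       (auto intro!: continuous_intros cD simp: DF0)
  show ?thesis unfolding rotd_def
    using z[OF b] z[of c b] b by (subst Bochner_Integration.integral_diff[OF i i]) auto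
qed

lemma nn_integral_ln_norm:
  fixes h :: "real \<Rightarrow> ennreal"
  assumes [measurable]: "h \<in> borel_measurable borel"
  shows "(\<integral>\<^sup>+x. h (ln (norm (x::'a::euclidean_space))) \<partial>lborel) =
    (\<integral>\<^sup>+t. ennreal (real DIM('a) * unit_ball_vol (real DIM('a)) * exp (real DIM('a) * t)) * h t \<partial>lborel)"
proof -
  have "(\<integral>\<^sup>+x. h (ln (norm (x::'a))) \<partial>lborel) = (\<integral>\<^sup>+t. h t \<partial>(distr (lborel :: 'a measure) borel (\<lambda>x. ln (norm x))))"
    by (subst nn_integral_distr) auto
  then show ?thesis by (simp add: distr_ln_norm nn_integral_density)
qed

lemma integral_ln_norm:
  fixes h :: "real \<Rightarrow> real"
  assumes [measurable]: "h \<in> borel_measurable borel"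
  shows "(\<integral>x. h (ln (norm (x::'a::euclidean_space))) \<partial>lborel) =
    (\<integral>t. (real DIM('a) * unit_ball_vol (real DIM('a)) * exp (real DIM('a) * t)) * h t \<partial>lborel)"
proof -
  have "(\<integral>x. h (ln (norm (x::'a))) \<partial>lborel) = (\<integral>t. h t \<partial>(distr (lborel :: 'a measure) borel (\<lambda>x. ln (norm x))))"
    by (subst integral_distr) auto
  then show ?thesis by (simp add: distr_ln_norm integral_density)
qed

lemma nn_integral_add5:
  assumes [measurable]: "a \<in> borel_measurable M" "b \<in> borel_measurable M" "c \<in> borel_measurable M"
    "d \<in> borel_measurable M" "e \<in> borel_measurable M"
  shows "(\<integral>\<^sup>+x. ennreal (a x) + ennreal (b x) + ennreal (c x) + ennreal (d x) + ennreal (e x) \<partial>M) =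
    (\<integral>\<^sup>+x. ennreal (a x) \<partial>M) + (\<integral>\<^sup>+x. ennreal (b x) \<partial>M) + (\<integral>\<^sup>+x. ennreal (c x) \<partial>M)
    + (\<integral>\<^sup>+x. ennreal (d x) \<partial>M) + (\<integral>\<^sup>+x. ennreal (e x) \<partial>M)"
  by (simp add: nn_integral_add)

text \<open>
  \<open>U\<close> and \<open>G\<close> are Borel versions of an element of \<open>W\<^sub>0\<^sup>1\<^sup>,\<^sup>p\<close> and its gradient, extended by \<open>0\<close> to the whole
  space; \<open>f\<close> are the approximating test functions. Working on the whole space encodes the boundary
  condition.
\<close>

locale radial_W0 =
  fixes p R :: real and U :: "'a::euclidean_space \<Rightarrow> real" and G :: "'a \<Rightarrow> 'a" and f :: "nat \<Rightarrow> 'a \<Rightarrow> real"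
  assumes p: "1 < p" and R: "0 < R"
    and U_meas [measurable]: "U \<in> borel_measurable borel"
    and G_meas [measurable]: "G \<in> borel_measurable borel"
    and U_cont: "continuous_on (ball 0 R - {0}) U"
    and U_rad: "norm x = norm y \<Longrightarrow> U x = U y"
    and U_out: "R \<le> norm x \<Longrightarrow> U x = 0"
    and G_out: "R \<le> norm x \<Longrightarrow> G x = 0"
    and f_C1: "C1 (f n) (grad (f n))"
    and f_C2: "b \<in> Basis \<Longrightarrow> C1 (\<lambda>x. grad (f n) x \<bullet> b) (grad (\<lambda>x. grad (f n) x \<bullet> b))"
    and f_out: "R \<le> norm x \<Longrightarrow> f n x = 0"
    and grad_conv: "(\<lambda>n. \<integral>\<^sup>+x. ennreal (norm (grad (f n) x - G x)) \<partial>lborel) \<longlonglongrightarrow> 0"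
    and f_conv: "(\<lambda>n. \<integral>\<^sup>+x. ennreal \<bar>f n x - U x\<bar> \<partial>lborel) \<longlonglongrightarrow> 0"
    and G_p: "(\<integral>\<^sup>+x. ennreal (norm (G x) powr p) \<partial>lborel) < \<infinity>"
begin

lemma f_cont: "continuous_on UNIV (f n)" and grad_cont: "continuous_on UNIV (grad (f n))"
  using C1_continuous[OF f_C1] C1_continuous_D[OF f_C1] by auto

lemma f_meas [measurable]: "f n \<in> borel_measurable borel"
  and grad_meas [measurable]: "grad (f n) \<in> borel_measurable borel"
  using f_cont grad_cont by (auto intro: borel_measurable_continuous_onI)

lemma f_eventually: "0 < e \<Longrightarrow> \<exists>n0. \<forall>n\<ge>n0. (\<integral>\<^sup>+x. ennreal \<bar>f n x - U x\<bar> \<partial>lborel) \<le> ennreal e"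
  using order_tendstoD(2)[OF f_conv, of "ennreal e"] unfolding eventually_sequentially
  by (simp, metis less_imp_le)

lemma grad_eventually: "0 < e \<Longrightarrow> \<exists>n0. \<forall>n\<ge>n0. (\<integral>\<^sup>+x. ennreal (norm (grad (f n) x - G x)) \<partial>lborel) \<le> ennreal e"
  using order_tendstoD(2)[OF grad_conv, of "ennreal e"] unfolding eventually_sequentially
  by (simp, metis less_imp_le)

lemma grad_out: "R < norm x \<Longrightarrow> grad (f n) x = 0"
  using C1_deriv_support[OF f_C1 f_out] .

lemma radial_eventually:
  assumes "0 < e"
  shows "\<exists>n0. \<forall>n\<ge>n0. (\<integral>\<^sup>+x. ennreal \<bar>grad (f n) x \<bullet> x - G x \<bullet> x\<bar> \<partial>lborel) \<le> ennreal e"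
proof -
  obtain n0 where n0: "\<And>n. n0 \<le> n \<Longrightarrow> (\<integral>\<^sup>+x. ennreal (norm (grad (f n) x - G x)) \<partial>lborel) \<le> ennreal (e / R)"
    using grad_eventually[of "e / R"] assms R by auto
  have "(\<integral>\<^sup>+x. ennreal \<bar>grad (f n) x \<bullet> x - G x \<bullet> x\<bar> \<partial>lborel) \<le> ennreal e" if "n0 \<le> n" for n
  proof -
    have "ennreal \<bar>grad (f n) x \<bullet> x - G x \<bullet> x\<bar> \<le> ennreal R * ennreal (norm (grad (f n) x - G x))" for x
    proof (cases "norm x \<le> R")
      case True
      have "\<bar>(grad (f n) x - G x) \<bullet> x\<bar> \<le> norm (grad (f n) x - G x) * R"
        using True by (intro order_trans[OF Cauchy_Schwarz_ineq2] mult_left_mono) auto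
      then show ?thesis using R by (simp add: inner_diff_left mult.commute ennreal_leI flip: ennreal_mult)
    next
      case False
      then show ?thesis using grad_out[of x] G_out[of x] by simp
    qed
    then have "(\<integral>\<^sup>+x. ennreal \<bar>grad (f n) x \<bullet> x - G x \<bullet> x\<bar> \<partial>lborel) \<le> ennreal R * (\<integral>\<^sup>+x. ennreal (norm (grad (f n) x - G x)) \<partial>lborel)"
      by (subst nn_integral_cmult[symmetric]) (auto intro!: nn_integral_mono)
    also have "\<dots> \<le> ennreal R * ennreal (e / R)" by (intro mult_left_mono n0 that) auto
    also have "\<dots> = ennreal e" using R assms by (simp flip: ennreal_mult)
    finally show ?thesis .
  qed
  then show ?thesis by blast
qed

text \<open>Two approximants are used: a fixed \<open>f n\<close>, whose quotients converge
  uniformly, and an \<open>f m\<close> close to \<open>U\<close> on the scale \<open>s\<close>. The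
  gap between them is controlled by the difference of their gradients, uniformly in
  \<open>s\<close>.\<close>

lemma dilation_quotient_L1:
  assumes e: "0 < e"
  shows "\<exists>s0>0. \<forall>s. 0 < s \<longrightarrow> s < s0 \<longrightarrow>
    (\<integral>\<^sup>+x. ennreal \<bar>(U (exp s *\<^sub>R x) - U x) / s - G x \<bullet> x\<bar> \<partial>lborel) \<le> ennreal e"
proof -
  \<comment> \<open>The five error terms will cost e'/2, e'/2, 2 e', e' and e'.\<close>
  define e' where "e' = e / 5"
  have e': "0 < e'" using e by (simp add: e'_def)
  obtain n where n: "\<And>m. n \<le> m \<Longrightarrow> (\<integral>\<^sup>+x. ennreal \<bar>grad (f m) x \<bullet> x - G x \<bullet> x\<bar> \<partial>lborel) \<le> ennreal e'"
    using radial_eventually[OF e'] by blast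
  define V where "V = measure lborel (cball (0::'a) R)"
  have V: "emeasure lborel (cball (0::'a) R) = ennreal V" "0 \<le> V"
    unfolding V_def using R by (auto simp: measure_def emeasure_cball)
  obtain s0 where s0: "0 < s0" "\<And>s x. 0 < s \<Longrightarrow> s < s0 \<Longrightarrow>
     \<bar>(f n (exp s *\<^sub>R x) - f n x) / s - grad (f n) x \<bullet> x\<bar> \<le> e' / (V + 1) * indicator (cball 0 R) x"
    using dilation_quotient_uniform[OF f_C1 f_out, of R "e' / (V + 1)" n] e' V(2) R by auto
  have "(\<integral>\<^sup>+x. ennreal \<bar>(U (exp s *\<^sub>R x) - U x) / s - G x \<bullet> x\<bar> \<partial>lborel) \<le> ennreal e" if s: "0 < s" "s < s0" for s
  proof -
    \<comment> \<open>The error is later divided by \<open>s\<close>, so the accuracy is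
      proportional to \<open>s\<close>; thus \<open>m\<close> depends on \<open>s\<close> while
      \<open>n\<close> does not.\<close>
    obtain m0 where m0: "\<And>m. m0 \<le> m \<Longrightarrow> (\<integral>\<^sup>+x. ennreal \<bar>f m x - U x\<bar> \<partial>lborel) \<le> ennreal (e' * s / 2)"
      using f_eventually[of "e' * s / 2"] e' s by auto
    define m where "m = max m0 n"
    have m: "(\<integral>\<^sup>+x. ennreal \<bar>f m x - U x\<bar> \<partial>lborel) \<le> ennreal (e' * s / 2)" "n \<le> m"
      using m0[of m] by (auto simp: m_def)
    let ?q = "\<lambda>g x. (g (exp s *\<^sub>R x) - g x) / s"
    let ?a = "\<lambda>x. inverse s * \<bar>f m (exp s *\<^sub>R x) - U (exp s *\<^sub>R x)\<bar>"
    let ?b = "\<lambda>x. inverse s * \<bar>f m x - U x\<bar>"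
    let ?c = "\<lambda>x. inverse s * \<bar>(f m (exp s *\<^sub>R x) - f n (exp s *\<^sub>R x)) - (f m x - f n x)\<bar>"
    let ?d = "\<lambda>x. e' / (V + 1) * indicator (cball (0::'a) R) x"
    let ?e = "\<lambda>x. \<bar>grad (f n) x \<bullet> x - G x \<bullet> x\<bar>"
    have pw: "\<bar>?q U x - G x \<bullet> x\<bar> \<le> ?a x + ?b x + ?c x + ?d x + ?e x" for x
    proof -
      have i: "inverse s * \<bar>t\<bar> = \<bar>inverse s * t\<bar>" for t using s by (simp add: abs_mult)
      have lin: "\<bar>X\<bar> \<le> a + b + c + D + \<bar>t5\<bar>"
        if "X = - t1 + t2 + t3 + t4 + t5" "a = \<bar>t1\<bar>" "b = \<bar>t2\<bar>" "c = \<bar>t3\<bar>" "\<bar>t4\<bar> \<le> D" for X t1 t2 t3 t4 t5 a b c D :: real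
        using that by linarith
      show ?thesis
        by (rule lin[OF _ i i i s0(2)[OF s]]) (use s in \<open>simp add: divide_inverse algebra_simps\<close>)
    qed
    have pos: "0 \<le> ?a x" "0 \<le> ?b x" "0 \<le> ?c x" "0 \<le> ?d x" "0 \<le> ?e x" for x
      using s e' V(2) by auto
    have a: "(\<integral>\<^sup>+x. ennreal (?a x) \<partial>lborel) \<le> ennreal (e' / 2)" and b: "(\<integral>\<^sup>+x. ennreal (?b x) \<partial>lborel) \<le> ennreal (e' / 2)"
    proof -
      have "(\<integral>\<^sup>+x. ennreal (?b x) \<partial>lborel) = ennreal (inverse s) * (\<integral>\<^sup>+x. ennreal \<bar>f m x - U x\<bar> \<partial>lborel)"
        using s by (subst nn_integral_cmult[symmetric]) (auto simp: ennreal_mult)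
      also have "\<dots> \<le> ennreal (inverse s) * ennreal (e' * s / 2)" by (intro mult_left_mono m) auto
      also have "\<dots> = ennreal (e' / 2)" using s e' by (simp flip: ennreal_mult)
      finally show "(\<integral>\<^sup>+x. ennreal (?b x) \<partial>lborel) \<le> ennreal (e' / 2)" .
      moreover have "(\<integral>\<^sup>+x. ennreal (?a x) \<partial>lborel) \<le> (\<integral>\<^sup>+x. ennreal (?b x) \<partial>lborel)"
        using nn_integral_dilation_le[of "\<lambda>x. ennreal (?b x)" "exp s"] s by simp
      ultimately show "(\<integral>\<^sup>+x. ennreal (?a x) \<partial>lborel) \<le> ennreal (e' / 2)" by (rule order_trans[rotated])
    qed
    have c: "(\<integral>\<^sup>+x. ennreal (?c x) \<partial>lborel) \<le> ennreal (2 * e')"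
    proof -
      have "(\<integral>\<^sup>+x. ennreal (?c x) \<partial>lborel) = ennreal (inverse s) * (\<integral>\<^sup>+x. ennreal \<bar>(f m (exp s *\<^sub>R x) - f n (exp s *\<^sub>R x)) - (f m x - f n x)\<bar> \<partial>lborel)"
        using s by (subst nn_integral_cmult[symmetric]) (auto simp: ennreal_mult)
      also have "\<dots> \<le> ennreal (inverse s) * (ennreal s * (\<integral>\<^sup>+x. ennreal \<bar>(grad (f m) x - grad (f n) x) \<bullet> x\<bar> \<partial>lborel))"
        using dilation_difference_le[OF C1_diff[OF f_C1 f_C1], of s m n] s by (intro mult_left_mono) auto
      also have "\<dots> = (\<integral>\<^sup>+x. ennreal \<bar>(grad (f m) x - grad (f n) x) \<bullet> x\<bar> \<partial>lborel)"
        using s by (simp add: mult.assoc[symmetric] flip: ennreal_mult)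
      also have "\<dots> \<le> (\<integral>\<^sup>+x. ennreal \<bar>grad (f m) x \<bullet> x - G x \<bullet> x\<bar> + ennreal \<bar>grad (f n) x \<bullet> x - G x \<bullet> x\<bar> \<partial>lborel)"
        by (intro nn_integral_mono) (auto simp: inner_diff_left simp flip: ennreal_plus intro!: ennreal_leI)
      also have "\<dots> \<le> ennreal e' + ennreal e'"
        by (subst nn_integral_add) (auto intro!: add_mono n m)
      finally show ?thesis using e' by (simp flip: ennreal_plus)
    qed
    have d: "(\<integral>\<^sup>+x. ennreal (?d x) \<partial>lborel) \<le> ennreal e'"
    proof -
      have "(\<integral>\<^sup>+x. ennreal (?d x) \<partial>lborel) = (\<integral>\<^sup>+x. ennreal (e' / (V + 1)) * indicator (cball (0::'a) R) x \<partial>lborel)"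
        by (intro nn_integral_cong) (auto simp: indicator_def)
      also have "\<dots> = ennreal (e' / (V + 1)) * ennreal V" by (subst nn_integral_cmult_indicator) (auto simp: V(1))
      also have "\<dots> = ennreal (e' / (V + 1) * V)" using e' V(2) by (intro ennreal_mult[symmetric]) auto
      also have "\<dots> \<le> ennreal e'" using e' V(2) by (intro ennreal_leI) (simp add: field_simps)
      finally show ?thesis .
    qed
    have "(\<integral>\<^sup>+x. ennreal \<bar>?q U x - G x \<bullet> x\<bar> \<partial>lborel)
       \<le> (\<integral>\<^sup>+x. ennreal (?a x) + ennreal (?b x) + ennreal (?c x) + ennreal (?d x) + ennreal (?e x) \<partial>lborel)"
      using pw pos by (intro nn_integral_mono) (simp add: ennreal_leI flip: ennreal_plus)
    also have "\<dots> = (\<integral>\<^sup>+x. ennreal (?a x) \<partial>lborel) + (\<integral>\<^sup>+x. ennreal (?b x) \<partial>lborel) + (\<integral>\<^sup>+x. ennreal (?c x) \<partial>lborel)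
        + (\<integral>\<^sup>+x. ennreal (?d x) \<partial>lborel) + (\<integral>\<^sup>+x. ennreal (?e x) \<partial>lborel)"
    proof (rule nn_integral_add5)
      show "?a \<in> borel_measurable lborel" "?b \<in> borel_measurable lborel" "?c \<in> borel_measurable lborel"
        by measurable
      show "?d \<in> borel_measurable lborel" by (intro borel_measurable_times borel_measurable_indicator) auto
      show "?e \<in> borel_measurable lborel"
        by (intro borel_measurable_abs borel_measurable_diff borel_measurable_inner) auto
    qed
    also have "\<dots> \<le> ennreal (e' / 2) + ennreal (e' / 2) + ennreal (2 * e') + ennreal e' + ennreal e'"
      by (intro add_mono a b c d n) auto
    also have "\<dots> = ennreal e" using e' by (simp flip: ennreal_plus) (simp add: e'_def)
    finally show ?thesis .
  qed
  then show ?thesis using s0(1) by blast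
qed

lemma integrable_of_L1_close:
  fixes h k :: "'a \<Rightarrow> 'b::{banach, second_countable_topology}"
  assumes h: "integrable lborel h" and [measurable]: "k \<in> borel_measurable borel"
    and le: "(\<integral>\<^sup>+x. ennreal (norm (h x - k x)) \<partial>lborel) \<le> ennreal 1"
  shows "integrable lborel k"
proof -
  have [measurable]: "h \<in> borel_measurable lborel" using h by auto
  have "integrable lborel (\<lambda>x. h x - k x)"
    using le by (intro integrableI_bounded) (auto simp: order_le_less_trans[OF le])
  from Bochner_Integration.integrable_diff[OF h this] show ?thesis by simp
qed

lemma f_integrable: "integrable lborel (f n)"
  using integrable_continuous_bounded_support[OF f_cont f_out] .

lemma grad_integrable: "integrable lborel (grad (f n))"
  by (rule integrable_continuous_bounded_support[OF grad_cont, where M="R + 1"]) (rule grad_out, simp)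

lemma U_integrable: "integrable lborel U"
proof -
  obtain n where "(\<integral>\<^sup>+x. ennreal \<bar>f n x - U x\<bar> \<partial>lborel) \<le> ennreal 1" using f_eventually[of 1] by auto
  then show ?thesis using integrable_of_L1_close[OF f_integrable, of U n] by simp
qed

lemma G_integrable: "integrable lborel G"
proof -
  obtain n where "(\<integral>\<^sup>+x. ennreal (norm (grad (f n) x - G x)) \<partial>lborel) \<le> ennreal 1" using grad_eventually[of 1] by auto
  then show ?thesis using integrable_of_L1_close[OF grad_integrable, of G n] by simp
qed

lemma f_conv_real: "(\<lambda>n. \<integral>x. \<bar>f n x - U x\<bar> \<partial>lborel) \<longlonglongrightarrow> 0"
  using tendsto_enn2real[of _ 0, OF f_conv[folded ennreal_0]] by (subst integral_eq_nn_integral) auto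

lemma grad_conv_real: "(\<lambda>n. \<integral>x. norm (grad (f n) x - G x) \<partial>lborel) \<longlonglongrightarrow> 0"
  using tendsto_enn2real[of _ 0, OF grad_conv[folded ennreal_0]] by (subst integral_eq_nn_integral) auto

section \<open>The gradient of a radial function is orthogonal to rotations\<close>

text \<open>For a polynomial P, integrate the rotational derivative of P(|x|^2) psi: the gradient of
  P(|x|^2) points along x and drops out. On the annulus carrying psi, \<open>U\<close> is continuous
  and is a uniform limit of such P(|x|^2).\<close>

lemma rotd_test_U:
  assumes \<psi>: "C1 \<psi> D\<psi>" and a: "0 < a" "a < a'" "a' < R"
    and out: "\<And>x. norm x \<le> a \<Longrightarrow> \<psi> x = 0" "\<And>x. a' \<le> norm x \<Longrightarrow> \<psi> x = 0"
    and b: "b \<in> Basis" "c \<in> Basis" "b \<noteq> c"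
  shows "(\<integral>x. U x * rotd b c x (D\<psi> x) \<partial>lborel) = 0"
proof -
  let ?X = "\<lambda>x. rotd b c x (D\<psi> x)"
  have cX: "continuous_on UNIV ?X" by (intro continuous_on_rotd C1_continuous_D[OF \<psi>])
  have D0: "D\<psi> x = 0" if "norm x < a \<or> a' < norm x" for x
  proof (cases "norm x < a")
    case True
    then show ?thesis by (intro C1_deriv_eq_0[OF \<psi> open_ball[of 0 a]]) (auto intro: out)
  next
    case False
    then show ?thesis using C1_deriv_support[OF \<psi> out(2)] that by blast
  qed
  have X0: "?X x = 0" if "norm x < a \<or> a' < norm x" for x
    using D0[OF that] by (simp add: rotd_def)
  have iX: "integrable lborel ?X"
    by (rule integrable_continuous_bounded_support[OF cX, where M=R]) (use X0 a in auto)
  \<comment> \<open>The profile of \<open>U\<close> as a function of |x|^2, the variable of the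
    approximating polynomials.\<close>
  define W where "W t = U (sqrt t *\<^sub>R b)" for t
  have W: "continuous_on {a\<^sup>2..a'\<^sup>2} W" unfolding W_def
  proof (rule continuous_on_compose2[OF U_cont])
    show "(\<lambda>t. sqrt t *\<^sub>R b) ` {a\<^sup>2..a'\<^sup>2} \<subseteq> ball 0 R - {0}"
    proof (intro subsetI, elim imageE, simp only:)
      fix t assume t: "t \<in> {a\<^sup>2..a'\<^sup>2}"
      then have "a \<le> sqrt t" "sqrt t \<le> a'" using a by (auto simp: real_le_rsqrt real_le_lsqrt)
      then show "sqrt t *\<^sub>R b \<in> ball 0 R - {0}" using a b by auto
    qed
  qed (intro continuous_intros)
  have UW: "U x = W (x \<bullet> x)" for x
    unfolding W_def using b by (intro U_rad) (simp add: norm_eq_sqrt_inner)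
  have le: "\<bar>\<integral>x. U x * ?X x \<partial>lborel\<bar> \<le> e * (\<integral>x. \<bar>?X x\<bar> \<partial>lborel)" if e: "0 < e" for e
  proof -
    obtain P where P: "real_polynomial_function P" "\<And>t. t \<in> {a\<^sup>2..a'\<^sup>2} \<Longrightarrow> \<bar>W t - P t\<bar> < e"
      using Stone_Weierstrass_real_polynomial_function[OF _ W e] by auto
    obtain P' where P': "real_polynomial_function P'" "\<And>t. (P has_real_derivative P' t) (at t)"
      using has_real_derivative_polynomial_function[OF P(1)] by auto
    have C: "C1 (\<lambda>x::'a. P (x \<bullet> x)) (\<lambda>x. P' (x \<bullet> x) *\<^sub>R (2 *\<^sub>R x))"
      by (rule C1_chain[OF C1_norm_sq P'(2)])
         (use P'(1) continuous_on_polymonial_function real_polynomial_function_eq in blast)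
    have "(\<integral>x. rotd b c x (P (x \<bullet> x) *\<^sub>R D\<psi> x + \<psi> x *\<^sub>R (P' (x \<bullet> x) *\<^sub>R (2 *\<^sub>R x))) \<partial>lborel) = 0"
      by (rule integral_rotd_C1_eq_0[OF C1_mult[OF C \<psi>] _ b, where M=a']) (use out in auto)
    then have P0: "(\<integral>x. P (x \<bullet> x) * ?X x \<partial>lborel) = 0"
      by (simp add: rotd_add rotd_scaleR rotd_self)
    have cP: "continuous_on UNIV (\<lambda>x::'a. P (x \<bullet> x))" using C1_continuous[OF C] .
    have iP: "integrable lborel (\<lambda>x. P (x \<bullet> x) * ?X x)"
      by (rule integrable_continuous_bounded_support[OF continuous_on_mult[OF cP cX], where M=R]) (use X0 a in auto)
    have pw: "\<bar>U x * ?X x - P (x \<bullet> x) * ?X x\<bar> \<le> e * \<bar>?X x\<bar>" for x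
    proof (cases "norm x < a \<or> a' < norm x")
      case False
      then have "a\<^sup>2 \<le> (norm x)\<^sup>2" "(norm x)\<^sup>2 \<le> a'\<^sup>2" using a by (auto intro!: power_mono)
      then have "\<bar>W (x \<bullet> x) - P (x \<bullet> x)\<bar> \<le> e"
        using P(2)[of "x \<bullet> x"] by (simp add: power2_norm_eq_inner)
      then have "\<bar>U x - P (x \<bullet> x)\<bar> * \<bar>?X x\<bar> \<le> e * \<bar>?X x\<bar>" by (intro mult_right_mono) (auto simp: UW)
      then show ?thesis by (simp add: left_diff_distrib[symmetric] abs_mult)
    qed (use X0 in auto)
    have [measurable]: "?X \<in> borel_measurable borel" "(\<lambda>x::'a. P (x \<bullet> x)) \<in> borel_measurable borel"
      using cX cP by (auto intro: borel_measurable_continuous_onI)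
    have iD: "integrable lborel (\<lambda>x. U x * ?X x - P (x \<bullet> x) * ?X x)"
      by (rule Bochner_Integration.integrable_bound[OF integrable_mult_right[OF integrable_abs[OF iX], of e]])
         (use pw in \<open>auto intro!: AE_I2 simp: abs_mult e less_imp_le\<close>)
    have iU: "integrable lborel (\<lambda>x. U x * ?X x)"
      using Bochner_Integration.integrable_add[OF iD iP] by simp
    have eqI: "(\<integral>x. U x * ?X x \<partial>lborel) = (\<integral>x. U x * ?X x - P (x \<bullet> x) * ?X x \<partial>lborel)"
      by (simp only: Bochner_Integration.integral_diff[OF iU iP] P0 diff_zero)
    have "\<bar>\<integral>x. U x * ?X x \<partial>lborel\<bar> \<le> (\<integral>x. \<bar>U x * ?X x - P (x \<bullet> x) * ?X x\<bar> \<partial>lborel)"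
      unfolding eqI by (rule integral_abs_bound)
    also have "\<dots> \<le> (\<integral>x. e * \<bar>?X x\<bar> \<partial>lborel)"
      by (rule integral_mono[OF integrable_abs[OF iD] integrable_mult_right[OF integrable_abs[OF iX]] pw])
    finally show ?thesis by simp
  qed
  have "\<bar>\<integral>x. U x * ?X x \<partial>lborel\<bar> \<le> 0"
  proof (rule field_le_epsilon)
    fix e :: real assume e: "0 < e"
    let ?I = "\<integral>x. \<bar>?X x\<bar> \<partial>lborel"
    have I: "0 \<le> ?I" by simp
    have "e / (t + 1) * t \<le> e" if "0 \<le> t" for t using e that by (simp add: field_simps)
    from this[OF I] have "e / (?I + 1) * ?I \<le> e" .
    then show "\<bar>\<integral>x. U x * ?X x \<partial>lborel\<bar> \<le> 0 + e" using le[of "e / (?I + 1)"] e I by simp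
  qed
  then show ?thesis by simp
qed

lemma rotd_conv:
  assumes b: "b \<in> Basis" "c \<in> Basis"
  shows "\<bar>rotd b c x (grad (f n) x) - rotd b c x (G x)\<bar> \<le> 2 * R * norm (grad (f n) x - G x)"
proof (cases "norm x \<le> R")
  case True
  have "\<bar>rotd b c x (grad (f n) x - G x)\<bar> \<le> 2 * norm x * norm (grad (f n) x - G x)"
    by (rule abs_rotd_le[OF b])
  also have "\<dots> \<le> 2 * R * norm (grad (f n) x - G x)" using True by (intro mult_right_mono) auto
  finally show ?thesis by (simp add: rotd_diff)
next
  case False
  then show ?thesis using grad_out[of x] G_out[of x] by (simp add: rotd_def)
qed

lemma rotd_meas [measurable]:
  fixes h :: "'a \<Rightarrow> 'a"
  shows "h \<in> borel_measurable borel \<Longrightarrow> (\<lambda>x. rotd b c x (h x)) \<in> borel_measurable borel"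
  unfolding rotd_def by (auto intro!: borel_measurable_diff borel_measurable_times borel_measurable_inner)

lemma grad_diff_integrable: "integrable lborel (\<lambda>x. norm (grad (f n) x - G x))"
  by (intro integrable_norm Bochner_Integration.integrable_diff grad_integrable G_integrable)

lemma rotd_G_integrable:
  assumes b: "b \<in> Basis" "c \<in> Basis"
  shows "integrable lborel (\<lambda>x. rotd b c x (G x))"
proof (rule Bochner_Integration.integrable_bound[OF integrable_mult_right[OF integrable_norm[OF G_integrable], of "2 * R"]])
  have "\<bar>rotd b c x (G x)\<bar> \<le> 2 * R * norm (G x)" for x
  proof (cases "norm x \<le> R")
    case True
    then show ?thesis
      by (intro order_trans[OF abs_rotd_le[OF b]] mult_right_mono) auto
  qed (use G_out[of x] in \<open>auto simp: rotd_def\<close>)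
  then show "AE x in lborel. norm (rotd b c x (G x)) \<le> norm (2 * R * norm (G x))" using R by simp
qed simp

text \<open>Integrate by parts with the test functions \<open>f n\<close>. Since psi and its
  rotational derivative are bounded, L^1 convergence of \<open>f n\<close> and of the gradients
  suffices for both terms, and the limit of the first is 0 because \<open>U\<close> is
  radial.\<close>

lemma rotd_test_G:
  assumes \<psi>: "C1 \<psi> D\<psi>" and a: "0 < a" "a < a'" "a' < R"
    and out: "\<And>x. norm x \<le> a \<Longrightarrow> \<psi> x = 0" "\<And>x. a' \<le> norm x \<Longrightarrow> \<psi> x = 0"
    and b: "b \<in> Basis" "c \<in> Basis" "b \<noteq> c"
  shows "(\<integral>x. \<psi> x * rotd b c x (G x) \<partial>lborel) = 0"
proof -
  let ?X = "\<lambda>x. rotd b c x (D\<psi> x)"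
  have cX: "continuous_on UNIV ?X" and c\<psi>: "continuous_on UNIV \<psi>"
    by (auto intro!: continuous_on_rotd C1_continuous_D[OF \<psi>] C1_continuous[OF \<psi>])
  have [measurable]: "?X \<in> borel_measurable borel" "\<psi> \<in> borel_measurable borel"
    using cX c\<psi> by (auto intro: borel_measurable_continuous_onI)
  have X0: "?X x = 0" if "a' < norm x" for x
    using C1_deriv_support[OF \<psi> out(2) that] by (simp add: rotd_def)
  have "\<exists>C>0. \<forall>x. norm (?X x) \<le> C"
    by (rule continuous_bounded_support_bounded[OF cX]) (rule X0)
  then obtain C where C: "0 < C" "\<And>x. \<bar>?X x\<bar> \<le> C" by auto
  have "\<exists>C>0. \<forall>x. norm (\<psi> x) \<le> C"
    by (rule continuous_bounded_support_bounded[OF c\<psi>, of a']) (simp add: out)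
  then obtain C' where C': "0 < C'" "\<And>x. \<bar>\<psi> x\<bar> \<le> C'" by auto
  have iUX: "integrable lborel (\<lambda>x. U x * ?X x)"
    by (rule Bochner_Integration.integrable_bound[OF integrable_mult_left[OF integrable_abs[OF U_integrable], of C]])
       (use C in \<open>auto intro!: AE_I2 mult_left_mono simp: abs_mult\<close>)
  have ifX: "integrable lborel (\<lambda>x. f n x * ?X x)" for n
    by (rule integrable_continuous_bounded_support[OF continuous_on_mult[OF f_cont cX] , where M=R]) (simp add: f_out)
  have iG: "integrable lborel (\<lambda>x. \<psi> x * rotd b c x (G x))"
    by (rule Bochner_Integration.integrable_bound[OF integrable_mult_right[OF integrable_abs[OF rotd_G_integrable[OF b(1,2)]], of C']])
       (use C' in \<open>auto intro!: AE_I2 mult_right_mono simp: abs_mult\<close>)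
  have ig: "integrable lborel (\<lambda>x. \<psi> x * rotd b c x (grad (f n) x))" for n
    by (rule integrable_continuous_bounded_support[OF continuous_on_mult[OF c\<psi> continuous_on_rotd[OF grad_cont]], where M=a']) (simp add: out)
  have le: "\<bar>\<integral>x. \<psi> x * rotd b c x (G x) \<partial>lborel\<bar> \<le> C' * (2 * R) * (\<integral>x. norm (grad (f n) x - G x) \<partial>lborel)
      + C * (\<integral>x. \<bar>f n x - U x\<bar> \<partial>lborel)" for n
  proof -
    have "(\<integral>x. rotd b c x (f n x *\<^sub>R D\<psi> x + \<psi> x *\<^sub>R grad (f n) x) \<partial>lborel) = 0"
      by (rule integral_rotd_C1_eq_0[OF C1_mult[OF f_C1 \<psi>] _ b, where M=R]) (simp add: f_out)
    then have "(\<integral>x. f n x * ?X x \<partial>lborel) + (\<integral>x. \<psi> x * rotd b c x (grad (f n) x) \<partial>lborel) = 0"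
      by (subst Bochner_Integration.integral_add[OF ifX ig, symmetric]) (simp add: rotd_add rotd_scaleR)
    moreover have "(\<integral>x. U x * ?X x \<partial>lborel) = 0" by (rule rotd_test_U[OF \<psi> a out b])
    ultimately have "(\<integral>x. \<psi> x * rotd b c x (G x) \<partial>lborel)
       = (\<integral>x. \<psi> x * rotd b c x (G x) - \<psi> x * rotd b c x (grad (f n) x) \<partial>lborel)
       + (\<integral>x. U x * ?X x - f n x * ?X x \<partial>lborel)"
      unfolding Bochner_Integration.integral_diff[OF iG ig] Bochner_Integration.integral_diff[OF iUX ifX] by linarith
    then have "\<bar>\<integral>x. \<psi> x * rotd b c x (G x) \<partial>lborel\<bar> \<le> (\<integral>x. \<bar>\<psi> x * rotd b c x (G x) - \<psi> x * rotd b c x (grad (f n) x)\<bar> \<partial>lborel)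
       + (\<integral>x. \<bar>U x * ?X x - f n x * ?X x\<bar> \<partial>lborel)"
      by (simp only:) (intro order_trans[OF abs_triangle_ineq] add_mono integral_abs_bound)
    also have "\<dots> \<le> (\<integral>x. C' * (2 * R) * norm (grad (f n) x - G x) \<partial>lborel) + (\<integral>x. C * \<bar>f n x - U x\<bar> \<partial>lborel)"
    proof (intro add_mono)
      have pw1: "\<bar>\<psi> x * rotd b c x (G x) - \<psi> x * rotd b c x (grad (f n) x)\<bar> \<le> C' * (2 * R) * norm (grad (f n) x - G x)" for x
      proof -
        have "\<bar>\<psi> x\<bar> * \<bar>rotd b c x (grad (f n) x) - rotd b c x (G x)\<bar> \<le> C' * (2 * R * norm (grad (f n) x - G x))"
          using C' by (intro mult_mono rotd_conv b) auto
        then show ?thesis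
          by (simp add: right_diff_distrib[symmetric] abs_mult abs_minus_commute mult.assoc)
      qed
      show "(\<integral>x. \<bar>\<psi> x * rotd b c x (G x) - \<psi> x * rotd b c x (grad (f n) x)\<bar> \<partial>lborel) \<le> (\<integral>x. C' * (2 * R) * norm (grad (f n) x - G x) \<partial>lborel)"
        by (rule integral_mono[OF integrable_abs[OF Bochner_Integration.integrable_diff[OF iG ig]] integrable_mult_right[OF grad_diff_integrable] pw1])
      have pw2: "\<bar>U x * ?X x - f n x * ?X x\<bar> \<le> C * \<bar>f n x - U x\<bar>" for x
      proof -
        have "\<bar>f n x - U x\<bar> * \<bar>?X x\<bar> \<le> \<bar>f n x - U x\<bar> * C" using C by (intro mult_left_mono) auto
        moreover have "\<bar>U x * ?X x - f n x * ?X x\<bar> = \<bar>f n x - U x\<bar> * \<bar>?X x\<bar>"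
          by (metis abs_minus_commute abs_mult left_diff_distrib)
        ultimately show ?thesis by (simp add: mult.commute)
      qed
      show "(\<integral>x. \<bar>U x * ?X x - f n x * ?X x\<bar> \<partial>lborel) \<le> (\<integral>x. C * \<bar>f n x - U x\<bar> \<partial>lborel)"
        by (rule integral_mono[OF integrable_abs[OF Bochner_Integration.integrable_diff[OF iUX ifX]]
              integrable_mult_right[OF integrable_abs[OF Bochner_Integration.integrable_diff[OF f_integrable U_integrable]]] pw2])
    qed
    finally show ?thesis by simp
  qed
  have "(\<lambda>n. C' * (2 * R) * (\<integral>x. norm (grad (f n) x - G x) \<partial>lborel)
      + C * (\<integral>x. \<bar>f n x - U x\<bar> \<partial>lborel)) \<longlonglongrightarrow> C' * (2 * R) * 0 + C * 0"
    by (intro tendsto_intros grad_conv_real f_conv_real)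
  then have "\<bar>\<integral>x. \<psi> x * rotd b c x (G x) \<partial>lborel\<bar> \<le> C' * (2 * R) * 0 + C * 0"
    by (rule LIMSEQ_le_const) (use le in auto)
  then show ?thesis by simp
qed

text \<open>
  The test function is a cutoff times \<open>arctan\<close> of the rotational derivative of an approximation \<open>f n\<close>:
  \<open>arctan\<close> keeps it bounded, so that \<open>L\<^sup>1\<close>-convergence suffices, and its product with the limit is nonnegative.
\<close>

lemma rotd_G_annulus:
  assumes a: "0 < a" "a < a'" "a' < R" and b: "b \<in> Basis" "c \<in> Basis" "b \<noteq> c"
  shows "AE x in lborel. a < norm x \<longrightarrow> norm x < a' \<longrightarrow> rotd b c x (G x) = 0"
proof -
  \<comment> \<open>Positive exactly between the squared radii; the outer square makes the cutoff
    C^1.\<close>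
  define h where "h t = (max 0 ((t - a\<^sup>2) * (a'\<^sup>2 - t)))\<^sup>2" for t :: real
  define h' where "h' t = 2 * max 0 ((t - a\<^sup>2) * (a'\<^sup>2 - t)) * ((a'\<^sup>2 - t) - (t - a\<^sup>2))" for t :: real
  have dh: "(h has_real_derivative h' t) (at t)" for t
    unfolding h_def h'_def
    by (rule DERIV_chain2[OF DERIV_max0_square]) (auto intro!: derivative_eq_intros)
  have ch': "continuous_on UNIV h'" unfolding h'_def by (intro continuous_intros)
  define cut where "cut x = h (x \<bullet> x)" for x :: 'a
  have Ccut: "C1 cut (\<lambda>x. h' (x \<bullet> x) *\<^sub>R (2 *\<^sub>R x))"
    unfolding cut_def by (rule C1_chain[OF C1_norm_sq dh ch'])
  have cut_out: "cut x = 0" if "norm x \<le> a \<or> a' \<le> norm x" for x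
  proof -
    have "(x \<bullet> x - a\<^sup>2) * (a'\<^sup>2 - x \<bullet> x) \<le> 0"
    proof (cases "norm x \<le> a")
      case True
      then have "(norm x)\<^sup>2 \<le> a\<^sup>2" "a\<^sup>2 \<le> a'\<^sup>2" using a by (auto intro!: power_mono)
      then show ?thesis by (intro mult_nonpos_nonneg) (auto simp: power2_norm_eq_inner)
    next
      case False
      then have "a'\<^sup>2 \<le> (norm x)\<^sup>2" "a\<^sup>2 \<le> a'\<^sup>2" using that a by (auto intro!: power_mono)
      then show ?thesis by (intro mult_nonneg_nonpos) (auto simp: power2_norm_eq_inner)
    qed
    then show ?thesis by (simp add: cut_def h_def max_def)
  qed
  have cut_pos: "0 < cut x" if "a < norm x" "norm x < a'" for x
  proof -
    have "a\<^sup>2 < (norm x)\<^sup>2" "(norm x)\<^sup>2 < a'\<^sup>2" using that a by (auto intro!: power_strict_mono)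
    then have "0 < (x \<bullet> x - a\<^sup>2) * (a'\<^sup>2 - x \<bullet> x)" by (intro mult_pos_pos) (auto simp: power2_norm_eq_inner)
    then have "0 < (max 0 ((x \<bullet> x - a\<^sup>2) * (a'\<^sup>2 - x \<bullet> x)))\<^sup>2" by (intro zero_less_power) simp
    then show ?thesis by (simp only: cut_def h_def)
  qed
  have cut_nn: "0 \<le> cut x" for x by (simp add: cut_def h_def)
  have ccut: "continuous_on UNIV cut" using C1_continuous[OF Ccut] .
  have [measurable]: "cut \<in> borel_measurable borel" using ccut by (rule borel_measurable_continuous_onI)
  have "\<exists>C>0. \<forall>x. norm (cut x) \<le> C"
    by (rule continuous_bounded_support_bounded[OF ccut, of a']) (simp add: cut_out)
  then obtain C where C: "0 < C" "\<And>x. \<bar>cut x\<bar> \<le> C" by auto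
  let ?F = "\<lambda>x. rotd b c x (G x)"
  let ?Fn = "\<lambda>n x. rotd b c x (grad (f n) x)"
  have iF: "integrable lborel ?F" using rotd_G_integrable[OF b(1,2)] .
  have cFn: "continuous_on UNIV (?Fn n)" for n by (intro continuous_on_rotd grad_cont)
  have [measurable]: "?Fn n \<in> borel_measurable borel" for n by measurable
  have iFn: "integrable lborel (?Fn n)" for n
    by (rule integrable_continuous_bounded_support[OF cFn, where M="R + 1"]) (use grad_out in \<open>auto simp: rotd_def\<close>)
  have at_meas: "(\<lambda>x::real. arctan x) \<in> borel_measurable borel"
    by (intro borel_measurable_continuous_onI continuous_intros)
  note [measurable] = measurable_compose[OF _ at_meas]
  have CFn: "\<exists>D. C1 (?Fn n) D" for n
    unfolding rotd_def using C1_diff[OF C1_mult[OF C1_inner f_C2[OF b(2)]] C1_mult[OF C1_inner f_C2[OF b(1)]]] by blast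
  have diff: "integrable lborel (\<lambda>x. \<bar>?Fn n x - ?F x\<bar>)" for n
    by (intro integrable_abs Bochner_Integration.integrable_diff iFn iF)
  have bnd: "integrable lborel (\<lambda>x. cut x * k x * arctan (g x))"
    if k: "integrable lborel k" and [measurable]: "g \<in> borel_measurable borel" for k g :: "'a \<Rightarrow> real"
  proof (rule Bochner_Integration.integrable_bound[OF integrable_mult_right[OF integrable_abs[OF k], of "C * 2"]])
    have [measurable]: "k \<in> borel_measurable lborel" using k by auto
    show "(\<lambda>x. cut x * k x * arctan (g x)) \<in> borel_measurable lborel" by measurable
    have "\<bar>cut x\<bar> * \<bar>arctan (g x)\<bar> * \<bar>k x\<bar> \<le> C * 2 * \<bar>k x\<bar>" for x
      using C abs_arctan_le_2 by (intro mult_right_mono mult_mono) auto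
    then show "AE x in lborel. norm (cut x * k x * arctan (g x)) \<le> norm (C * 2 * \<bar>k x\<bar>)"
      using C(1) by (simp add: abs_mult mult_ac)
  qed
  \<comment> \<open>Replacing F arctan F by Fn arctan Fn costs 3 C by the Lipschitz bound. Next, Fn
    arctan Fn = (Fn - F) arctan Fn + F arctan Fn: the first summand costs 2 C, the second integrates
    to 0 against the cutoff.\<close>
  have le: "(\<integral>x. cut x * ?F x * arctan (?F x) \<partial>lborel) \<le> 5 * C * (\<integral>x. \<bar>?Fn n x - ?F x\<bar> \<partial>lborel)" for n
  proof -
    obtain D where D: "C1 (?Fn n) D" using CFn by blast
    have ca: "continuous_on UNIV (\<lambda>x::real. inverse (1 + x\<^sup>2))"
      by (intro continuous_intros) (metis add_pos_nonneg less_irrefl zero_le_power2 zero_less_one)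
    have Ca: "C1 (\<lambda>x. arctan (?Fn n x)) (\<lambda>x. inverse (1 + (?Fn n x)\<^sup>2) *\<^sub>R D x)"
      by (rule C1_chain[OF D DERIV_arctan ca])
    have test0: "(\<integral>x. cut x * arctan (?Fn n x) * ?F x \<partial>lborel) = 0"
      by (rule rotd_test_G[OF C1_mult[OF Ccut Ca] a _ _ b]) (auto simp: cut_out)
    have i1: "integrable lborel (\<lambda>x. cut x * (?Fn n x - ?F x) * arctan (?Fn n x))"
      by (intro bnd Bochner_Integration.integrable_diff iFn iF) measurable
    have "(\<integral>x. cut x * ?F x * arctan (?F x) \<partial>lborel)
        \<le> (\<integral>x. cut x * (?Fn n x - ?F x) * arctan (?Fn n x) + cut x * ?F x * arctan (?Fn n x) + 3 * C * \<bar>?Fn n x - ?F x\<bar> \<partial>lborel)"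
    proof (intro integral_mono Bochner_Integration.integrable_add i1 bnd iF integrable_mult_right diff)
      fix x
      have "cut x * (?F x * arctan (?F x) - ?Fn n x * arctan (?Fn n x)) \<le> cut x * (3 * \<bar>?F x - ?Fn n x\<bar>)"
        using mult_arctan_lipschitz[of "?F x" "?Fn n x"] cut_nn[of x] by (intro mult_left_mono) auto
      also have "\<dots> \<le> C * (3 * \<bar>?F x - ?Fn n x\<bar>)" using C(2)[of x] by (intro mult_right_mono) auto
      finally show "cut x * ?F x * arctan (?F x) \<le> cut x * (?Fn n x - ?F x) * arctan (?Fn n x) + cut x * ?F x * arctan (?Fn n x) + 3 * C * \<bar>?Fn n x - ?F x\<bar>"
        by (simp add: algebra_simps abs_minus_commute)
    qed measurable
    also have "\<dots> = (\<integral>x. cut x * (?Fn n x - ?F x) * arctan (?Fn n x) \<partial>lborel) + 0 + 3 * C * (\<integral>x. \<bar>?Fn n x - ?F x\<bar> \<partial>lborel)"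
    proof -
      have i2: "integrable lborel (\<lambda>x. cut x * ?F x * arctan (?Fn n x))" by (intro bnd iF) measurable
      have "(\<integral>x. cut x * ?F x * arctan (?Fn n x) \<partial>lborel) = 0" using test0 by (simp add: mult_ac)
      then show ?thesis
        by (subst Bochner_Integration.integral_add[OF Bochner_Integration.integrable_add[OF i1 i2] integrable_mult_right[OF diff]])
           (subst Bochner_Integration.integral_add[OF i1 i2], simp)
    qed
    finally have le1: "(\<integral>x. cut x * ?F x * arctan (?F x) \<partial>lborel) \<le> (\<integral>x. cut x * (?Fn n x - ?F x) * arctan (?Fn n x) \<partial>lborel) + 0 + 3 * C * (\<integral>x. \<bar>?Fn n x - ?F x\<bar> \<partial>lborel)" .
    have le2: "(\<integral>x. cut x * (?Fn n x - ?F x) * arctan (?Fn n x) \<partial>lborel) \<le> (\<integral>x. 2 * C * \<bar>?Fn n x - ?F x\<bar> \<partial>lborel)"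
    proof (intro integral_mono i1 integrable_mult_right diff)
      fix x
      have "cut x * (?Fn n x - ?F x) * arctan (?Fn n x) \<le> \<bar>cut x * (?Fn n x - ?F x) * arctan (?Fn n x)\<bar>"
        by (rule abs_ge_self)
      then have "cut x * (?Fn n x - ?F x) * arctan (?Fn n x) \<le> \<bar>cut x\<bar> * \<bar>arctan (?Fn n x)\<bar> * \<bar>?Fn n x - ?F x\<bar>"
        by (simp only: abs_mult mult_ac)
      also have "\<dots> \<le> C * 2 * \<bar>?Fn n x - ?F x\<bar>" using C abs_arctan_le_2 by (intro mult_right_mono mult_mono) auto
      finally show "cut x * (?Fn n x - ?F x) * arctan (?Fn n x) \<le> 2 * C * \<bar>?Fn n x - ?F x\<bar>" by simp
    qed
    have eq: "(\<integral>x. 2 * C * \<bar>?Fn n x - ?F x\<bar> \<partial>lborel) = 2 * C * (\<integral>x. \<bar>?Fn n x - ?F x\<bar> \<partial>lborel)"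
      by (rule integral_mult_right_zero)
    have lin: "I0 \<le> 5 * C * J" if "I0 \<le> I1 + 0 + 3 * C * J" "I1 \<le> K" "K = 2 * C * J" for I0 I1 J K :: real
      using that by simp
    show ?thesis by (rule lin[OF le1 le2 eq])
  qed
  have conv: "(\<lambda>n. \<integral>x. \<bar>?Fn n x - ?F x\<bar> \<partial>lborel) \<longlonglongrightarrow> 0"
  proof (rule tendsto_sandwich[OF _ _ tendsto_const])
    show "\<forall>\<^sub>F n in sequentially. (\<integral>x. \<bar>?Fn n x - ?F x\<bar> \<partial>lborel) \<le> 2 * R * (\<integral>x. norm (grad (f n) x - G x) \<partial>lborel)"
    proof (rule always_eventually, rule allI)
      fix n
      have "(\<integral>x. \<bar>?Fn n x - ?F x\<bar> \<partial>lborel) \<le> (\<integral>x. 2 * R * norm (grad (f n) x - G x) \<partial>lborel)"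
        by (rule integral_mono[OF diff integrable_mult_right[OF grad_diff_integrable] rotd_conv[OF b(1,2)]])
      then show "(\<integral>x. \<bar>?Fn n x - ?F x\<bar> \<partial>lborel) \<le> 2 * R * (\<integral>x. norm (grad (f n) x - G x) \<partial>lborel)"
        by simp
    qed
    show "(\<lambda>n. 2 * R * (\<integral>x. norm (grad (f n) x - G x) \<partial>lborel)) \<longlonglongrightarrow> 0"
      using tendsto_mult[OF tendsto_const grad_conv_real, of "2 * R"] by simp
  qed simp
  have "(\<lambda>n. 5 * C * (\<integral>x. \<bar>?Fn n x - ?F x\<bar> \<partial>lborel)) \<longlonglongrightarrow> 5 * C * 0"
    by (intro tendsto_intros conv)
  then have "(\<integral>x. cut x * ?F x * arctan (?F x) \<partial>lborel) \<le> 5 * C * 0"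
    by (rule LIMSEQ_le_const) (use le in auto)
  moreover have nn: "0 \<le> cut x * ?F x * arctan (?F x)" for x
  proof -
    have "0 \<le> ?F x * arctan (?F x)"
      by (cases "0 \<le> ?F x") (auto intro: mult_nonneg_nonneg mult_nonpos_nonpos simp: arctan_le_zero_iff)
    then show ?thesis using mult_nonneg_nonneg[OF cut_nn[of x]] by (simp add: mult.assoc)
  qed
  ultimately have "(\<integral>x. cut x * ?F x * arctan (?F x) \<partial>lborel) = 0"
    using Bochner_Integration.integral_nonneg[of lborel "\<lambda>x. cut x * ?F x * arctan (?F x)"] by (auto intro: antisym)
  then have "AE x in lborel. cut x * ?F x * arctan (?F x) = 0"
    by (subst (asm) integral_nonneg_eq_0_iff_AE) (auto simp: nn intro!: bnd iF)
  \<comment> \<open>s arctan s vanishes only at s = 0, and the cutoff is positive inside the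
    annulus.\<close>
  then show ?thesis
    by eventually_elim (use cut_pos in fastforce)
qed

lemma rotd_G:
  assumes b: "b \<in> Basis" "c \<in> Basis" "b \<noteq> c"
  shows "AE x in lborel. rotd b c x (G x) = 0"
proof -
  \<comment> \<open>Countably many annuli exhaust the punctured ball; the offset 3 keeps the inner
    radius below the outer one.\<close>
  have "AE x in lborel. R / real (n + 3) < norm x \<longrightarrow> norm x < R - R / real (n + 3) \<longrightarrow> rotd b c x (G x) = 0" for n
  proof (rule rotd_G_annulus[OF _ _ _ b])
    have "R / real (n + 3) < R / 2" using R by (intro divide_strict_left_mono) auto
    then show "R / real (n + 3) < R - R / real (n + 3)" by linarith
  qed (use R in auto)
  then have "AE x in lborel. \<forall>n. R / real (n + 3) < norm x \<longrightarrow> norm x < R - R / real (n + 3) \<longrightarrow> rotd b c x (G x) = 0"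
    by (subst AE_all_countable) auto
  then show ?thesis
  proof eventually_elim
    case (elim x)
    show ?case
    proof (cases "x = 0 \<or> R \<le> norm x")
      case True
      then show ?thesis using G_out[of x] by (auto simp: rotd_def)
    next
      case False
      have "(\<lambda>n. R / real (n + 3)) \<longlonglongrightarrow> 0"
        by (intro tendsto_divide_0[OF tendsto_const] filterlim_compose[OF filterlim_real_sequentially]
             filterlim_at_top_imp_at_infinity filterlim_add_const_nat_at_top)
      then have "\<forall>\<^sub>F n in sequentially. R / real (n + 3) < min (norm x) (R - norm x)"
        by (rule order_tendstoD(2)) (use False in auto)
      then obtain n where "R / real (n + 3) < min (norm x) (R - norm x)"
        unfolding eventually_sequentially by blast
      then show ?thesis using elim[rule_format, of n] by simp
    qed
  qed
qed

text \<open>The vanishing rotational components are the 2 by 2 minors of x and G x, so the vectors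
  are parallel; summing (x.b)(G.c) = (x.c)(G.b) against x.b identifies the factor.\<close>

lemma G_radial_direction: "AE x in lborel. G x = ((G x \<bullet> x) / (norm x)\<^sup>2) *\<^sub>R x"
proof -
  have "AE x in lborel. \<forall>b\<in>Basis. \<forall>c\<in>Basis. b \<noteq> c \<longrightarrow> rotd b c x (G x) = 0"
    by (intro AE_finite_allI finite_Basis) (auto intro: rotd_G)
  with AE_lborel_singleton[of 0] show ?thesis
  proof eventually_elim
    case (elim x)
    have rot: "(x \<bullet> b) * (G x \<bullet> c) = (x \<bullet> c) * (G x \<bullet> b)" if "b \<in> Basis" "c \<in> Basis" for b c
      using elim(2) that by (cases "b = c") (auto simp: rotd_def)
    show ?case
    proof (rule euclidean_eqI)
      fix c :: 'a assume c: "c \<in> Basis"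
      have "(G x \<bullet> c) * (norm x)\<^sup>2 = (\<Sum>b\<in>Basis. (x \<bullet> b) * (x \<bullet> b) * (G x \<bullet> c))"
        by (simp add: power2_norm_eq_inner euclidean_inner[of x x] sum_distrib_left sum_distrib_right mult.commute)
      also have "\<dots> = (\<Sum>b\<in>Basis. (x \<bullet> c) * ((G x \<bullet> b) * (x \<bullet> b)))"
        using rot c by (intro sum.cong) (auto simp: mult_ac)
      also have "\<dots> = (x \<bullet> c) * (G x \<bullet> x)"
        by (simp add: euclidean_inner[of "G x" x] sum_distrib_left)
      finally show "G x \<bullet> c = (((G x \<bullet> x) / (norm x)\<^sup>2) *\<^sub>R x) \<bullet> c"
        using elim(1) by (simp add: field_simps)
    qed
  qed
qed

end

section \<open>One-dimensional profile of the function and its gradient\<close>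

text \<open>\<open>cN\<close> is the area of the unit sphere, the constant of integration in polar
  coordinates.\<close>

locale radial_W0_dim = radial_W0 p R U G f
  for p R :: real and U :: "'a::euclidean_space \<Rightarrow> real" and G :: "'a \<Rightarrow> 'a" and f :: "nat \<Rightarrow> 'a \<Rightarrow> real" +
  fixes N cN :: real
  assumes N_def: "N = real DIM('a)" and cN_def: "cN = N * unit_ball_vol N"
begin

definition e0 :: 'a where "e0 = (SOME b. b \<in> Basis)"

lemma e0_Basis: "e0 \<in> Basis"
  unfolding e0_def by (rule someI_ex) (use nonempty_Basis in blast)

lemma norm_e0 [simp]: "norm e0 = 1"
  using e0_Basis by simp

definition V :: "real \<Rightarrow> real" where "V t = U (exp t *\<^sub>R e0)"

lemma U_eq_V: "x \<noteq> 0 \<Longrightarrow> U x = V (ln (norm x))"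
  unfolding V_def by (rule U_rad) simp

lemma V_out: "ln R \<le> t \<Longrightarrow> V t = 0"
  unfolding V_def using R by (intro U_out) (simp add: ln_ge_iff[symmetric] ln_le_cancel_iff flip: ln_le_cancel_iff[of R "exp t"])

lemma V_meas [measurable]: "V \<in> borel_measurable borel"
  unfolding V_def[abs_def] by measurable

lemma isCont_V: "t < ln R \<Longrightarrow> isCont V t"
proof -
  assume t: "t < ln R"
  have "continuous_on {..<ln R} V"
    unfolding V_def
  proof (rule continuous_on_compose2[OF U_cont])
    show "(\<lambda>t. exp t *\<^sub>R e0) ` {..<ln R} \<subseteq> ball 0 R - {0}"
      using R e0_Basis by (auto simp: nonzero_Basis ln_less_cancel_iff simp flip: exp_less_cancel_iff[of _ "ln R"])
  qed (intro continuous_intros)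
  then show ?thesis using t by (simp add: continuous_on_eq_continuous_at)
qed

lemma cN_pos: "0 < cN" by (simp add: cN_def N_def)

lemma nn_integral_radial:
  assumes "h \<in> borel_measurable borel" "AE x in lborel. k x = h (ln (norm x))"
  shows "(\<integral>\<^sup>+x. k (x::'a) \<partial>lborel) = (\<integral>\<^sup>+t. ennreal (cN * exp (N * t)) * h t \<partial>lborel)"
proof -
  have "(\<integral>\<^sup>+x. k (x::'a) \<partial>lborel) = (\<integral>\<^sup>+x. h (ln (norm (x::'a))) \<partial>lborel)"
    by (rule nn_integral_cong_AE[OF assms(2)])
  then show ?thesis by (simp add: nn_integral_ln_norm[OF assms(1)] cN_def N_def)
qed

text \<open>On the half-line the weight \<open>cN * exp (N * t)\<close> is at least its value at
  \<open>a\<close>, so L^1 bounds in space become L^1 bounds in t away from -infinity.\<close>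

lemma nn_integral_half_line_le:
  assumes [measurable]: "h \<in> borel_measurable borel"
  shows "(\<integral>\<^sup>+t. h t * indicator {a..} t \<partial>lborel) \<le> ennreal (1 / (cN * exp (N * a))) * (\<integral>\<^sup>+t. ennreal (cN * exp (N * t)) * h t \<partial>lborel)"
proof -
  have "h t * indicator {a..} t \<le> ennreal (1 / (cN * exp (N * a))) * (ennreal (cN * exp (N * t)) * h t)" for t
  proof (cases "a \<le> t")
    case True
    have "N * a \<le> N * t" using True by (simp add: N_def mult_left_mono)
    then have "1 \<le> 1 / (cN * exp (N * a)) * (cN * exp (N * t))" using cN_pos by (simp add: field_simps)
    then have "1 \<le> ennreal (1 / (cN * exp (N * a)) * (cN * exp (N * t)))" by (metis ennreal_1 ennreal_leI)
    then have "1 * h t \<le> ennreal (1 / (cN * exp (N * a)) * (cN * exp (N * t))) * h t" by (intro mult_right_mono) auto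
    then show ?thesis using True cN_pos by (simp add: ennreal_mult mult.assoc del: times_divide_eq_left)
  qed simp
  then show ?thesis by (subst nn_integral_cmult[symmetric]) (auto intro: nn_integral_mono)
qed

lemma radial_integrable: "integrable lborel (\<lambda>x. G x \<bullet> x)"
proof (rule Bochner_Integration.integrable_bound[OF integrable_mult_right[OF integrable_norm[OF G_integrable], of R]])
  have "\<bar>G x \<bullet> x\<bar> \<le> R * norm (G x)" for x
  proof (cases "norm x \<le> R")
    case True
    then have "\<bar>G x \<bullet> x\<bar> \<le> norm (G x) * R"
      by (intro order_trans[OF Cauchy_Schwarz_ineq2] mult_left_mono) auto
    then show ?thesis by (simp add: mult.commute)
  qed (use G_out[of x] in auto)
  then show "AE x in lborel. norm (G x \<bullet> x) \<le> norm (R * norm (G x))" using R by simp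
qed simp

lemma V_half_line: "integrable lborel (\<lambda>t. V t * indicator {a..} t)"
proof (rule integrableI_bounded)
  have "(\<integral>\<^sup>+t. ennreal (norm (V t * indicator {a..} t)) \<partial>lborel) = (\<integral>\<^sup>+t. ennreal \<bar>V t\<bar> * indicator {a..} t \<partial>lborel)"
    by (intro nn_integral_cong) (auto simp: indicator_def)
  also have "\<dots> \<le> ennreal (1 / (cN * exp (N * a))) * (\<integral>\<^sup>+t. ennreal (cN * exp (N * t)) * ennreal \<bar>V t\<bar> \<partial>lborel)"
    by (rule nn_integral_half_line_le) measurable
  also have "(\<integral>\<^sup>+t. ennreal (cN * exp (N * t)) * ennreal \<bar>V t\<bar> \<partial>lborel) = (\<integral>\<^sup>+x. ennreal \<bar>U x\<bar> \<partial>lborel)"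
    by (rule nn_integral_radial[symmetric]) (auto intro!: eventually_mono[OF AE_lborel_singleton[of "0::'a"]] simp: U_eq_V)
  also have "ennreal (1 / (cN * exp (N * a))) * \<dots> < \<infinity>"
    using U_integrable by (auto simp: integrable_iff_bounded ennreal_mult_less_top)
  finally show "(\<integral>\<^sup>+t. ennreal (norm (V t * indicator {a..} t)) \<partial>lborel) < \<infinity>" .
qed measurable

definition dquot :: "real \<Rightarrow> real \<Rightarrow> real" where "dquot s t = (V (t + s) - V t) / s"

lemma dquot_meas [measurable]: "dquot s \<in> borel_measurable borel"
  unfolding dquot_def[abs_def] by measurable

lemma U_dquot: "x \<noteq> 0 \<Longrightarrow> (U (exp s *\<^sub>R x) - U x) / s = dquot s (ln (norm x))"
  by (simp add: U_eq_V dquot_def ln_mult add.commute)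

lemma V_shift:
  "integrable lborel (\<lambda>t. V (t + s) * indicator {a..} t)"
  "(\<integral>t. V (t + s) * indicator {a..} t \<partial>lborel) = (\<integral>t. V t * indicator {a + s..} t \<partial>lborel)"
proof -
  have e: "V (t + s) * indicator {a..} t = V (s + 1 * t) * indicator {a + s..} (s + 1 * t)" for t
    by (auto simp: indicator_def add.commute)
  have "has_bochner_integral lborel (\<lambda>t. V t * indicator {a + s..} t) (\<integral>t. V t * indicator {a + s..} t \<partial>lborel)"
    using V_half_line[of "a + s"] by (simp add: has_bochner_integral_integrable)
  then have "has_bochner_integral lborel (\<lambda>t. V (t + s) * indicator {a..} t) (\<integral>t. V t * indicator {a + s..} t \<partial>lborel)"
    unfolding e by (subst (asm) lborel_has_bochner_integral_real_affine_iff[of 1 _ _ s]) auto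
  then show "integrable lborel (\<lambda>t. V (t + s) * indicator {a..} t)"
    "(\<integral>t. V (t + s) * indicator {a..} t \<partial>lborel) = (\<integral>t. V t * indicator {a + s..} t \<partial>lborel)"
    by (auto simp: has_bochner_integral_iff)
qed

text \<open>Shifting the variable in the first half-line integral leaves, with a minus sign, the
  average of \<open>V\<close> just to the right of \<open>a\<close>.\<close>

lemma dquot_half_line:
  assumes s: "0 < s"
  shows "integrable lborel (\<lambda>t. dquot s t * indicator {a..} t)"
    and "(\<integral>t. dquot s t * indicator {a..} t \<partial>lborel) = - ((\<integral>t. V t * indicator {a..<a + s} t \<partial>lborel) / s)"
proof -
  have e: "dquot s t * indicator {a..} t = (V (t + s) * indicator {a..} t - V t * indicator {a..} t) / s" for t
    by (simp add: dquot_def left_diff_distrib)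
  show "integrable lborel (\<lambda>t. dquot s t * indicator {a..} t)"
    unfolding e by (intro Bochner_Integration.integrable_diff integrable_divide V_shift V_half_line)
  have "(\<integral>t. dquot s t * indicator {a..} t \<partial>lborel) = ((\<integral>t. V t * indicator {a + s..} t \<partial>lborel) - (\<integral>t. V t * indicator {a..} t \<partial>lborel)) / s"
    unfolding e integral_divide_zero Bochner_Integration.integral_diff[OF V_shift(1) V_half_line] V_shift(2) ..
  also have "(\<integral>t. V t * indicator {a + s..} t \<partial>lborel) - (\<integral>t. V t * indicator {a..} t \<partial>lborel)
      = (\<integral>t. V t * indicator {a + s..} t - V t * indicator {a..} t \<partial>lborel)"
    by (rule Bochner_Integration.integral_diff[OF V_half_line V_half_line, symmetric])
  also have "\<dots> = (\<integral>t. - (V t * indicator {a..<a + s} t) \<partial>lborel)"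
    using s by (intro Bochner_Integration.integral_cong) (auto simp: indicator_def)
  finally show "(\<integral>t. dquot s t * indicator {a..} t \<partial>lborel) = - ((\<integral>t. V t * indicator {a..<a + s} t \<partial>lborel) / s)"
    by simp
qed

lemma average_V:
  assumes a: "a < ln R" and e: "0 < e"
  shows "\<exists>d>0. \<forall>s. 0 < s \<longrightarrow> s < d \<longrightarrow> \<bar>(\<integral>t. V t * indicator {a..<a + s} t \<partial>lborel) / s - V a\<bar> \<le> e"
proof -
  obtain d where d: "0 < d" "\<And>t. \<bar>t - a\<bar> < d \<Longrightarrow> \<bar>V t - V a\<bar> < e"
    using isCont_V[OF a] e unfolding continuous_at_eps_delta dist_real_def by blast
  have "\<bar>(\<integral>t. V t * indicator {a..<a + s} t \<partial>lborel) / s - V a\<bar> \<le> e" if s: "0 < s" "s < d" for s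
  proof -
    have ind: "integrable lborel (\<lambda>t. indicator {a..<a + s} t * c)" "(\<integral>t. indicator {a..<a + s} t * c \<partial>lborel) = s * c" for c :: real
      using s by auto
    have iV: "integrable lborel (\<lambda>t. V t * indicator {a..<a + s} t)"
      by (rule Bochner_Integration.integrable_bound[OF integrable_norm[OF V_half_line[of a]]])
         (auto simp: indicator_def)
    have iD: "integrable lborel (\<lambda>t. V t * indicator {a..<a + s} t - indicator {a..<a + s} t * V a)"
      by (rule Bochner_Integration.integrable_diff[OF iV ind(1)])
    have "(\<integral>t. V t * indicator {a..<a + s} t \<partial>lborel) - s * V a = (\<integral>t. V t * indicator {a..<a + s} t - indicator {a..<a + s} t * V a \<partial>lborel)"
      by (simp only: Bochner_Integration.integral_diff[OF iV ind(1)] ind(2))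
    then have "\<bar>(\<integral>t. V t * indicator {a..<a + s} t \<partial>lborel) - s * V a\<bar> \<le> (\<integral>t. \<bar>V t * indicator {a..<a + s} t - indicator {a..<a + s} t * V a\<bar> \<partial>lborel)"
      by (simp only:) (rule integral_abs_bound)
    also have "\<dots> \<le> (\<integral>t. indicator {a..<a + s} t * e \<partial>lborel)"
      by (rule integral_mono[OF integrable_abs[OF iD] ind(1)])
         (use d(2) s in \<open>auto simp: indicator_def intro: less_imp_le\<close>)
    also have "\<dots> = s * e" by (rule ind(2))
    finally have "\<bar>((\<integral>t. V t * indicator {a..<a + s} t \<partial>lborel) - s * V a) / s\<bar> \<le> e"
      using s by (simp add: field_simps)
    then show ?thesis using s by (simp add: diff_divide_distrib)
  qed
  then show ?thesis using d(1) by blast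
qed

text \<open>
  \<open>\<kappa>\<close> is the derivative of \<open>V\<close>, that is \<open>r u'(r)\<close> at \<open>r = e\<^sup>t\<close>. It is the almost everywhere limit of a sequence of
  dilation quotients of \<open>U\<close>; each of these is radial, and hence so is their limit \<open>G x \<bullet> x\<close>.
\<close>

theorem radial_profile:
  obtains \<kappa> :: "real \<Rightarrow> real" where "\<kappa> \<in> borel_measurable borel"
    "AE x in lborel. G x = (\<kappa> (ln (norm x)) / (norm x)\<^sup>2) *\<^sub>R x"
    "\<And>a. integrable lborel (\<lambda>t. \<kappa> t * indicator {a..} t)"
    "\<And>a. a < ln R \<Longrightarrow> V a = - (\<integral>t. \<kappa> t * indicator {a..} t \<partial>lborel)"
    "\<And>t. ln R \<le> t \<Longrightarrow> \<kappa> t = 0"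
    "(\<integral>\<^sup>+t. ennreal (\<bar>\<kappa> t\<bar> powr p * exp ((N - p) * t)) \<partial>lborel) < \<infinity>"
proof -
  define \<sigma>' where "\<sigma>' j = inverse (real (Suc j))" for j
  let ?D = "\<lambda>j x. (U (exp (\<sigma>' j) *\<^sub>R x) - U x) / \<sigma>' j - G x \<bullet> x"
  have \<sigma>'_pos: "0 < \<sigma>' j" for j by (simp add: \<sigma>'_def)
  have \<sigma>'_lim: "\<sigma>' \<longlonglongrightarrow> 0" unfolding \<sigma>'_def by (rule LIMSEQ_inverse_real_of_nat)
  have lim: "(\<lambda>j. \<integral>\<^sup>+x. ennreal \<bar>?D j x\<bar> \<partial>lborel) \<longlonglongrightarrow> 0"
  proof (rule order_tendstoI)
    fix e :: ennreal assume e: "0 < e"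
    obtain e' where e': "0 < e'" "ennreal e' < e"
    proof -
      obtain m where m: "0 < m" "m < e" using dense[OF e] by blast
      then obtain x where "m = ennreal x" "0 \<le> x" by (cases m) auto
      then show ?thesis using m that[of x] by (auto simp: ennreal_less_zero_iff)
    qed
    obtain s0 where s0: "0 < s0" "\<And>s. 0 < s \<Longrightarrow> s < s0 \<Longrightarrow> (\<integral>\<^sup>+x. ennreal \<bar>(U (exp s *\<^sub>R x) - U x) / s - G x \<bullet> x\<bar> \<partial>lborel) \<le> ennreal e'"
      using dilation_quotient_L1[OF e'(1)] by blast
    have "\<forall>\<^sub>F j in sequentially. \<sigma>' j < s0" using order_tendstoD(2)[OF \<sigma>'_lim s0(1)] .
    then show "\<forall>\<^sub>F j in sequentially. (\<integral>\<^sup>+x. ennreal \<bar>?D j x\<bar> \<partial>lborel) < e"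
      by eventually_elim (use s0(2) \<sigma>'_pos e'(2) in \<open>blast intro: order_le_less_trans\<close>)
  qed simp
  have iU: "integrable lborel (\<lambda>x. U (exp s *\<^sub>R x))" if "0 < s" for s
  proof (rule integrableI_bounded)
    have "(\<integral>\<^sup>+x. ennreal (norm (U (exp s *\<^sub>R x))) \<partial>lborel) \<le> (\<integral>\<^sup>+x. ennreal (norm (U x)) \<partial>lborel)"
      using nn_integral_dilation_le[of "\<lambda>x. ennreal (norm (U x))" "exp s"] that by simp
    also have "\<dots> < \<infinity>" using U_integrable by (simp add: integrable_iff_bounded)
    finally show "(\<integral>\<^sup>+x. ennreal (norm (U (exp s *\<^sub>R x))) \<partial>lborel) < \<infinity>" .
  qed measurable
  have iD: "integrable lborel (?D j)" for j
    by (intro Bochner_Integration.integrable_diff integrable_divide iU U_integrable radial_integrable \<sigma>'_pos)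
  have [measurable]: "?D j \<in> borel_measurable lborel" for j using iD by auto
  have "(\<lambda>j. \<integral>x. norm (?D j x) \<partial>lborel) \<longlonglongrightarrow> 0"
    using tendsto_enn2real[of _ 0, OF lim[folded ennreal_0]] by (subst integral_eq_nn_integral) auto
  from tendsto_L1_AE_subseq[OF iD this]
  obtain r where r: "strict_mono (r :: nat \<Rightarrow> nat)" "AE x in lborel. (\<lambda>j. ?D (r j) x) \<longlonglongrightarrow> 0" by blast
  define \<sigma> where "\<sigma> j = \<sigma>' (r j)" for j
  have \<sigma>_pos: "0 < \<sigma> j" for j by (simp add: \<sigma>_def \<sigma>'_pos)
  have \<sigma>_lim: "\<sigma> \<longlonglongrightarrow> 0"
    using LIMSEQ_subseq_LIMSEQ[OF \<sigma>'_lim r(1)] by (simp add: \<sigma>_def[abs_def] o_def)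
  \<comment> \<open>\<open>lim\<close> is total, so this is a function of t alone, which is what
    makes its composition with ln |x| radial. Points without convergence form a null set after
    composition.\<close>
  define \<kappa> where "\<kappa> t = lim (\<lambda>j. dquot (\<sigma> j) t)" for t
  have [measurable]: "\<kappa> \<in> borel_measurable borel" unfolding \<kappa>_def[abs_def] by measurable
  have AEk: "AE x in lborel. G x \<bullet> x = \<kappa> (ln (norm x))"
    using r(2) AE_lborel_singleton[of 0]
  proof eventually_elim
    case (elim x)
    then have "(\<lambda>j. dquot (\<sigma> j) (ln (norm x)) - G x \<bullet> x) \<longlonglongrightarrow> 0" by (simp add: U_dquot \<sigma>_def)
    then have "(\<lambda>j. dquot (\<sigma> j) (ln (norm x))) \<longlonglongrightarrow> G x \<bullet> x" by (simp add: LIM_zero_iff)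
    then show ?case by (simp add: \<kappa>_def limI)
  qed
  have AEG: "AE x in lborel. G x = (\<kappa> (ln (norm x)) / (norm x)\<^sup>2) *\<^sub>R x"
    using AEk G_radial_direction by eventually_elim simp
  have lim\<sigma>: "(\<lambda>j. \<integral>\<^sup>+t. ennreal (cN * exp (N * t)) * ennreal \<bar>dquot (\<sigma> j) t - \<kappa> t\<bar> \<partial>lborel) \<longlonglongrightarrow> 0"
  proof -
    have "(\<integral>\<^sup>+t. ennreal (cN * exp (N * t)) * ennreal \<bar>dquot (\<sigma> j) t - \<kappa> t\<bar> \<partial>lborel) = (\<integral>\<^sup>+x. ennreal \<bar>?D (r j) x\<bar> \<partial>lborel)" for j
    proof (rule nn_integral_radial[symmetric])
      show "AE x in lborel. ennreal \<bar>?D (r j) x\<bar> = ennreal \<bar>dquot (\<sigma> j) (ln (norm x)) - \<kappa> (ln (norm x))\<bar>"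
        using AEk AE_lborel_singleton[of 0] by eventually_elim (simp add: U_dquot \<sigma>_def)
    qed measurable
    then show ?thesis using LIMSEQ_subseq_LIMSEQ[OF lim r(1)] by (simp add: o_def)
  qed
  have nnk: "(\<integral>\<^sup>+t. ennreal (norm (\<kappa> t * indicator {a..} t)) \<partial>lborel) < \<infinity>" for a
  proof -
    have "(\<integral>\<^sup>+t. ennreal (norm (\<kappa> t * indicator {a..} t)) \<partial>lborel) = (\<integral>\<^sup>+t. ennreal \<bar>\<kappa> t\<bar> * indicator {a..} t \<partial>lborel)"
      by (intro nn_integral_cong) (auto simp: indicator_def)
    also have "\<dots> \<le> ennreal (1 / (cN * exp (N * a))) * (\<integral>\<^sup>+t. ennreal (cN * exp (N * t)) * ennreal \<bar>\<kappa> t\<bar> \<partial>lborel)"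
      by (rule nn_integral_half_line_le) measurable
    also have "(\<integral>\<^sup>+t. ennreal (cN * exp (N * t)) * ennreal \<bar>\<kappa> t\<bar> \<partial>lborel) = (\<integral>\<^sup>+x. ennreal \<bar>G x \<bullet> x\<bar> \<partial>lborel)"
      by (rule nn_integral_radial[symmetric]) (use AEk in auto)
    also have "ennreal (1 / (cN * exp (N * a))) * \<dots> < \<infinity>"
      using radial_integrable by (auto simp: integrable_iff_bounded ennreal_mult_less_top)
    finally show ?thesis .
  qed
  have ik: "integrable lborel (\<lambda>t. \<kappa> t * indicator {a..} t)" for a
    by (rule integrableI_bounded[OF _ nnk]) measurable
  \<comment> \<open>Two limits of the same half-line integrals: L^1 convergence of the quotients
    gives the integral of the derivative, and the averages of \<open>V\<close> give
    \<open>- V a\<close>.\<close>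
  have Vk: "V a = - (\<integral>t. \<kappa> t * indicator {a..} t \<partial>lborel)" if a: "a < ln R" for a
  proof -
    let ?I = "\<lambda>j. \<integral>t. dquot (\<sigma> j) t * indicator {a..} t \<partial>lborel"
    have "(\<lambda>j. ?I j - (\<integral>t. \<kappa> t * indicator {a..} t \<partial>lborel)) \<longlonglongrightarrow> 0"
    proof (rule Lim_null_comparison)
      let ?B = "\<lambda>j. enn2real (ennreal (1 / (cN * exp (N * a))) * (\<integral>\<^sup>+t. ennreal (cN * exp (N * t)) * ennreal \<bar>dquot (\<sigma> j) t - \<kappa> t\<bar> \<partial>lborel))"
      have l0: "(\<lambda>j. ennreal (1 / (cN * exp (N * a))) * (\<integral>\<^sup>+t. ennreal (cN * exp (N * t)) * ennreal \<bar>dquot (\<sigma> j) t - \<kappa> t\<bar> \<partial>lborel)) \<longlonglongrightarrow> ennreal (1 / (cN * exp (N * a))) * 0"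
        by (rule ennreal_tendsto_cmult[OF _ lim\<sigma>]) simp
      then have l1: "?B \<longlonglongrightarrow> 0" using tendsto_enn2real[of _ 0] by simp
      then show "?B \<longlonglongrightarrow> 0" .
      have "\<forall>\<^sub>F j in sequentially. ennreal (1 / (cN * exp (N * a))) * (\<integral>\<^sup>+t. ennreal (cN * exp (N * t)) * ennreal \<bar>dquot (\<sigma> j) t - \<kappa> t\<bar> \<partial>lborel) < top"
        using order_tendstoD(2)[OF l0, of top] by simp
      then show "\<forall>\<^sub>F j in sequentially. norm (?I j - (\<integral>t. \<kappa> t * indicator {a..} t \<partial>lborel)) \<le> ?B j"
      proof eventually_elim
        case (elim j)
        have iD: "integrable lborel (\<lambda>t. dquot (\<sigma> j) t * indicator {a..} t - \<kappa> t * indicator {a..} t)"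
          by (intro Bochner_Integration.integrable_diff dquot_half_line \<sigma>_pos ik)
        have "norm (?I j - (\<integral>t. \<kappa> t * indicator {a..} t \<partial>lborel)) = norm (\<integral>t. dquot (\<sigma> j) t * indicator {a..} t - \<kappa> t * indicator {a..} t \<partial>lborel)"
          by (simp only: Bochner_Integration.integral_diff[OF dquot_half_line(1)[OF \<sigma>_pos] ik])
        then have "ennreal (norm (?I j - (\<integral>t. \<kappa> t * indicator {a..} t \<partial>lborel))) \<le> (\<integral>\<^sup>+t. ennreal (norm (dquot (\<sigma> j) t * indicator {a..} t - \<kappa> t * indicator {a..} t)) \<partial>lborel)"
          by (simp only:) (rule integral_norm_bound_ennreal[OF iD])
        also have "\<dots> = (\<integral>\<^sup>+t. ennreal \<bar>dquot (\<sigma> j) t - \<kappa> t\<bar> * indicator {a..} t \<partial>lborel)"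
          by (intro nn_integral_cong) (auto simp: indicator_def)
        also have "\<dots> \<le> ennreal (1 / (cN * exp (N * a))) * (\<integral>\<^sup>+t. ennreal (cN * exp (N * t)) * ennreal \<bar>dquot (\<sigma> j) t - \<kappa> t\<bar> \<partial>lborel)"
          by (rule nn_integral_half_line_le) measurable
        finally have "enn2real (ennreal (norm (?I j - (\<integral>t. \<kappa> t * indicator {a..} t \<partial>lborel)))) \<le> ?B j"
          by (rule enn2real_mono[OF _ elim])
        then show ?case by simp
      qed
    qed
    then have 1: "?I \<longlonglongrightarrow> (\<integral>t. \<kappa> t * indicator {a..} t \<partial>lborel)" by (simp add: LIM_zero_iff)
    have 2: "?I \<longlonglongrightarrow> - V a"
    proof (rule LIMSEQ_I)
      fix e :: real assume e: "0 < e"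
      obtain d where d: "0 < d" "\<And>s. 0 < s \<Longrightarrow> s < d \<Longrightarrow> \<bar>(\<integral>t. V t * indicator {a..<a + s} t \<partial>lborel) / s - V a\<bar> \<le> e / 2"
        using average_V[OF a, of "e / 2"] e by auto
      have "\<forall>\<^sub>F j in sequentially. \<sigma> j < d" using order_tendstoD(2)[OF \<sigma>_lim d(1)] .
      then obtain j0 where j0: "\<And>j. j0 \<le> j \<Longrightarrow> \<sigma> j < d" unfolding eventually_sequentially by blast
      have "norm (?I j - - V a) < e" if "j0 \<le> j" for j
        using d(2)[OF \<sigma>_pos j0[OF that]] e unfolding dquot_half_line(2)[OF \<sigma>_pos] real_norm_def by linarith
      then show "\<exists>no. \<forall>j\<ge>no. norm (?I j - - V a) < e" by blast
    qed
    show ?thesis using LIMSEQ_unique[OF 1 2] by simp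
  qed
  have k0: "\<kappa> t = 0" if "ln R \<le> t" for t
  proof -
    have "dquot (\<sigma> j) t = 0" for j
      using that \<sigma>_pos[of j] by (simp add: dquot_def V_out)
    then show ?thesis by (simp add: \<kappa>_def limI)
  qed
  \<comment> \<open>|G| = |kappa| / r, hence |G|^p r^N = |kappa|^p r^(N-p) in the measure
    dt.\<close>
  have energy: "(\<integral>\<^sup>+t. ennreal (\<bar>\<kappa> t\<bar> powr p * exp ((N - p) * t)) \<partial>lborel) < \<infinity>"
  proof -
    have "(\<integral>\<^sup>+x. ennreal (norm (G x) powr p) \<partial>lborel) = (\<integral>\<^sup>+t. ennreal (cN * exp (N * t)) * ennreal ((\<bar>\<kappa> t\<bar> / exp t) powr p) \<partial>lborel)"
    proof (rule nn_integral_radial)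
      show "AE x in lborel. ennreal (norm (G x) powr p) = ennreal ((\<bar>\<kappa> (ln (norm x))\<bar> / exp (ln (norm x))) powr p)"
        using AEG AE_lborel_singleton[of 0]
      proof eventually_elim
        case (elim x)
        have "norm (G x) = \<bar>\<kappa> (ln (norm x))\<bar> / (norm x)\<^sup>2 * norm x"
          by (subst elim(1)) (simp add: abs_divide)
        then show ?case using elim(2) by (simp add: power2_eq_square)
      qed
    qed measurable
    also have "\<dots> = (\<integral>\<^sup>+t. ennreal cN * ennreal (\<bar>\<kappa> t\<bar> powr p * exp ((N - p) * t)) \<partial>lborel)"
    proof (rule nn_integral_cong)
      fix t
      have "cN * exp (N * t) * (\<bar>\<kappa> t\<bar> / exp t) powr p = cN * (\<bar>\<kappa> t\<bar> powr p * exp ((N - p) * t))"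
        by (simp add: powr_divide exp_powr_real left_diff_distrib exp_diff mult.commute[of t])
      then show "ennreal (cN * exp (N * t)) * ennreal ((\<bar>\<kappa> t\<bar> / exp t) powr p) = ennreal cN * ennreal (\<bar>\<kappa> t\<bar> powr p * exp ((N - p) * t))"
        using cN_pos by (simp flip: ennreal_mult)
    qed
    also have "\<dots> = ennreal cN * (\<integral>\<^sup>+t. ennreal (\<bar>\<kappa> t\<bar> powr p * exp ((N - p) * t)) \<partial>lborel)"
      by (rule nn_integral_cmult) measurable
    finally have "ennreal cN * (\<integral>\<^sup>+t. ennreal (\<bar>\<kappa> t\<bar> powr p * exp ((N - p) * t)) \<partial>lborel) < \<infinity>"
      using G_p by simp
    then show ?thesis using cN_pos by (auto simp: ennreal_mult_less_top)
  qed
  show ?thesis by (rule that[OF _ AEG ik Vk k0 energy]) measurable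
qed

end

section \<open>Smooth radial test functions\<close>

text \<open>The functions t^(-m) e^(-1/t), extended by 0, have derivatives that are linear
  combinations of members of the same family; m = 0 is the usual flat function.\<close>

definition exp_flat :: "nat \<Rightarrow> real \<Rightarrow> real" where
  "exp_flat m t = (if 0 < t then (1 / t) ^ m * exp (- (1 / t)) else 0)"

lemma exp_flat_tendsto_0: "((\<lambda>t. exp_flat m t) \<longlongrightarrow> 0) (at 0)"
proof -
  have "((\<lambda>x. x ^ m / exp x) \<longlongrightarrow> (0::real)) at_top" by (rule tendsto_power_div_exp_0)
  moreover have "filterlim (\<lambda>t::real. 1 / t) at_top (at_right 0)"
    by (simp add: filterlim_inverse_at_top_right flip: inverse_eq_divide)
  ultimately have "((\<lambda>t. (1 / t) ^ m / exp (1 / t)) \<longlongrightarrow> (0::real)) (at_right 0)"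
    by (rule filterlim_compose)
  moreover have "\<forall>\<^sub>F t in at_right 0. (1 / t) ^ m / exp (1 / t) = exp_flat m t"
    by (auto simp: eventually_at_right_field exp_flat_def exp_minus divide_inverse intro!: exI[of _ 1])
  ultimately have r: "((\<lambda>t. exp_flat m t) \<longlongrightarrow> 0) (at_right 0)" by (blast intro: Lim_transform_eventually)
  have "\<forall>\<^sub>F t in at_left 0. 0 = exp_flat m t"
    by (auto simp: eventually_at_left_field exp_flat_def intro!: exI[of _ "-1"])
  then have "((\<lambda>t. exp_flat m t) \<longlongrightarrow> 0) (at_left 0)" by (blast intro: Lim_transform_eventually)
  with r show ?thesis by (simp add: filterlim_split_at)
qed

lemma exp_flat_deriv:
  "(exp_flat m has_real_derivative exp_flat (m + 2) t - real m * exp_flat (m + 1) t) (at t)"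
proof (cases t "0::real" rule: linorder_cases)
  case less
  have "((\<lambda>_. 0) has_real_derivative exp_flat (m + 2) t - real m * exp_flat (m + 1) t) (at t)"
    using less by (simp add: exp_flat_def)
  then show ?thesis
    by (rule has_field_derivative_transform_within[where d="-t"]) (use less in \<open>auto simp: dist_real_def exp_flat_def\<close>)
next
  case equal
  have "((\<lambda>h. exp_flat (m + 1) h) \<longlongrightarrow> 0) (at 0)" by (rule exp_flat_tendsto_0)
  moreover have "exp_flat m h / h = exp_flat (m + 1) h" for h by (simp add: exp_flat_def)
  ultimately show ?thesis using equal by (simp add: DERIV_def exp_flat_def[of _ 0])
next
  case greater
  have p: "(1 / t) ^ m = (1 / t) ^ (m - 1) * (1 / t)" if "0 < m" using that by (cases m) auto
  have "((\<lambda>t. (1 / t) ^ m * exp (- (1 / t))) has_real_derivative exp_flat (m + 2) t - real m * exp_flat (m + 1) t) (at t)"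
    using greater
    by (auto intro!: derivative_eq_intros simp: exp_flat_def power2_eq_square)
       (cases m; simp add: field_simps power2_eq_square)
  then show ?thesis
    by (rule has_field_derivative_transform_within[where d="t"]) (use greater in \<open>auto simp: dist_real_def exp_flat_def\<close>)
qed

text \<open>A class closed under differentiation that contains the bumps, so that smoothness of
  every order needs only a first-derivative argument.\<close>

inductive smooth_fun :: "(real \<Rightarrow> real) \<Rightarrow> bool" where
  flat: "smooth_fun (\<lambda>t. exp_flat m (k * ((t - a) * (b - t))))"
| const: "smooth_fun (\<lambda>t. c)"
| ident: "smooth_fun (\<lambda>t. t)"
| add: "smooth_fun f \<Longrightarrow> smooth_fun g \<Longrightarrow> smooth_fun (\<lambda>t. f t + g t)"
| mult: "smooth_fun f \<Longrightarrow> smooth_fun g \<Longrightarrow> smooth_fun (\<lambda>t. f t * g t)"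

lemma smooth_fun_deriv:
  "smooth_fun f \<Longrightarrow> \<exists>f'. smooth_fun f' \<and> (\<forall>t. (f has_real_derivative f' t) (at t))"
proof (induction rule: smooth_fun.induct)
  case (flat m k a b)
  let ?s = "\<lambda>t. k * ((t - a) * (b - t))"
  have "((\<lambda>t. exp_flat m (?s t)) has_real_derivative
      (exp_flat (m + 2) (?s t) + (- real m) * exp_flat (m + 1) (?s t)) * (k * ((a + b) + (- 2) * t))) (at t)" for t
  proof -
    have "(?s has_real_derivative k * ((a + b) + (- 2) * t)) (at t)"
      by (auto intro!: derivative_eq_intros simp: algebra_simps)
    from DERIV_chain2[where f="exp_flat m" and g="?s", OF exp_flat_deriv this] show ?thesis by simp
  qed
  moreover have "smooth_fun (\<lambda>t. (exp_flat (m + 2) (?s t) + (- real m) * exp_flat (m + 1) (?s t)) * (k * ((a + b) + (- 2) * t)))"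
    by (intro smooth_fun.intros)
  ultimately show ?case by blast
next
  case (const c)
  have "smooth_fun (\<lambda>_. 0)" by (rule smooth_fun.const)
  then show ?case by (intro exI[of _ "\<lambda>_. 0"]) auto
next
  case ident
  have "smooth_fun (\<lambda>_. 1)" by (rule smooth_fun.const)
  then show ?case by (intro exI[of _ "\<lambda>_. 1"]) auto
next
  case (add f g)
  then obtain f' g' where "smooth_fun f'" "smooth_fun g'" "\<And>t. (f has_real_derivative f' t) (at t)" "\<And>t. (g has_real_derivative g' t) (at t)"
    by blast
  then show ?case
    by (intro exI[of _ "\<lambda>t. f' t + g' t"]) (auto intro: smooth_fun.add DERIV_add)
next
  case (mult f g)
  then obtain f' g' where fg: "smooth_fun f'" "smooth_fun g'" "\<And>t. (f has_real_derivative f' t) (at t)" "\<And>t. (g has_real_derivative g' t) (at t)"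
    by blast
  have "smooth_fun (\<lambda>t. f' t * g t + g' t * f t)" by (intro smooth_fun.add smooth_fun.mult fg mult)
  then show ?case
    by (intro exI[of _ "\<lambda>t. f' t * g t + g' t * f t"]) (auto intro: DERIV_mult fg)
qed

lemma smooth_fun_continuous: "smooth_fun f \<Longrightarrow> continuous_on S f"
  using smooth_fun_deriv DERIV_isCont by (metis continuous_at_imp_continuous_on)

text \<open>A class closed under partial derivatives. The rule \<open>radial\<close> asks only that
  the derivative of F be in \<open>smooth_fun\<close>, because F will be a primitive of bumps, for
  which no closed form is available.\<close>

inductive radial_smooth :: "('a::euclidean_space \<Rightarrow> real) \<Rightarrow> bool" where
  radial: "(\<And>t. (F has_real_derivative \<eta> t) (at t)) \<Longrightarrow> smooth_fun \<eta> \<Longrightarrow> radial_smooth (\<lambda>x. F (x \<bullet> x))"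
| inner: "radial_smooth (\<lambda>x. x \<bullet> b)"
| const: "radial_smooth (\<lambda>x. c)"
| add: "radial_smooth f \<Longrightarrow> radial_smooth g \<Longrightarrow> radial_smooth (\<lambda>x. f x + g x)"
| mult: "radial_smooth f \<Longrightarrow> radial_smooth g \<Longrightarrow> radial_smooth (\<lambda>x. f x * g x)"

lemma radial_smooth_deriv:
  "radial_smooth f \<Longrightarrow> \<exists>Df. (\<forall>x. (f has_derivative (\<lambda>h. Df x \<bullet> h)) (at x)) \<and> (\<forall>b. radial_smooth (\<lambda>x. Df x \<bullet> b))"
proof (induction rule: radial_smooth.induct)
  case (radial F \<eta>)
  obtain \<eta>' where \<eta>': "smooth_fun \<eta>'" "\<And>t. (\<eta> has_real_derivative \<eta>' t) (at t)"
    using smooth_fun_deriv[OF radial(2)] by blast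
  have "((\<lambda>x. F (x \<bullet> x)) has_derivative (\<lambda>h. ((2 * \<eta> (x \<bullet> x)) *\<^sub>R x) \<bullet> h)) (at x)" for x :: 'a
  proof -
    have "((\<lambda>x::'a. x \<bullet> x) has_derivative (\<lambda>h. 2 * (x \<bullet> h))) (at x)"
      by (auto intro!: derivative_eq_intros simp: inner_commute)
    from has_derivative_compose[OF this radial(1)[of "x \<bullet> x", unfolded has_field_derivative_def]]
    show ?thesis by (simp add: mult_ac)
  qed
  moreover have "radial_smooth (\<lambda>x::'a. ((2 * \<eta> (x \<bullet> x)) *\<^sub>R x) \<bullet> b)" for b
  proof -
    have "radial_smooth (\<lambda>x::'a. 2 * \<eta> (x \<bullet> x) * (x \<bullet> b))"
      by (intro radial_smooth.mult radial_smooth.const radial_smooth.inner radial_smooth.radial[OF \<eta>'(2,1)])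
    then show ?thesis by simp
  qed
  ultimately show ?case by (intro exI[of _ "\<lambda>x::'a. (2 * \<eta> (x \<bullet> x)) *\<^sub>R x"]) blast
next
  case (inner b)
  then show ?case
    by (intro exI[of _ "\<lambda>_. b"]) (auto intro!: derivative_eq_intros radial_smooth.const simp: inner_commute)
next
  case (const c)
  then show ?case
    by (intro exI[of _ "\<lambda>_. 0"]) (auto intro!: derivative_eq_intros radial_smooth.const)
next
  case (add f g)
  then obtain Df Dg where *: "\<And>x. (f has_derivative (\<lambda>h. Df x \<bullet> h)) (at x)" "\<And>b. radial_smooth (\<lambda>x. Df x \<bullet> b)"
    "\<And>x. (g has_derivative (\<lambda>h. Dg x \<bullet> h)) (at x)" "\<And>b. radial_smooth (\<lambda>x. Dg x \<bullet> b)"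
    by metis
  then show ?case
    by (intro exI[of _ "\<lambda>x. Df x + Dg x"]) (auto simp: inner_add_left intro: radial_smooth.add has_derivative_add)
next
  case (mult f g)
  then obtain Df Dg where *: "\<And>x. (f has_derivative (\<lambda>h. Df x \<bullet> h)) (at x)" "\<And>b. radial_smooth (\<lambda>x. Df x \<bullet> b)"
    "\<And>x. (g has_derivative (\<lambda>h. Dg x \<bullet> h)) (at x)" "\<And>b. radial_smooth (\<lambda>x. Dg x \<bullet> b)"
    by metis
  have "((\<lambda>x. f x * g x) has_derivative (\<lambda>h. (f x *\<^sub>R Dg x + g x *\<^sub>R Df x) \<bullet> h)) (at x)" for x
    using has_derivative_mult[OF *(1,3), of x] by (simp add: inner_add_left mult.commute)
  moreover have "radial_smooth (\<lambda>x. (f x *\<^sub>R Dg x + g x *\<^sub>R Df x) \<bullet> b)" for b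
  proof -
    have "radial_smooth (\<lambda>x. f x * (Dg x \<bullet> b) + g x * (Df x \<bullet> b))"
      by (intro radial_smooth.add radial_smooth.mult * mult)
    then show ?thesis by (simp add: inner_add_left)
  qed
  ultimately show ?case by (intro exI[of _ "\<lambda>x. f x *\<^sub>R Dg x + g x *\<^sub>R Df x"]) blast
qed

lemma radial_smooth_Ck: "radial_smooth f \<Longrightarrow> Ck k f"
proof (induction k arbitrary: f)
  case 0
  obtain Df where "\<And>x. (f has_derivative (\<lambda>h. Df x \<bullet> h)) (at x)"
    using radial_smooth_deriv[OF 0] by blast
  then show ?case by (auto intro!: continuous_at_imp_continuous_on has_derivative_continuous)
next
  case (Suc k)
  obtain Df where Df: "\<And>x. (f has_derivative (\<lambda>h. Df x \<bullet> h)) (at x)" "\<And>b. radial_smooth (\<lambda>x. Df x \<bullet> b)"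
    using radial_smooth_deriv[OF Suc.prems] by blast
  have "partial_deriv b f = (\<lambda>x. Df x \<bullet> b)" for b
    unfolding partial_deriv_def fun_eq_iff using frechet_derivative_at[OF Df(1)] by metis
  then have "\<forall>b\<in>Basis. Ck k (partial_deriv b f)" using Suc.IH[OF Df(2)] by simp
  moreover have "f differentiable_on UNIV"
    using Df(1) by (auto simp: differentiable_on_def differentiable_def intro: has_derivative_at_withinI)
  ultimately show ?case by simp
qed

lemma radial_test_function:
  fixes F \<eta> :: "real \<Rightarrow> real"
  assumes F: "\<And>t. (F has_real_derivative \<eta> t) (at t)" and \<eta>: "smooth_fun \<eta>"
    and ab: "0 < a" "b < R\<^sup>2" "0 < R" and out: "\<And>t. t \<le> a \<Longrightarrow> F t = 0" "\<And>t. b \<le> t \<Longrightarrow> F t = 0"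
  shows "(\<lambda>x::'a::euclidean_space. F (x \<bullet> x)) \<in> test_functions (ball 0 R)"
    and "grad (\<lambda>x::'a. F (x \<bullet> x)) x = (2 * \<eta> (x \<bullet> x)) *\<^sub>R x"
    and "C1 (\<lambda>x::'a. F (x \<bullet> x)) (\<lambda>x. (2 * \<eta> (x \<bullet> x)) *\<^sub>R x)"
proof -
  let ?f = "\<lambda>x::'a. F (x \<bullet> x)"
  have C1f: "C1 ?f (\<lambda>x. \<eta> (x \<bullet> x) *\<^sub>R (2 *\<^sub>R x))"
    by (rule C1_chain[OF C1_norm_sq F smooth_fun_continuous[OF \<eta>]])
  then show C: "C1 ?f (\<lambda>x. (2 * \<eta> (x \<bullet> x)) *\<^sub>R x)" by (simp add: mult.commute)
  show "grad ?f x = (2 * \<eta> (x \<bullet> x)) *\<^sub>R x" using C1_grad[OF C] by simp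
  have Ck: "Ck k ?f" for k by (intro radial_smooth_Ck radial_smooth.radial[OF F \<eta>])
  define S where "S = {x::'a. x \<bullet> x \<le> b}"
  have "{x. ?f x \<noteq> 0} \<subseteq> S" using out(2) by (auto simp: S_def) (meson linorder_linear)
  moreover have "closed S" unfolding S_def by (intro closed_Collect_le continuous_intros)
  ultimately have cl: "closure {x. ?f x \<noteq> 0} \<subseteq> S" by (rule closure_minimal)
  have SB: "S \<subseteq> ball 0 R"
  proof
    fix x :: 'a assume "x \<in> S"
    then have "(norm x)\<^sup>2 < R\<^sup>2" using ab by (simp add: S_def power2_norm_eq_inner)
    then show "x \<in> ball 0 R" using ab(3) by (simp add: power2_less_imp_less)
  qed
  have "bounded S" using bounded_subset[OF bounded_ball SB] .
  then have "compact (closure {x. ?f x \<noteq> 0})" using cl bounded_subset by (auto simp: compact_eq_bounded_closed)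
  then show "?f \<in> test_functions (ball 0 R)"
    using Ck cl SB by (auto simp: test_functions_def)
qed

section \<open>Bumps, primitives and localisation of integrals\<close>

text \<open>The growing factor makes the bumps increase to the indicator of the open
  interval.\<close>

definition bump :: "real \<Rightarrow> real \<Rightarrow> nat \<Rightarrow> real \<Rightarrow> real" where
  "bump a b k t = exp_flat 0 (real (Suc k) * ((t - a) * (b - t)))"

lemma smooth_bump: "smooth_fun (bump a b k)"
  unfolding bump_def[abs_def] by (rule smooth_fun.flat)

lemma bump_nonneg: "0 \<le> bump a b k t" and bump_le_1: "bump a b k t \<le> 1"
  by (auto simp: bump_def exp_flat_def)

lemma bump_out: "a < b \<Longrightarrow> t \<le> a \<or> b \<le> t \<Longrightarrow> bump a b k t = 0"
proof -
  assume "a < b" "t \<le> a \<or> b \<le> t"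
  then have "(t - a) * (b - t) \<le> 0" by (auto simp: mult_le_0_iff)
  then have "real (Suc k) * ((t - a) * (b - t)) \<le> 0" by (simp add: mult_nonneg_nonpos)
  then show ?thesis by (simp add: bump_def exp_flat_def)
qed

lemma bump_pos: "a < t \<Longrightarrow> t < b \<Longrightarrow> 0 < bump a b k t"
  by (simp add: bump_def exp_flat_def)

lemma bump_tendsto: "a < t \<Longrightarrow> t < b \<Longrightarrow> (\<lambda>k. bump a b k t) \<longlonglongrightarrow> 1"
proof -
  assume t: "a < t" "t < b"
  define c where "c = (t - a) * (b - t)"
  have c: "0 < c" using t by (simp add: c_def)
  have "(\<lambda>k. exp (- (inverse (real (Suc k)) * (1 / c)))) \<longlonglongrightarrow> exp (- (0 * (1 / c)))"
    by (intro tendsto_intros LIMSEQ_inverse_real_of_nat)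
  moreover have "bump a b k t = exp (- (inverse (real (Suc k)) * (1 / c)))" for k
    unfolding bump_def c_def[symmetric] using c by (simp add: exp_flat_def divide_inverse mult.commute)
  ultimately show ?thesis by simp
qed

text \<open>Normalising the primitive at \<open>a\<close> leaves the total integral of \<eta> as
  \<open>F b\<close>; the primitive has compact support when this number is 0.\<close>

lemma antiderivative_vanishing_outside:
  fixes \<eta> :: "real \<Rightarrow> real"
  assumes "continuous_on UNIV \<eta>" and ab: "a < b" and out: "\<And>t. t \<le> a \<or> b \<le> t \<Longrightarrow> \<eta> t = 0"
  obtains F where "\<And>t. (F has_real_derivative \<eta> t) (at t)" "\<And>t. t \<le> a \<Longrightarrow> F t = 0" "\<And>t. b \<le> t \<Longrightarrow> F t = F b"
proof -
  have "\<exists>F. \<forall>x. - \<infinity> < ereal x \<longrightarrow> ereal x < \<infinity> \<longrightarrow> (F has_vector_derivative \<eta> x) (at x)"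
    by (rule einterval_antiderivative) (use assms(1) in \<open>auto simp: continuous_on_eq_continuous_at\<close>)
  then obtain F0 where F0: "\<And>x. (F0 has_real_derivative \<eta> x) (at x)"
    by (auto simp: has_real_derivative_iff_has_vector_derivative)
  have const: "F0 s = F0 t" if "s \<le> t" "t \<le> a \<or> b \<le> s" for s t
  proof (cases "s = t")
    case False
    then have "s < t" using that by simp
    then obtain z where "s < z" "z < t" "F0 t - F0 s = (t - s) * \<eta> z" using MVT2[OF _ F0] by blast
    then show ?thesis using out[of z] that by auto
  qed simp
  show ?thesis
  proof (rule that[of "\<lambda>t. F0 t - F0 a"])
    show "((\<lambda>t. F0 t - F0 a) has_real_derivative \<eta> t) (at t)" for t
      by (auto intro!: derivative_eq_intros F0)
  qed (use const in auto)
qed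

text \<open>\<open>ennreal\<close> truncates at 0, so the densities used are the positive and the
  negative part of \<open>f\<close> on the interval. The two finite measures agree on half-lines,
  hence everywhere, and equal parts that are never both positive must vanish.\<close>

lemma AE_zero_of_interval_integrals:
  fixes f :: "real \<Rightarrow> real"
  assumes f: "integrable lborel (\<lambda>t. f t * indicator {c..d} t)" and [measurable]: "f \<in> borel_measurable borel"
    and zero: "\<And>a b. c \<le> a \<Longrightarrow> a < b \<Longrightarrow> b \<le> d \<Longrightarrow> (\<integral>t. f t * indicator {a<..<b} t \<partial>lborel) = 0"
  shows "AE t in lborel. t \<in> {c..d} \<longrightarrow> f t = 0"
proof -
  let ?f = "\<lambda>t. f t * indicator {c..d} t"
  have [measurable]: "?f \<in> borel_measurable borel" by measurable
  let ?P = "density lborel (\<lambda>t. ennreal (?f t))" and ?Q = "density lborel (\<lambda>t. ennreal (- ?f t))"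
  have iA: "integrable lborel (\<lambda>t. ?f t * indicator A t)" if [measurable]: "A \<in> sets borel" for A
    by (rule Bochner_Integration.integrable_bound[OF f]) (auto simp: indicator_def)
  have fin: "(\<integral>\<^sup>+t. ennreal (norm (?f t * indicator A t)) \<partial>lborel) < \<infinity>" if "A \<in> sets borel" for A
    using iA[OF that] by (simp add: integrable_iff_bounded)
  have PA: "emeasure ?P A = (\<integral>\<^sup>+t. ennreal (?f t * indicator A t) \<partial>lborel)"
    and QA: "emeasure ?Q A = (\<integral>\<^sup>+t. ennreal (- (?f t * indicator A t)) \<partial>lborel)" if A: "A \<in> sets borel" for A
    using A by (auto simp: emeasure_density intro!: nn_integral_cong simp: indicator_def)
  have Pfin: "emeasure ?P A < \<infinity>" and Qfin: "emeasure ?Q A < \<infinity>" if A: "A \<in> sets borel" for A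
  proof -
    have "ennreal (?f t * indicator A t) \<le> ennreal (norm (?f t * indicator A t))"
      "ennreal (- (?f t * indicator A t)) \<le> ennreal (norm (?f t * indicator A t))" for t
      by (auto intro!: ennreal_leI simp only: real_norm_def)
    then have "(\<integral>\<^sup>+t. ennreal (?f t * indicator A t) \<partial>lborel) \<le> (\<integral>\<^sup>+t. ennreal (norm (?f t * indicator A t)) \<partial>lborel)"
      "(\<integral>\<^sup>+t. ennreal (- (?f t * indicator A t)) \<partial>lborel) \<le> (\<integral>\<^sup>+t. ennreal (norm (?f t * indicator A t)) \<partial>lborel)"
      by (auto intro!: nn_integral_mono simp only:)
    then show "emeasure ?P A < \<infinity>" "emeasure ?Q A < \<infinity>"
      unfolding PA[OF A] QA[OF A] using fin[OF A] by (auto intro: order_le_less_trans simp only:)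
  qed
  have "?P = ?Q"
  proof (rule measure_eqI_lessThan)
    show "emeasure ?P {x<..} < \<infinity>" for x by (rule Pfin) simp
    fix x :: real
    have i: "integrable lborel (\<lambda>t. ?f t * indicator {x<..} t)" by (rule iA) simp
    have "(\<integral>t. ?f t * indicator {x<..} t \<partial>lborel) = 0"
    proof (cases "max c x < d")
      case True
      have "(\<integral>t. ?f t * indicator {x<..} t \<partial>lborel) = (\<integral>t. f t * indicator {max c x<..<d} t \<partial>lborel)"
      proof (rule integral_cong_AE)
        show "AE t in lborel. ?f t * indicator {x<..} t = f t * indicator {max c x<..<d} t"
          using AE_lborel_singleton[of c] AE_lborel_singleton[of d]
          by eventually_elim (auto simp: indicator_def)
      qed measurable
      then show ?thesis using zero[of "max c x" d] True by simp
    next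
      case False
      have "(\<integral>t. ?f t * indicator {x<..} t \<partial>lborel) = integral\<^sup>L lborel (\<lambda>t::real. 0::real)"
      proof (rule integral_cong_AE)
        show "AE t in lborel. ?f t * indicator {x<..} t = 0"
          using AE_lborel_singleton[of c] AE_lborel_singleton[of d]
          by eventually_elim (use False in \<open>auto simp: indicator_def\<close>)
      qed measurable
      then show ?thesis by simp
    qed
    then have "enn2real (emeasure ?P {x<..}) = enn2real (emeasure ?Q {x<..})"
      using real_lebesgue_integral_def[OF i] by (simp add: PA QA)
    then show "emeasure ?P {x<..} = emeasure ?Q {x<..}"
      using Pfin[of "{x<..}"] Qfin[of "{x<..}"]
      by (metis borel_open ennreal_enn2real infinity_ennreal_def open_greaterThan)
  qed simp_all
  then have "AE t in lborel. ennreal (?f t) = ennreal (- ?f t)"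
    by (subst (asm) sigma_finite_measure.density_unique_iff[OF sigma_finite_lborel]) auto
  then show ?thesis
  proof eventually_elim
    case (elim t)
    show ?case
    proof
      assume t: "t \<in> {c..d}"
      then have "ennreal (f t) = ennreal (- f t)" using elim by simp
      then show "f t = 0" by (cases "0 \<le> f t") (auto simp: ennreal_neg ennreal_eq_0_iff)
    qed
  qed
qed

section \<open>From weak solutions to the ordinary differential equation\<close>

text \<open>If x exceeds h, then h^(1-p) x^(p-1) >= 1, and the second term alone suffices.\<close>

lemma le_add_powr:
  fixes x :: real
  assumes "0 \<le> x" "0 < h" "1 < p"
  shows "x \<le> h + h powr (1 - p) * x powr p"
proof (cases "x \<le> h")
  case True
  have "0 \<le> h powr (1 - p) * x powr p" by simp
  then show ?thesis using True by linarith
next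
  case False
  have "x = h powr (1 - p) * (x * h powr (p - 1))" using assms by (simp add: powr_add[symmetric] mult.left_commute)
  also have "\<dots> \<le> h powr (1 - p) * (x * x powr (p - 1))"
    using False assms by (intro mult_left_mono powr_mono2) auto
  also have "x * x powr (p - 1) = x powr p" using False assms by (simp add: powr_mult_base)
  finally show ?thesis using assms by linarith
qed

lemma powr_add_le:
  fixes x y :: real
  assumes "0 \<le> x" "0 \<le> y" "0 \<le> p"
  shows "(x + y) powr p \<le> 2 powr p * (x powr p + y powr p)"
proof -
  have "(x + y) powr p \<le> (2 * max x y) powr p" using assms by (intro powr_mono2) auto
  also have "\<dots> = 2 powr p * max x y powr p" using assms by (simp add: powr_mult)
  also have "max x y powr p \<le> x powr p + y powr p" by (simp add: max_def)
  finally show ?thesis by simp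
qed

text \<open>Pointwise h <= k + k^(1-p) h^p. On a set of finite measure, choosing \<open>k\<close>
  small first and then \<open>n\<close> large takes the place of Hoelder's inequality.\<close>

lemma L1_tendsto_of_Lp:
  fixes h :: "nat \<Rightarrow> 'a \<Rightarrow> real"
  assumes [measurable]: "\<And>n. h n \<in> borel_measurable M" "B \<in> sets M"
    and h: "\<And>n x. 0 \<le> h n x" and p: "1 < p" and fin: "emeasure M B < \<infinity>"
    and lim: "(\<lambda>n. \<integral>\<^sup>+x. ennreal (h n x powr p) * indicator B x \<partial>M) \<longlonglongrightarrow> 0"
  shows "(\<lambda>n. \<integral>\<^sup>+x. ennreal (h n x) * indicator B x \<partial>M) \<longlonglongrightarrow> 0"
proof (rule order_tendstoI)
  fix e :: ennreal assume e: "0 < e"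
  obtain e' where e': "0 < e'" "ennreal e' < e"
  proof -
    obtain m where m: "0 < m" "m < e" using dense[OF e] by blast
    then obtain x where "m = ennreal x" "0 \<le> x" by (cases m) auto
    then show ?thesis using m that[of x] by (auto simp: ennreal_less_zero_iff)
  qed
  define b where "b = measure M B"
  have b: "emeasure M B = ennreal b" "0 \<le> b" using fin by (auto simp: b_def emeasure_eq_ennreal_measure)
  define k where "k = e' / 2 / (b + 1)"
  have k: "0 < k" "k * b \<le> e' / 2" using e' b(2) by (auto simp: k_def field_simps)
  define c where "c = k powr (1 - p)"
  have c: "0 < c" using k by (simp add: c_def)
  have "\<forall>\<^sub>F n in sequentially. (\<integral>\<^sup>+x. ennreal (h n x powr p) * indicator B x \<partial>M) < ennreal (e' / 2 / c)"
    by (rule order_tendstoD(2)[OF lim]) (use e' c in auto)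
  then show "\<forall>\<^sub>F n in sequentially. (\<integral>\<^sup>+x. ennreal (h n x) * indicator B x \<partial>M) < e"
  proof eventually_elim
    case (elim n)
    have "(\<integral>\<^sup>+x. ennreal (h n x) * indicator B x \<partial>M) \<le> (\<integral>\<^sup>+x. ennreal k * indicator B x + ennreal c * (ennreal (h n x powr p) * indicator B x) \<partial>M)"
    proof (rule nn_integral_mono)
      fix x
      have "h n x \<le> k + c * h n x powr p" unfolding c_def by (rule le_add_powr[OF h k(1) p])
      then show "ennreal (h n x) * indicator B x \<le> ennreal k * indicator B x + ennreal c * (ennreal (h n x powr p) * indicator B x)"
        using k c by (auto simp: indicator_def simp flip: ennreal_mult ennreal_plus intro: ennreal_leI)
    qed
    also have "\<dots> = ennreal k * ennreal b + ennreal c * (\<integral>\<^sup>+x. ennreal (h n x powr p) * indicator B x \<partial>M)"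
      by (subst nn_integral_add) (auto simp: nn_integral_cmult nn_integral_cmult_indicator b)
    also have "\<dots> \<le> ennreal (e' / 2) + ennreal c * ennreal (e' / 2 / c)"
      using k b c e' by (intro add_mono mult_left_mono less_imp_le[OF elim]) (auto simp flip: ennreal_mult intro: ennreal_leI)
    also have "\<dots> = ennreal e'" using c e' by (simp flip: ennreal_mult ennreal_plus)
    finally show ?case using e'(2) by (rule order_le_less_trans)
  qed
qed simp

section \<open>Borel versions on the whole space\<close>

text \<open>The test functions vanish near and outside the boundary, so everything extends by 0, and
  on the ball of finite volume L^p convergence gives L^1 convergence. The function is Borel by
  continuity off the origin; the gradient is only Lebesgue measurable and is replaced by a Borel
  version, component by component.\<close>

lemma radial_W0_of_W0_with_grad:
  fixes u :: "'a::euclidean_space \<Rightarrow> real"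
  assumes W: "W0_with_grad p (ball 0 R) u g" and p: "1 < p" and R: "0 < R"
    and cont: "continuous_on (ball 0 R - {0}) u"
    and rad: "\<And>x y. x \<in> ball 0 R \<Longrightarrow> y \<in> ball 0 R \<Longrightarrow> norm x = norm y \<Longrightarrow> u x = u y"
  obtains G f where "radial_W0 p R (\<lambda>x. if x \<in> ball 0 R - {0} then u x else 0) G f"
    "AE x in lebesgue. x \<in> ball 0 R \<longrightarrow> G x = g x"
proof -
  let ?B = "ball (0::'a) R"
  let ?U = "\<lambda>x. if x \<in> ?B - {0} then u x else 0"
  have Bl [measurable]: "?B \<in> sets lebesgue" by simp
  obtain f where f: "\<And>n. f n \<in> test_functions ?B"
    and c1: "(\<lambda>n. \<integral>\<^sup>+x. ennreal (norm (grad (f n) x - g x) powr p) \<partial>lebesgue_on ?B) \<longlonglongrightarrow> 0"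
    and c2: "(\<lambda>n. \<integral>\<^sup>+x. ennreal (\<bar>f n x - u x\<bar> powr p) \<partial>lebesgue_on ?B) \<longlonglongrightarrow> 0"
    and gm: "g \<in> borel_measurable (lebesgue_on ?B)"
    using W unfolding W0_with_grad_def by blast
  have um: "?U \<in> borel_measurable borel"
  proof -
    have "(\<lambda>x. indicator (?B - {0}) x *\<^sub>R u x) \<in> borel_measurable borel"
      by (rule borel_measurable_continuous_on_indicator) (use cont in auto)
    moreover have "(\<lambda>x. indicator (?B - {0}) x *\<^sub>R u x) = ?U" by (auto simp: fun_eq_iff)
    ultimately show ?thesis by simp
  qed
  define g0 where "g0 x = (if x \<in> ?B then g x else 0)" for x
  have g0m: "g0 \<in> borel_measurable lebesgue"
    unfolding g0_def[abs_def] using gm by (subst borel_measurable_if) auto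
  have "\<exists>h. h \<in> borel_measurable lborel \<and> (AE x in lborel. g0 x \<bullet> b = h x)" for b
  proof -
    have "(\<lambda>x. g0 x \<bullet> b) \<in> borel_measurable lebesgue" using g0m by measurable
    from completion_ex_borel_measurable_real[OF this] show ?thesis by blast
  qed
  then obtain h where h: "\<And>b. h b \<in> borel_measurable lborel" "\<And>b. AE x in lborel. g0 x \<bullet> b = h b x"
    by metis
  note [measurable] = h(1)
  define G where "G x = (if x \<in> ?B then \<Sum>b\<in>Basis. h b x *\<^sub>R b else 0)" for x
  have [measurable]: "?B \<in> sets borel" by simp
  have Gm [measurable]: "G \<in> borel_measurable borel"
    unfolding G_def[abs_def] by measurable
  have Gg0: "AE x in lborel. G x = g0 x"
  proof -
    have "AE x in lborel. \<forall>b\<in>Basis. g0 x \<bullet> b = h b x" by (intro AE_finite_allI finite_Basis h)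
    then show ?thesis
    proof eventually_elim
      case (elim x)
      then have "g0 x = (\<Sum>b\<in>Basis. h b x *\<^sub>R b)" by (subst euclidean_representation[of "g0 x", symmetric]) simp
      then show ?case by (auto simp: G_def g0_def)
    qed
  qed
  have C: "C1 (f n) (grad (f n))" for n
    using f[of n] by (intro test_function_C1[of 0]) (simp only: test_functions_def mem_Collect_eq)
  have C2: "C1 (\<lambda>x. grad (f n) x \<bullet> b) (grad (\<lambda>x. grad (f n) x \<bullet> b))" if b: "b \<in> Basis" for n b
  proof -
    have "Ck (Suc (Suc (Suc 0))) (f n)" using f[of n] unfolding test_functions_def by blast
    then have "Ck (Suc (Suc 0)) (partial_deriv b (f n))" using b unfolding Ck.simps(2)[of "Suc (Suc 0)"] by blast
    from test_function_C1[OF this] have "C1 (partial_deriv b (f n)) (grad (partial_deriv b (f n)))" .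
    moreover have "(\<lambda>x. grad (f n) x \<bullet> b) = partial_deriv b (f n)" using grad_inner_Basis[OF b] by auto
    ultimately show ?thesis by simp
  qed
  have supp: "closure {x. f n x \<noteq> 0} \<subseteq> ?B" for n
    using f[of n] by (simp only: test_functions_def mem_Collect_eq)
  have f_zero: "f n x = 0" if "x \<notin> closure {x. f n x \<noteq> 0}" for n x
    using subsetD[OF closure_subset, of x "{x. f n x \<noteq> 0}"] that by auto
  have not_supp: "x \<notin> closure {x. f n x \<noteq> 0}" if "R \<le> norm x" for n x
    using subsetD[OF supp, of x n] that by auto
  have f_out: "f n x = 0" if "R \<le> norm x" for n x
    by (rule f_zero[OF not_supp[OF that]])
  have grad_out: "grad (f n) x = 0" if "R \<le> norm x" for n x
    by (rule C1_deriv_eq_0[OF C open_Compl[OF closed_closure] not_supp[OF that, folded Compl_iff] f_zero[OF ComplD]])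
  have fm [measurable]: "f n \<in> borel_measurable borel" "grad (f n) \<in> borel_measurable borel" for n
    using C1_continuous[OF C] C1_continuous_D[OF C] by (auto intro: borel_measurable_continuous_onI)
  have Bfin: "emeasure lborel ?B < \<infinity>" 
    using emeasure_ball[of R "0::'a"] R by simp
  have lim1: "(\<lambda>n. \<integral>\<^sup>+x. ennreal (norm (grad (f n) x - G x) powr p) * indicator ?B x \<partial>lborel) \<longlonglongrightarrow> 0"
  proof -
    have "(\<integral>\<^sup>+x. ennreal (norm (grad (f n) x - g x) powr p) \<partial>lebesgue_on ?B) = (\<integral>\<^sup>+x. ennreal (norm (grad (f n) x - G x) powr p) * indicator ?B x \<partial>lborel)" for n
    proof -
      have "(\<integral>\<^sup>+x. ennreal (norm (grad (f n) x - g x) powr p) \<partial>lebesgue_on ?B) = (\<integral>\<^sup>+x. ennreal (norm (grad (f n) x - g x) powr p) * indicator ?B x \<partial>lborel)"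
        by (subst nn_integral_restrict_space) (auto simp: nn_integral_completion)
      also have "\<dots> = (\<integral>\<^sup>+x. ennreal (norm (grad (f n) x - G x) powr p) * indicator ?B x \<partial>lborel)"
        by (rule nn_integral_cong_AE, use Gg0 in eventually_elim) (auto simp: g0_def indicator_def)
      finally show ?thesis .
    qed
    then show ?thesis using c1 by simp
  qed
  have lim2: "(\<lambda>n. \<integral>\<^sup>+x. ennreal (\<bar>f n x - ?U x\<bar> powr p) * indicator ?B x \<partial>lborel) \<longlonglongrightarrow> 0"
  proof -
    have "(\<integral>\<^sup>+x. ennreal (\<bar>f n x - u x\<bar> powr p) \<partial>lebesgue_on ?B) = (\<integral>\<^sup>+x. ennreal (\<bar>f n x - ?U x\<bar> powr p) * indicator ?B x \<partial>lborel)" for n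
    proof -
      have "(\<integral>\<^sup>+x. ennreal (\<bar>f n x - u x\<bar> powr p) \<partial>lebesgue_on ?B) = (\<integral>\<^sup>+x. ennreal (\<bar>f n x - u x\<bar> powr p) * indicator ?B x \<partial>lborel)"
        by (subst nn_integral_restrict_space) (auto simp: nn_integral_completion)
      also have "\<dots> = (\<integral>\<^sup>+x. ennreal (\<bar>f n x - ?U x\<bar> powr p) * indicator ?B x \<partial>lborel)"
        by (rule nn_integral_cong_AE, use AE_lborel_singleton[of "0::'a"] in eventually_elim) (auto simp: indicator_def)
      finally show ?thesis .
    qed
    then show ?thesis using c2 by simp
  qed
  have Gout: "G x = 0" if "R \<le> norm x" for x using that by (simp add: G_def)
  have "radial_W0 p R ?U G f"
  proof
    show "continuous_on (?B - {0}) ?U" by (rule continuous_on_eq[OF cont]) auto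
    show "?U x = ?U y" if "norm x = norm y" for x y
      using rad[of x y] that by auto
    have "(\<lambda>n. \<integral>\<^sup>+x. ennreal (norm (grad (f n) x - G x)) * indicator ?B x \<partial>lborel) \<longlonglongrightarrow> 0"
      by (rule L1_tendsto_of_Lp[OF _ _ _ p Bfin lim1]) (auto simp del: mem_ball)
    moreover have "(\<integral>\<^sup>+x. ennreal (norm (grad (f n) x - G x)) * indicator ?B x \<partial>lborel) = (\<integral>\<^sup>+x. ennreal (norm (grad (f n) x - G x)) \<partial>lborel)" for n
      by (intro nn_integral_cong) (auto simp: indicator_def grad_out Gout)
    ultimately show "(\<lambda>n. \<integral>\<^sup>+x. ennreal (norm (grad (f n) x - G x)) \<partial>lborel) \<longlonglongrightarrow> 0" by simp
    have "(\<lambda>n. \<integral>\<^sup>+x. ennreal \<bar>f n x - ?U x\<bar> * indicator ?B x \<partial>lborel) \<longlonglongrightarrow> 0"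
    proof (rule L1_tendsto_of_Lp[OF _ _ _ p Bfin lim2])
      show "(\<lambda>x. \<bar>f n x - ?U x\<bar>) \<in> borel_measurable lborel" for n
        by (intro borel_measurable_abs borel_measurable_diff) (use fm um in auto)
    qed auto
    moreover have "(\<integral>\<^sup>+x. ennreal \<bar>f n x - ?U x\<bar> * indicator ?B x \<partial>lborel) = (\<integral>\<^sup>+x. ennreal \<bar>f n x - ?U x\<bar> \<partial>lborel)" for n
      by (intro nn_integral_cong) (auto simp: indicator_def f_out)
    ultimately show "(\<lambda>n. \<integral>\<^sup>+x. ennreal \<bar>f n x - ?U x\<bar> \<partial>lborel) \<longlonglongrightarrow> 0" by simp
    show "(\<integral>\<^sup>+x. ennreal (norm (G x) powr p) \<partial>lborel) < \<infinity>"
    proof -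
      have "\<forall>\<^sub>F n in sequentially. (\<integral>\<^sup>+x. ennreal (norm (grad (f n) x - G x) powr p) * indicator ?B x \<partial>lborel) < 1"
        by (rule order_tendstoD(2)[OF lim1]) simp
      \<comment> \<open>One approximant at finite L^p distance suffices, since its gradient is
        bounded on a ball of finite volume.\<close>
      then obtain n where n: "(\<integral>\<^sup>+x. ennreal (norm (grad (f n) x - G x) powr p) * indicator ?B x \<partial>lborel) < 1"
        unfolding eventually_sequentially by blast
      have "\<exists>K>0. \<forall>x. norm (grad (f n) x) \<le> K"
        by (rule continuous_bounded_support_bounded[OF C1_continuous_D[OF C], of R]) (simp add: grad_out)
      then obtain K where K: "0 < K" "\<And>x. norm (grad (f n) x) \<le> K" by blast
      have pw: "norm (G x) powr p \<le> 2 powr p * (K powr p + norm (grad (f n) x - G x) powr p)" for x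
      proof -
        have "norm (G x) \<le> norm (grad (f n) x) + norm (grad (f n) x - G x)"
          by (metis norm_minus_commute norm_triangle_sub)
        then have "norm (G x) powr p \<le> (norm (grad (f n) x) + norm (grad (f n) x - G x)) powr p"
          using p by (intro powr_mono2) auto
        also have "\<dots> \<le> 2 powr p * (norm (grad (f n) x) powr p + norm (grad (f n) x - G x) powr p)"
          using p by (intro powr_add_le) auto
        also have "\<dots> \<le> 2 powr p * (K powr p + norm (grad (f n) x - G x) powr p)"
          using p K by (intro mult_left_mono add_mono powr_mono2) auto
        finally show ?thesis .
      qed
      have "(\<integral>\<^sup>+x. ennreal (norm (G x) powr p) \<partial>lborel) \<le> (\<integral>\<^sup>+x. ennreal (2 powr p) * (ennreal (K powr p) * indicator ?B x + ennreal (norm (grad (f n) x - G x) powr p) * indicator ?B x) \<partial>lborel)"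
      proof (rule nn_integral_mono)
        fix x
        show "ennreal (norm (G x) powr p) \<le> ennreal (2 powr p) * (ennreal (K powr p) * indicator ?B x + ennreal (norm (grad (f n) x - G x) powr p) * indicator ?B x)"
          using ennreal_leI[OF pw[of x]] Gout[of x] p
          by (cases "x \<in> ?B") (auto simp: ennreal_mult ennreal_plus)
      qed
      also have "\<dots> = ennreal (2 powr p) * (ennreal (K powr p) * emeasure lborel ?B + (\<integral>\<^sup>+x. ennreal (norm (grad (f n) x - G x) powr p) * indicator ?B x \<partial>lborel))"
        by (subst nn_integral_cmult, measurable, subst nn_integral_add, measurable) (simp add: nn_integral_cmult_indicator)
      also have "\<dots> < \<infinity>"
        using Bfin order_less_trans[OF n, of top] by (auto simp: ennreal_mult_less_top)
      finally show ?thesis .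
    qed
  qed (use p R um Gm C C2 f_out Gout in auto)
  moreover have "AE x in lebesgue. x \<in> ?B \<longrightarrow> G x = g x"
    using AE_completion[OF Gg0] by eventually_elim (simp add: g0_def)
  ultimately show ?thesis by (rule that)
qed

lemma integrable_const_Icc: "integrable lborel (\<lambda>t::real. (C::real) * indicator {c..d} t)"
  by (intro integrable_mult_right integrable_real_indicator) (auto simp: emeasure_lborel_Icc_eq)

section \<open>Flux and source term in logarithmic radius\<close>

locale radial_kappa = radial_W0_dim p R U G f N cN
  for p R :: real and U :: "'a::euclidean_space \<Rightarrow> real" and G :: "'a \<Rightarrow> 'a" and f :: "nat \<Rightarrow> 'a \<Rightarrow> real" and N cN +
  fixes \<kappa> :: "real \<Rightarrow> real" and s \<mu> lam q :: real
  assumes \<kappa>_meas [measurable]: "\<kappa> \<in> borel_measurable borel"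
    and \<kappa>_int: "integrable lborel (\<lambda>t. \<kappa> t * indicator {a..} t)"
    and V_lt: "a < ln R \<Longrightarrow> V a = - (\<integral>t. \<kappa> t * indicator {a..} t \<partial>lborel)"
    and \<kappa>_out: "ln R \<le> t \<Longrightarrow> \<kappa> t = 0"
    and \<kappa>_p: "(\<integral>\<^sup>+t. ennreal (\<bar>\<kappa> t\<bar> powr p * exp ((N - p) * t)) \<partial>lborel) < \<infinity>"
    and pN: "p < N" and pq: "p < q"
    and V_pos: "t < ln R \<Longrightarrow> 0 < V t"
begin

lemma V_eq: "V a = - (\<integral>t. \<kappa> t * indicator {a..} t \<partial>lborel)"
proof (cases "a < ln R")
  case False
  have "(\<integral>t. \<kappa> t * indicator {a..} t \<partial>lborel) = integral\<^sup>L lborel (\<lambda>t::real. 0::real)"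
    using False \<kappa>_out by (intro Bochner_Integration.integral_cong) (auto simp: indicator_def)
  then show ?thesis using False V_out by simp
qed (rule V_lt)

lemma V_cont: "continuous_on UNIV V"
proof (intro continuous_at_imp_continuous_on ballI)
  fix a :: real
  show "isCont V a"
    unfolding continuous_at_sequentially
  proof (intro allI impI)
    fix X assume X: "X \<longlonglongrightarrow> a"
    have "\<forall>\<^sub>F n in sequentially. a - 1 < X n" using order_tendstoD(1)[OF X, of "a - 1"] by simp
    then obtain n0 where n0: "\<And>n. n0 \<le> n \<Longrightarrow> a - 1 < X n" unfolding eventually_sequentially by blast
    have X': "(\<lambda>n. X (n + n0)) \<longlonglongrightarrow> a" using X by (rule LIMSEQ_ignore_initial_segment)
    have "(\<lambda>n. \<integral>t. \<kappa> t * indicator {X (n + n0)..} t \<partial>lborel) \<longlonglongrightarrow> (\<integral>t. \<kappa> t * indicator {a..} t \<partial>lborel)"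
    proof (rule integral_dominated_convergence[where w="\<lambda>t. norm (\<kappa> t * indicator {a - 1..} t)"])
      show "AE t in lborel. (\<lambda>n. \<kappa> t * indicator {X (n + n0)..} t) \<longlonglongrightarrow> \<kappa> t * indicator {a..} t"
        using AE_lborel_singleton[of a]
      proof eventually_elim
        case (elim t)
        have "\<forall>\<^sub>F n in sequentially. \<kappa> t * indicator {a..} t = \<kappa> t * indicator {X (n + n0)..} t"
        proof (cases "t < a")
          case True
          show ?thesis using order_tendstoD(1)[OF X' True] by eventually_elim (use True in \<open>auto simp: indicator_def\<close>)
        next
          case False
          then have "a < t" using elim by simp
          show ?thesis using order_tendstoD(2)[OF X' \<open>a < t\<close>] by eventually_elim (use \<open>a < t\<close> in \<open>auto simp: indicator_def\<close>)
        qed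
        then show ?case by (rule Lim_transform_eventually[OF tendsto_const])
      qed
      show "AE t in lborel. norm (\<kappa> t * indicator {X (n + n0)..} t) \<le> norm (\<kappa> t * indicator {a - 1..} t)" for n
        using n0[of "n + n0"] by (intro AE_I2) (auto simp: indicator_def)
    qed (auto intro!: integrable_norm \<kappa>_int)
    then have "(\<lambda>n. V (X (n + n0))) \<longlonglongrightarrow> V a" unfolding V_eq by (rule tendsto_minus)
    then show "(V \<circ> X) \<longlonglongrightarrow> V a" unfolding o_def by (rule LIMSEQ_offset)
  qed
qed

lemma V_nonneg: "0 \<le> V t"
  using V_pos[of t] V_out[of t] by (cases "t < ln R") auto

text \<open>With r = e^t and kappa = r u' this is the flux r^(N-1) |u'|^(p-2) u'. \<open>Q\<close>
  is r^N times the zero-order terms, so that the equation will read A' = -Q.\<close>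

definition A :: "real \<Rightarrow> real" where "A t = exp ((N - p) * t) * spow (p - 1) (\<kappa> t)"
definition Q :: "real \<Rightarrow> real" where
  "Q t = exp (N * t) * (\<mu> * exp (- p * t) * V t powr (p - 1) + lam * V t powr (p - 1) + exp (- s * t) * V t powr (q - 1))"

lemma spow_meas [measurable]: "spow r \<in> borel_measurable borel"
  unfolding spow_def[abs_def] by measurable

lemma A_meas [measurable]: "A \<in> borel_measurable borel"
  unfolding A_def[abs_def] by measurable

lemma V_powr_cont: "0 < r \<Longrightarrow> continuous_on UNIV (\<lambda>t. V t powr r)"
  by (rule continuous_on_powr'[OF V_cont continuous_on_const]) (use V_nonneg in auto)

lemma Q_cont: "continuous_on UNIV Q"
proof -
  have "continuous_on UNIV (\<lambda>t. V t powr (p - 1))" "continuous_on UNIV (\<lambda>t. V t powr (q - 1))"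
    using p pq by (auto intro: V_powr_cont)
  moreover have "continuous_on UNIV (\<lambda>t. exp (c * t))" for c :: real by (intro continuous_intros)
  ultimately show ?thesis
    unfolding Q_def by (intro continuous_on_mult continuous_on_add continuous_on_const)
qed

text \<open>Use |kappa|^(p-1) <= 1 + |kappa|^p: the weight is bounded on a bounded interval, and
  weight times |kappa|^p is the energy density.\<close>

lemma A_integrable: "integrable lborel (\<lambda>t. A t * indicator {c..d} t)"
proof (rule integrableI_bounded)
  let ?K = "exp (\<bar>N - p\<bar> * max \<bar>c\<bar> \<bar>d\<bar>)"
  have "(\<integral>\<^sup>+t. ennreal (norm (A t * indicator {c..d} t)) \<partial>lborel) \<le> (\<integral>\<^sup>+t. ennreal ?K * indicator {c..d} t + ennreal (\<bar>\<kappa> t\<bar> powr p * exp ((N - p) * t)) \<partial>lborel)"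
  proof (rule nn_integral_mono)
    fix t
    show "ennreal (norm (A t * indicator {c..d} t)) \<le> ennreal ?K * indicator {c..d} t + ennreal (\<bar>\<kappa> t\<bar> powr p * exp ((N - p) * t))"
    proof (cases "t \<in> {c..d}")
      case True
      have "\<bar>\<kappa> t\<bar> powr (p - 1) \<le> 1 + \<bar>\<kappa> t\<bar> powr p"
      proof (cases "\<bar>\<kappa> t\<bar> \<le> 1")
        case True
        then have "\<bar>\<kappa> t\<bar> powr (p - 1) \<le> 1 powr (p - 1)" using p by (intro powr_mono2) auto
        moreover have "0 \<le> \<bar>\<kappa> t\<bar> powr p" by simp
        moreover have "(1::real) powr (p - 1) = 1" by simp
        ultimately show ?thesis by linarith
      next
        case False
        then have "\<bar>\<kappa> t\<bar> powr (p - 1) \<le> \<bar>\<kappa> t\<bar> powr p" by (intro powr_mono) auto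
        then show ?thesis by simp
      qed
      then have "exp ((N - p) * t) * \<bar>\<kappa> t\<bar> powr (p - 1) \<le> exp ((N - p) * t) * (1 + \<bar>\<kappa> t\<bar> powr p)"
        by (intro mult_left_mono) auto
      moreover have "exp ((N - p) * t) \<le> ?K"
      proof -
        have "(N - p) * t \<le> \<bar>N - p\<bar> * \<bar>t\<bar>" by (metis abs_ge_self abs_mult)
        also have "\<dots> \<le> \<bar>N - p\<bar> * max \<bar>c\<bar> \<bar>d\<bar>" using True by (intro mult_left_mono) auto
        finally show ?thesis by simp
      qed
      moreover have "e * (1 + x) = e + x * e" for e x :: real by (simp add: algebra_simps)
      moreover have "\<bar>A t\<bar> = exp ((N - p) * t) * \<bar>\<kappa> t\<bar> powr (p - 1)"
        unfolding A_def by (simp only: abs_mult abs_spow abs_exp_cancel)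
      ultimately have "\<bar>A t\<bar> \<le> ?K + \<bar>\<kappa> t\<bar> powr p * exp ((N - p) * t)"
        by (metis add_right_mono order_trans)
      then show ?thesis using True by (simp add: ennreal_leI flip: ennreal_plus)
    qed simp
  qed
  also have "\<dots> = ennreal ?K * emeasure lborel {c..d} + (\<integral>\<^sup>+t. ennreal (\<bar>\<kappa> t\<bar> powr p * exp ((N - p) * t)) \<partial>lborel)"
    by (subst nn_integral_add) (auto simp: nn_integral_cmult_indicator)
  also have "\<dots> < \<infinity>" using \<kappa>_p by (auto simp: ennreal_mult_less_top emeasure_lborel_Icc_eq)
  finally show "(\<integral>\<^sup>+t. ennreal (norm (A t * indicator {c..d} t)) \<partial>lborel) < \<infinity>" .
qed measurable

lemma integrable_mult_bounded:
  fixes g h :: "real \<Rightarrow> real"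
  assumes g: "integrable lborel (\<lambda>t. g t * indicator {c..d} t)" and [measurable]: "g \<in> borel_measurable borel"
    and h: "continuous_on UNIV h" "\<And>t. t \<notin> {c..d} \<Longrightarrow> h t = 0"
  shows "integrable lborel (\<lambda>t. g t * h t)"
proof -
  have "compact (h ` {c..d})" by (intro compact_continuous_image continuous_on_subset[OF h(1)]) auto
  then obtain B where B: "0 < B" "\<And>t. t \<in> {c..d} \<Longrightarrow> norm (h t) \<le> B"
    using compact_imp_bounded bounded_pos by (metis image_eqI)
  have [measurable]: "h \<in> borel_measurable borel" using h(1) by (rule borel_measurable_continuous_onI)
  show ?thesis
  proof (rule Bochner_Integration.integrable_bound[OF integrable_mult_right[OF integrable_norm[OF g], of B]])
    have "\<bar>g t * h t\<bar> \<le> B * \<bar>g t * indicator {c..d} t\<bar>" for t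
    proof (cases "t \<in> {c..d}")
      case True
      then show ?thesis using mult_left_mono[OF B(2)[OF True], of "\<bar>g t\<bar>"] by (simp add: abs_mult mult.commute)
    qed (simp add: h(2))
    then show "AE t in lborel. norm (g t * h t) \<le> norm (B * norm (g t * indicator {c..d} t))"
      using B(1) by (simp add: abs_mult)
  qed simp
qed

end

section \<open>Du Bois-Reymond's lemma for the radial equation\<close>

lemma pull_out:
  fixes a b t :: real and \<eta> :: "real \<Rightarrow> real"
  assumes "0 < a" "a < b" "\<And>t. t \<le> a \<or> b \<le> t \<Longrightarrow> \<eta> t = 0" "t \<notin> {ln a / 2..ln b / 2}"
  shows "\<eta> (exp (2 * t)) = 0"
proof -
  have "2 * t < ln a \<or> ln b < 2 * t" using assms(4) by auto
  then have "exp (2 * t) < a \<or> b < exp (2 * t)" using assms(1,2)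
    by (metis exp_less_cancel_iff exp_ln less_trans)
  then show ?thesis using assms(3)[of "exp (2 * t)"] by auto
qed

text \<open>\<open>weak\<close> is the equation tested with F(|x|^2); since |x|^2 = e^(2t), the
  factor of \<open>A\<close> is the t-derivative of F(e^(2t)). \<open>q_eq\<close> is the
  criticality of \<open>q\<close> cleared of its denominator.\<close>

locale radial_weak = radial_kappa +
  assumes q_eq: "(N - p) * q = (N - s) * p"
    and weak: "\<lbrakk>\<And>t. (F has_real_derivative \<eta> t) (at t); smooth_fun \<eta>; 0 < a; a < b; b < R\<^sup>2;
      \<And>t. t \<le> a \<Longrightarrow> F t = 0; \<And>t. b \<le> t \<Longrightarrow> F t = 0; \<And>t. t \<le> a \<or> b \<le> t \<Longrightarrow> \<eta> t = 0\<rbrakk> \<Longrightarrow>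
      (\<integral>t. A t * (2 * exp (2 * t) * \<eta> (exp (2 * t))) \<partial>lborel) = (\<integral>t. Q t * F (exp (2 * t)) \<partial>lborel)"
begin

definition P :: "real \<Rightarrow> real" where "P = (SOME P. \<forall>t. (P has_real_derivative Q t) (at t))"

lemma P_deriv: "(P has_real_derivative Q t) (at t)"
proof -
  have "\<exists>P. \<forall>x. - \<infinity> < ereal x \<longrightarrow> ereal x < \<infinity> \<longrightarrow> (P has_vector_derivative Q x) (at x)"
    by (rule einterval_antiderivative) (use Q_cont in \<open>auto simp: continuous_on_eq_continuous_at\<close>)
  then have "\<exists>P. \<forall>t. (P has_real_derivative Q t) (at t)"
    by (auto simp: has_real_derivative_iff_has_vector_derivative)
  then show ?thesis unfolding P_def by (rule someI2_ex) blast
qed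

lemma P_cont: "continuous_on UNIV P"
  by (rule continuous_at_imp_continuous_on) (auto intro: DERIV_isCont[OF P_deriv])

lemma P_meas [measurable]: "P \<in> borel_measurable borel"
  using P_cont by (rule borel_measurable_continuous_onI)

abbreviation (input) pull :: "(real \<Rightarrow> real) \<Rightarrow> real \<Rightarrow> real" where
  "pull \<eta> t \<equiv> 2 * exp (2 * t) * \<eta> (exp (2 * t))"

lemma pull_cont: "continuous_on UNIV \<eta> \<Longrightarrow> continuous_on UNIV (pull \<eta>)"
proof -
  assume c: "continuous_on UNIV \<eta>"
  have e: "continuous_on UNIV (\<lambda>t::real. exp (2 * t))" by (intro continuous_intros)
  have "continuous_on UNIV (\<lambda>t. \<eta> (exp (2 * t)))"
    by (rule continuous_on_compose2[OF c e]) simp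
  then show ?thesis by (intro continuous_on_mult[OF continuous_on_mult[OF continuous_on_const e]])
qed

lemma P_integrable: "integrable lborel (\<lambda>t. P t * indicator {c..d} t)"
  using borel_integrable_compact[of "{c..d}" P] continuous_on_subset[OF P_cont]
  by (simp add: mult.commute)

lemma FTC_pull:
  assumes F: "\<And>t. (F has_real_derivative \<eta> t) (at t)" and \<eta>: "continuous_on UNIV \<eta>"
    and ab: "0 < a" "a < b" and out: "\<And>t. t \<le> a \<or> b \<le> t \<Longrightarrow> \<eta> t = 0"
  shows "(\<integral>t. pull \<eta> t \<partial>lborel) = F b - F a"
    and "F a = 0 \<Longrightarrow> F b = 0 \<Longrightarrow> (\<And>t. t \<le> a \<or> b \<le> t \<Longrightarrow> F t = 0) \<Longrightarrow>
      (\<integral>t. Q t * F (exp (2 * t)) \<partial>lborel) = - (\<integral>t. P t * pull \<eta> t \<partial>lborel)"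
proof -
  let ?c = "ln a / 2" and ?d = "ln b / 2"
  have cd: "?c \<le> ?d" using ab by simp
  have e: "exp (2 * ?c) = a" "exp (2 * ?d) = b" using ab by auto
  have D: "((\<lambda>t. F (exp (2 * t))) has_real_derivative pull \<eta> t) (at t)" for t
    by (rule DERIV_cong[OF DERIV_chain2[where f=F and g="\<lambda>t. exp (2 * t)", OF F]])
       (auto intro!: derivative_eq_intros)
  have pc: "isCont (pull \<eta>) t" for t using pull_cont[OF \<eta>] by (simp add: continuous_on_eq_continuous_at)
  have z: "\<eta> (exp (2 * t)) = 0" if "t \<notin> {?c..?d}" for t by (rule pull_out[where \<eta>=\<eta>, OF ab out that])
  have "(\<integral>t. pull \<eta> t \<partial>lborel) = (\<integral>t. pull \<eta> t * indicator {?c..?d} t \<partial>lborel)"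
    using z by (intro Bochner_Integration.integral_cong) (auto simp: indicator_def)
  also have "\<dots> = F b - F a"
    using integral_FTC_Icc_real[OF cd D pc] unfolding e .
  finally show "(\<integral>t. pull \<eta> t \<partial>lborel) = F b - F a" .
  assume F0: "F a = 0" "F b = 0" "\<And>t. t \<le> a \<or> b \<le> t \<Longrightarrow> F t = 0"
  have zF: "F (exp (2 * t)) = 0" if "t \<notin> {?c..?d}" for t by (rule pull_out[where \<eta>=F, OF ab F0(3) that])
  have FC: "continuous_on UNIV (\<lambda>t. F (exp (2 * t)))"
    by (rule continuous_at_imp_continuous_on) (auto intro: DERIV_isCont[OF D])
  have PD: "((\<lambda>t. P t * F (exp (2 * t))) has_real_derivative Q t * F (exp (2 * t)) + pull \<eta> t * P t) (at t)" for t
    by (rule DERIV_mult[OF P_deriv D])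
  have cont: "isCont (\<lambda>t. Q t * F (exp (2 * t)) + pull \<eta> t * P t) t" for t
    using continuous_on_add[OF continuous_on_mult[OF Q_cont FC] continuous_on_mult[OF pull_cont[OF \<eta>] P_cont]]
    by (simp add: continuous_on_eq_continuous_at)
  have "(\<integral>t. Q t * F (exp (2 * t)) + pull \<eta> t * P t \<partial>lborel) = (\<integral>t. (Q t * F (exp (2 * t)) + pull \<eta> t * P t) * indicator {?c..?d} t \<partial>lborel)"
  proof (intro Bochner_Integration.integral_cong refl)
    fix t show "Q t * F (exp (2 * t)) + pull \<eta> t * P t = (Q t * F (exp (2 * t)) + pull \<eta> t * P t) * indicator {?c..?d} t"
      using z[of t] zF[of t] by (cases "t \<in> {?c..?d}") (simp_all del: atLeastAtMost_iff)
  qed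
  also have "\<dots> = 0"
    using integral_FTC_Icc_real[OF cd PD cont] unfolding e by (simp add: F0)
  finally have 0: "(\<integral>t. Q t * F (exp (2 * t)) + pull \<eta> t * P t \<partial>lborel) = 0" .
  have iP: "integrable lborel (\<lambda>t. P t * pull \<eta> t)"
  proof (rule integrable_mult_bounded[OF P_integrable[of ?c ?d] _ pull_cont[OF \<eta>]])
    show "pull \<eta> t = 0" if "t \<notin> {?c..?d}" for t using z[OF that] by simp
  qed simp
  have iQ: "integrable lborel (\<lambda>t. Q t * F (exp (2 * t)))"
  proof (rule integrable_mult_bounded[OF _ _ FC zF])
    show "integrable lborel (\<lambda>t. Q t * indicator {?c..?d} t)"
      using borel_integrable_compact[of "{?c..?d}" Q] continuous_on_subset[OF Q_cont] by (simp add: mult.commute)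
    show "Q \<in> borel_measurable borel" using Q_cont by (rule borel_measurable_continuous_onI)
  qed
  show "(\<integral>t. Q t * F (exp (2 * t)) \<partial>lborel) = - (\<integral>t. P t * pull \<eta> t \<partial>lborel)"
    using 0 Bochner_Integration.integral_add[OF iQ iP] by (simp add: mult.commute)
qed

abbreviation (input) M :: "real \<Rightarrow> real" where "M t \<equiv> A t + P t"

lemma M_integrable: "integrable lborel (\<lambda>t. M t * indicator {c..d} t)"
  using Bochner_Integration.integrable_add[OF A_integrable P_integrable] by (simp add: distrib_right)

text \<open>Integration by parts moves \<open>Q\<close> to its primitive \<open>P\<close>, so the
  weak equation says that A + P is orthogonal to the derivatives of test functions.\<close>

lemma M_test:
  assumes F: "\<And>t. (F has_real_derivative \<eta> t) (at t)" and \<eta>: "smooth_fun \<eta>" and ab: "0 < a" "a < b" "b < R\<^sup>2"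
    and out: "\<And>t. t \<le> a \<Longrightarrow> F t = 0" "\<And>t. b \<le> t \<Longrightarrow> F t = 0" "\<And>t. t \<le> a \<or> b \<le> t \<Longrightarrow> \<eta> t = 0"
  shows "(\<integral>t. M t * pull \<eta> t \<partial>lborel) = 0"
proof -
  have c\<eta>: "continuous_on UNIV \<eta>" by (rule smooth_fun_continuous[OF \<eta>])
  have z: "pull \<eta> t = 0" if "t \<notin> {ln a / 2..ln b / 2}" for t using pull_out[where \<eta>=\<eta>, OF ab(1,2) out(3) that] by simp
  have iP: "integrable lborel (\<lambda>t. P t * pull \<eta> t)"
    by (rule integrable_mult_bounded[OF P_integrable[of "ln a / 2" "ln b / 2"] _ pull_cont[OF c\<eta>] z]) auto
  have iA: "integrable lborel (\<lambda>t. A t * pull \<eta> t)"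
    by (rule integrable_mult_bounded[OF A_integrable[of "ln a / 2" "ln b / 2"] _ pull_cont[OF c\<eta>] z]) auto
  have "(\<integral>t. M t * pull \<eta> t \<partial>lborel) = (\<integral>t. A t * pull \<eta> t \<partial>lborel) + (\<integral>t. P t * pull \<eta> t \<partial>lborel)"
    unfolding distrib_right by (rule Bochner_Integration.integral_add[OF iA iP])
  also have "(\<integral>t. A t * pull \<eta> t \<partial>lborel) = (\<integral>t. Q t * F (exp (2 * t)) \<partial>lborel)"
    by (rule weak[OF F \<eta> ab out])
  also have "\<dots> = - (\<integral>t. P t * pull \<eta> t \<partial>lborel)"
    by (rule FTC_pull(2)[OF F c\<eta> ab(1,2) out(3)]) (use out ab in auto)
  finally show ?thesis by simp
qed

text \<open>A bump is not the derivative of a test function, but it becomes one after subtracting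
  the multiple of a fixed reference bump that has the same integral.\<close>

lemma M_bump_const:
  obtains C where "\<And>a b k. 0 < a \<Longrightarrow> a < b \<Longrightarrow> b < R\<^sup>2 \<Longrightarrow> (\<integral>t. (M t - C) * pull (bump a b k) t \<partial>lborel) = 0"
proof -
  let ?a2 = "R\<^sup>2 / 4" and ?b2 = "R\<^sup>2 / 2"
  have ab2: "0 < ?a2" "?a2 < ?b2" "?b2 < R\<^sup>2" using R by auto
  let ?\<eta>2 = "bump ?a2 ?b2 0"
  note bo = bump_out
  obtain F2 where F2: "\<And>t. (F2 has_real_derivative ?\<eta>2 t) (at t)" "\<And>t. t \<le> ?a2 \<Longrightarrow> F2 t = 0" "\<And>t. ?b2 \<le> t \<Longrightarrow> F2 t = F2 ?b2"
    using antiderivative_vanishing_outside[OF smooth_fun_continuous[OF smooth_bump] ab2(2) bump_out[OF ab2(2)]] by blast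
  have I2: "0 < F2 ?b2"
  proof -
    obtain z where z: "?a2 < z" "z < ?b2" "F2 ?b2 - F2 ?a2 = (?b2 - ?a2) * ?\<eta>2 z" using MVT2[OF ab2(2) F2(1)] by blast
    then have "F2 ?b2 = (?b2 - ?a2) * ?\<eta>2 z" using F2(2)[of ?a2] by simp
    also have "0 < \<dots>" using bump_pos[OF z(1,2), of 0] ab2(2) by (intro mult_pos_pos) auto
    finally show ?thesis .
  qed
  \<comment> \<open>The mean of A + P with respect to the reference bump, whose total integral is
    \<open>F2 ?b2\<close>.\<close>
  define C where "C = (\<integral>t. M t * pull ?\<eta>2 t \<partial>lborel) / F2 ?b2"
  show ?thesis
  proof (rule that[of C])
    fix a b :: real and k assume ab: "0 < a" "a < b" "b < R\<^sup>2"
    let ?\<eta>1 = "bump a b k"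
    obtain F1 where F1: "\<And>t. (F1 has_real_derivative ?\<eta>1 t) (at t)" "\<And>t. t \<le> a \<Longrightarrow> F1 t = 0" "\<And>t. b \<le> t \<Longrightarrow> F1 t = F1 b"
      using antiderivative_vanishing_outside[OF smooth_fun_continuous[OF smooth_bump] ab(2) bump_out[OF ab(2)]] by blast
    \<comment> \<open>Chosen so that the combined primitive vanishes to the right of both
      bumps.\<close>
    define m where "m = - (F1 b / F2 ?b2)"
    define F where "F t = F1 t + m * F2 t" for t
    define \<eta> where "\<eta> t = ?\<eta>1 t + m * ?\<eta>2 t" for t
    have s\<eta>: "smooth_fun \<eta>" unfolding \<eta>_def[abs_def]
      by (intro smooth_fun.add smooth_fun.mult smooth_fun.const smooth_bump)
    have dF: "(F has_real_derivative \<eta> t) (at t)" for t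
      unfolding F_def[abs_def] \<eta>_def by (intro DERIV_add DERIV_cmult F1 F2)
    let ?a = "min a ?a2" and ?b = "max b ?b2"
    have z1: "pull ?\<eta>1 t = 0" if "t \<notin> {ln a / 2..ln b / 2}" for t
      using pull_out[where \<eta>="?\<eta>1", OF ab(1,2) bump_out[OF ab(2)] that] by simp
    have z2: "pull ?\<eta>2 t = 0" if "t \<notin> {ln ?a2 / 2..ln ?b2 / 2}" for t
      using pull_out[where \<eta>="?\<eta>2", OF ab2(1,2) bump_out[OF ab2(2)] that] by simp
    have c1: "continuous_on UNIV (pull ?\<eta>1)" and c2: "continuous_on UNIV (pull ?\<eta>2)"
      by (intro pull_cont smooth_fun_continuous[OF smooth_bump])+
    have i1: "integrable lborel (\<lambda>t. M t * pull ?\<eta>1 t)"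
      by (rule integrable_mult_bounded[OF M_integrable[of "ln a / 2" "ln b / 2"] _ c1 z1]) auto
    have i2: "integrable lborel (\<lambda>t. M t * pull ?\<eta>2 t)"
      by (rule integrable_mult_bounded[OF M_integrable[of "ln ?a2 / 2" "ln ?b2 / 2"] _ c2 z2]) auto
    have i3: "integrable lborel (\<lambda>t. C * pull ?\<eta>1 t)"
      by (rule integrable_mult_bounded[OF integrable_const_Icc[of C "ln a / 2" "ln b / 2"] _ c1 z1]) auto
    have "(\<integral>t. M t * pull \<eta> t \<partial>lborel) = 0"
    proof (rule M_test[OF dF s\<eta>, of ?a ?b])
      show "F t = 0" if "?b \<le> t" for t using that F1(3)[of t] F2(3)[of t] I2 by (simp add: F_def m_def)
    qed (use ab ab2 F1 F2 bump_out[OF ab(2)] bump_out[OF ab2(2)] in \<open>auto simp: F_def \<eta>_def\<close>)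
    also have "(\<lambda>t. M t * pull \<eta> t) = (\<lambda>t. M t * pull ?\<eta>1 t + m * (M t * pull ?\<eta>2 t))"
      by (auto simp: \<eta>_def algebra_simps)
    finally have "(\<integral>t. M t * pull ?\<eta>1 t \<partial>lborel) + m * (\<integral>t. M t * pull ?\<eta>2 t \<partial>lborel) = 0"
      by (simp only: Bochner_Integration.integral_add[OF i1 integrable_mult_right[OF i2]] integral_mult_right_zero)
    then have 1: "(\<integral>t. M t * pull ?\<eta>1 t \<partial>lborel) = C * F1 b"
      using I2 by (simp add: m_def C_def field_simps)
    have 2: "(\<integral>t. pull ?\<eta>1 t \<partial>lborel) = F1 b"
      using FTC_pull(1)[OF F1(1) smooth_fun_continuous[OF smooth_bump] ab(1,2) bump_out[OF ab(2)]] F1(2)[of a] by simp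
    have "(\<integral>t. (M t - C) * pull ?\<eta>1 t \<partial>lborel) = (\<integral>t. M t * pull ?\<eta>1 t \<partial>lborel) - (\<integral>t. C * pull ?\<eta>1 t \<partial>lborel)"
      unfolding left_diff_distrib by (rule Bochner_Integration.integral_diff[OF i1 i3])
    then show "(\<integral>t. (M t - C) * pull ?\<eta>1 t \<partial>lborel) = 0"
      using 1 2 by (simp only: integral_mult_right_zero)
  qed
qed

text \<open>This is du Bois-Reymond's lemma in the variable \<open>\<tau> = \<bar>x\<bar>\<^sup>2 = e\<^sup>2\<^sup>t\<close>.\<close>

lemma M_const: obtains C where "AE t in lborel. t < ln R \<longrightarrow> M t = C"
proof -
  obtain C where C: "\<And>a b k. 0 < a \<Longrightarrow> a < b \<Longrightarrow> b < R\<^sup>2 \<Longrightarrow> (\<integral>t. (M t - C) * pull (bump a b k) t \<partial>lborel) = 0"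
    using M_bump_const by blast
  let ?h = "\<lambda>t. (M t - C) * (2 * exp (2 * t))"
  have ih: "integrable lborel (\<lambda>t. ?h t * indicator {c..d} t)" for c d
  proof -
    have iC: "integrable lborel (\<lambda>t. C * indicator {c..d} t)" by (rule integrable_const_Icc)
    have "integrable lborel (\<lambda>t. (M t - C) * indicator {c..d} t)"
      using Bochner_Integration.integrable_diff[OF M_integrable iC] by (simp add: left_diff_distrib)
    then have "integrable lborel (\<lambda>t. (2 * exp (2 * d)) * norm ((M t - C) * indicator {c..d} t))"
      by (intro integrable_mult_right integrable_norm)
    then show ?thesis
    proof (rule Bochner_Integration.integrable_bound)
      have "\<bar>?h t * indicator {c..d} t\<bar> \<le> (2 * exp (2 * d)) * \<bar>(M t - C) * indicator {c..d} t\<bar>" for t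
        by (auto simp: indicator_def abs_mult mult.commute[of "\<bar>M t - C\<bar>"] intro!: mult_right_mono)
      then show "AE t in lborel. norm (?h t * indicator {c..d} t) \<le> norm ((2 * exp (2 * d)) * norm ((M t - C) * indicator {c..d} t))"
        by (simp add: abs_mult)
    qed measurable
  qed
  have zero: "(\<integral>t. ?h t * indicator {a<..<b} t \<partial>lborel) = 0" if ab: "a < b" "b < ln R" for a b
  proof -
    let ?a = "exp (2 * a)" and ?b = "exp (2 * b)"
    have "exp (2 * b) < exp (2 * ln R)" using ab by simp
    also have "exp (2 * ln R) = R\<^sup>2" using R by (simp add: exp_double)
    finally have ab': "0 < ?a" "?a < ?b" "?b < R\<^sup>2" using ab by auto
    \<comment> \<open>The bumps tend to the indicator of the interval, so the vanishing of their
      integrals passes to intervals.\<close>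
    have "(\<lambda>k. \<integral>t. (M t - C) * pull (bump ?a ?b k) t \<partial>lborel) \<longlonglongrightarrow> (\<integral>t. ?h t * indicator {a<..<b} t \<partial>lborel)"
    proof (rule integral_dominated_convergence[where w="\<lambda>t. norm (?h t * indicator {a..b} t)"])
      show "AE t in lborel. (\<lambda>k. (M t - C) * pull (bump ?a ?b k) t) \<longlonglongrightarrow> ?h t * indicator {a<..<b} t"
      proof (rule AE_I2)
        fix t
        show "(\<lambda>k. (M t - C) * pull (bump ?a ?b k) t) \<longlonglongrightarrow> ?h t * indicator {a<..<b} t"
        proof (cases "t \<in> {a<..<b}")
          case True
          then have "(\<lambda>k. bump ?a ?b k (exp (2 * t))) \<longlonglongrightarrow> 1" by (intro bump_tendsto) auto
          then have "(\<lambda>k. ?h t * bump ?a ?b k (exp (2 * t))) \<longlonglongrightarrow> ?h t * 1" by (intro tendsto_intros)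
          then show ?thesis using True by (simp add: mult_ac)
        next
          case False
          then have "bump ?a ?b k (exp (2 * t)) = 0" for k by (intro bump_out[OF ab'(2)]) auto
          then show ?thesis using False by simp
        qed
      qed
      show "AE t in lborel. norm ((M t - C) * pull (bump ?a ?b k) t) \<le> norm (?h t * indicator {a..b} t)" for k
      proof (rule AE_I2)
        fix t
        show "norm ((M t - C) * pull (bump ?a ?b k) t) \<le> norm (?h t * indicator {a..b} t)"
        proof (cases "t \<in> {a..b}")
          case True
          have "\<bar>?h t\<bar> * \<bar>bump ?a ?b k (exp (2 * t))\<bar> \<le> \<bar>?h t\<bar> * 1"
            using bump_nonneg[of ?a ?b k] bump_le_1[of ?a ?b k] by (intro mult_left_mono) (auto simp: abs_of_nonneg)
          then show ?thesis using True by (simp add: abs_mult mult_ac)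
        next
          case False
          then have "bump ?a ?b k (exp (2 * t)) = 0" for k by (intro bump_out[OF ab'(2)]) auto
          then show ?thesis using False by simp
        qed
      qed
      show "(\<lambda>t. (M t - C) * pull (bump ?a ?b k) t) \<in> borel_measurable lborel" for k
      proof -
        have m1: "pull (bump ?a ?b k) \<in> borel_measurable borel"
          by (rule borel_measurable_continuous_onI[OF pull_cont[OF smooth_fun_continuous[OF smooth_bump]]])
        have m2: "(\<lambda>t. M t - C) \<in> borel_measurable borel" by measurable
        show ?thesis using borel_measurable_times[OF m2 m1] by (simp only: measurable_cong_sets[OF sets_lborel refl])
      qed
      show "integrable lborel (\<lambda>t. norm (?h t * indicator {a..b} t))" by (intro integrable_norm ih)
    qed measurable
    then show ?thesis by (simp only: C[OF ab'] LIMSEQ_const_iff)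
  qed
  \<comment> \<open>These compact intervals, ending strictly below ln R, exhaust the
    half-line.\<close>
  have "AE t in lborel. t \<in> {- real n..ln R - 1 / real (Suc n)} \<longrightarrow> ?h t = 0" for n
  proof (rule AE_zero_of_interval_integrals[OF ih])
    fix a b assume "a < b" "b \<le> ln R - 1 / real (Suc n)"
    moreover have "0 < 1 / real (Suc n)" by simp
    ultimately show "(\<integral>t. ?h t * indicator {a<..<b} t \<partial>lborel) = 0" by (intro zero) linarith+
  qed measurable
  then have "AE t in lborel. \<forall>n. t \<in> {- real n..ln R - 1 / real (Suc n)} \<longrightarrow> ?h t = 0"
    by (subst AE_all_countable) auto
  then have "AE t in lborel. t < ln R \<longrightarrow> M t = C"
  proof eventually_elim
    case (elim t)
    show ?case
    proof
      assume t: "t < ln R"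
      have "\<forall>\<^sub>F n in sequentially. 1 / real (Suc n) < ln R - t"
        using order_tendstoD(2)[OF LIMSEQ_inverse_real_of_nat, of "ln R - t"] t by (simp add: inverse_eq_divide)
      moreover have "\<forall>\<^sub>F n in sequentially. - t < real n"
        using filterlim_real_sequentially by (simp add: filterlim_at_top_dense)
      ultimately have "\<forall>\<^sub>F n in sequentially. 1 / real (Suc n) < ln R - t \<and> - t < real n"
        by eventually_elim auto
      then obtain n where "1 / real (Suc n) < ln R - t" "- t < real n" unfolding eventually_sequentially by blast
      then have "?h t = 0" using elim[rule_format, of n] by auto
      then show "M t = C" by simp
    qed
  qed
  then show ?thesis by (rule that)
qed

end

section \<open>Reduction of the weak formulation to one variable\<close>

context radial_kappa
begin

text \<open>For a function of |x|^2 both gradients are multiples of x, so every integrand depends on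
  ln |x| only. The test function vanishes near the origin and near the boundary, hence has compact
  support in t, which makes the terms separately integrable.\<close>

lemma weak_radial_form:
  fixes u :: "'a \<Rightarrow> real" and g :: "'a \<Rightarrow> 'a"
  assumes Uu: "\<And>x. x \<in> ball 0 R - {0} \<Longrightarrow> U x = u x"
    and gG: "AE x in lebesgue. x \<in> ball 0 R \<longrightarrow> G x = g x"
    and G\<kappa>: "AE x in lborel. G x = (\<kappa> (ln (norm x)) / (norm x)\<^sup>2) *\<^sub>R x"
    and gm: "g \<in> borel_measurable (lebesgue_on (ball 0 R))"
    and um: "u \<in> borel_measurable (lebesgue_on (ball 0 R))"
    and ws: "\<And>\<phi>. \<phi> \<in> test_functions (ball 0 R) \<Longrightarrow>
         (\<integral>x. norm (g x) powr (p - 2) * (g x \<bullet> grad \<phi> x)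
              - \<mu> / norm x powr p * \<bar>u x\<bar> powr (p - 2) * u x * \<phi> x
              - lam * \<bar>u x\<bar> powr (p - 2) * u x * \<phi> x \<partial>lebesgue_on (ball 0 R)) =
         (\<integral>x. \<bar>u x\<bar> powr (q - 2) * u x / norm x powr s * \<phi> x \<partial>lebesgue_on (ball 0 R))"
    and F: "\<And>t. (F has_real_derivative \<eta> t) (at t)" and \<eta>: "smooth_fun \<eta>" and ab: "0 < a" "a < b" "b < R\<^sup>2"
    and out: "\<And>t. t \<le> a \<Longrightarrow> F t = 0" "\<And>t. b \<le> t \<Longrightarrow> F t = 0" "\<And>t. t \<le> a \<or> b \<le> t \<Longrightarrow> \<eta> t = 0"
  shows "(\<integral>t. A t * (2 * exp (2 * t) * \<eta> (exp (2 * t))) \<partial>lborel) = (\<integral>t. Q t * F (exp (2 * t)) \<partial>lborel)"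
proof -
  let ?B = "ball (0::'a) R"
  let ?\<phi> = "\<lambda>x::'a. F (x \<bullet> x)"
  note T = radial_test_function[OF F \<eta> ab(1,3) R out(1,2)]
  have cF: "continuous_on UNIV F" by (rule continuous_at_imp_continuous_on) (auto intro: DERIV_isCont[OF F])
  have c\<eta>: "continuous_on UNIV \<eta>" by (rule smooth_fun_continuous[OF \<eta>])
  have [measurable]: "F \<in> borel_measurable borel" "\<eta> \<in> borel_measurable borel"
    using cF c\<eta> by (auto intro: borel_measurable_continuous_onI)
  define h1 where "h1 t = exp (- p * t) * spow (p - 1) (\<kappa> t) * (2 * exp (2 * t) * \<eta> (exp (2 * t)))
      - \<mu> * exp (- p * t) * V t powr (p - 1) * F (exp (2 * t)) - lam * V t powr (p - 1) * F (exp (2 * t))" for t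
  define h2 where "h2 t = exp (- s * t) * V t powr (q - 1) * F (exp (2 * t))" for t
  have [measurable]: "h1 \<in> borel_measurable borel" "h2 \<in> borel_measurable borel"
    unfolding h1_def[abs_def] h2_def[abs_def] by measurable
  have sq: "x \<bullet> x = exp (2 * ln (norm x))" if "x \<noteq> 0" for x :: 'a
    using that by (simp add: exp_double power2_norm_eq_inner)
  have np: "norm x powr r = exp (r * ln (norm x))" if "x \<noteq> 0" for x :: 'a and r
    using that by (simp add: powr_def)
  have uV: "u x = V (ln (norm x))" "0 < V (ln (norm x))" if "x \<in> ?B" "x \<noteq> 0" for x
  proof -
    have "U x = u x" using that by (intro Uu) auto
    then show "u x = V (ln (norm x))" using U_eq_V[OF that(2)] by simp
    show "0 < V (ln (norm x))" using that R by (intro V_pos) (simp add: ln_less_cancel_iff)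
  qed
  have spV: "\<bar>v\<bar> powr (r - 2) * v = v powr (r - 1)" if "0 < v" for v r :: real
    using that powr_minus2_mult[of v r] by (simp add: spow_nonneg)
  have E1: "AE x in lebesgue_on ?B. norm (g x) powr (p - 2) * (g x \<bullet> grad ?\<phi> x)
              - \<mu> / norm x powr p * \<bar>u x\<bar> powr (p - 2) * u x * ?\<phi> x
              - lam * \<bar>u x\<bar> powr (p - 2) * u x * ?\<phi> x = h1 (ln (norm x))"
  proof (subst AE_restrict_space_iff)
    show "AE x in lebesgue. x \<in> ?B \<longrightarrow> norm (g x) powr (p - 2) * (g x \<bullet> grad ?\<phi> x)
              - \<mu> / norm x powr p * \<bar>u x\<bar> powr (p - 2) * u x * ?\<phi> x
              - lam * \<bar>u x\<bar> powr (p - 2) * u x * ?\<phi> x = h1 (ln (norm x))"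
      using gG AE_completion[OF G\<kappa>] AE_completion[OF AE_lborel_singleton[of "0::'a"]]
    proof eventually_elim
      case (elim x)
      show ?case
      proof
        assume x: "x \<in> ?B"
        define t where "t = ln (norm x)"
        have nx: "norm x = exp t" using elim by (simp add: t_def)
        have gx: "g x = (\<kappa> t / (norm x)\<^sup>2) *\<^sub>R x" using elim x by (simp add: t_def)
        have ng: "norm (g x) = \<bar>\<kappa> t\<bar> * exp (- t)"
          unfolding gx by (simp add: nx power2_eq_square exp_minus field_simps)
        have gi: "g x \<bullet> grad ?\<phi> x = 2 * \<eta> (exp (2 * t)) * \<kappa> t"
        proof -
          have xx: "x \<bullet> x = exp (2 * t)" "(norm x)\<^sup>2 = exp (2 * t)"
            using sq[OF elim(3)] by (auto simp: t_def power2_norm_eq_inner)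
          have gr: "grad ?\<phi> x = (2 * \<eta> (x \<bullet> x)) *\<^sub>R x" by (rule T(2))
          have "g x \<bullet> grad ?\<phi> x = \<kappa> t / (norm x)\<^sup>2 * (2 * \<eta> (x \<bullet> x) * (x \<bullet> x))"
            unfolding gx gr by (simp only: inner_scaleR_left inner_scaleR_right mult_ac)
          then show ?thesis unfolding xx by simp
        qed
        have "norm (g x) powr (p - 2) * (g x \<bullet> grad ?\<phi> x) = exp (- t * (p - 2)) * (\<bar>\<kappa> t\<bar> powr (p - 2) * \<kappa> t) * (2 * \<eta> (exp (2 * t)))"
          unfolding ng gi by (simp add: powr_mult exp_powr_real)
        also have "exp (- t * (p - 2)) = exp (- p * t) * exp (2 * t)" by (simp add: algebra_simps flip: exp_add)
        finally have 1: "norm (g x) powr (p - 2) * (g x \<bullet> grad ?\<phi> x) = exp (- p * t) * spow (p - 1) (\<kappa> t) * (2 * exp (2 * t) * \<eta> (exp (2 * t)))"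
          unfolding powr_minus2_mult by simp
        have u: "u x = V t" "0 < V t" using uV[OF x elim(3)] by (auto simp: t_def)
        have \<phi>: "?\<phi> x = F (exp (2 * t))" using sq[OF elim(3)] by (simp add: t_def)
        have 2: "\<mu> / norm x powr p * \<bar>u x\<bar> powr (p - 2) * u x * ?\<phi> x = \<mu> * exp (- p * t) * V t powr (p - 1) * F (exp (2 * t))"
        proof -
          have "\<mu> / norm x powr p * \<bar>u x\<bar> powr (p - 2) * u x * ?\<phi> x = \<mu> / norm x powr p * (\<bar>u x\<bar> powr (p - 2) * u x) * ?\<phi> x"
            by (simp only: mult.assoc)
          also have "\<dots> = \<mu> / exp (p * t) * V t powr (p - 1) * F (exp (2 * t))"
            unfolding u(1) \<phi> np[OF elim(3), folded t_def] spV[OF u(2)] ..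
          finally show ?thesis by (simp add: exp_minus divide_inverse)
        qed
        have 3: "lam * \<bar>u x\<bar> powr (p - 2) * u x * ?\<phi> x = lam * V t powr (p - 1) * F (exp (2 * t))"
        proof -
          have "lam * \<bar>u x\<bar> powr (p - 2) * u x * ?\<phi> x = lam * (\<bar>u x\<bar> powr (p - 2) * u x) * ?\<phi> x"
            by (simp only: mult.assoc)
          then show ?thesis unfolding u(1) \<phi> spV[OF u(2)] .
        qed
        show "norm (g x) powr (p - 2) * (g x \<bullet> grad ?\<phi> x)
              - \<mu> / norm x powr p * \<bar>u x\<bar> powr (p - 2) * u x * ?\<phi> x
              - lam * \<bar>u x\<bar> powr (p - 2) * u x * ?\<phi> x = h1 (ln (norm x))"
          unfolding 1 2 3 t_def[symmetric] h1_def ..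
      qed
    qed
  qed auto
  have E2: "AE x in lebesgue_on ?B. \<bar>u x\<bar> powr (q - 2) * u x / norm x powr s * ?\<phi> x = h2 (ln (norm x))"
  proof (subst AE_restrict_space_iff)
    show "AE x in lebesgue. x \<in> ?B \<longrightarrow> \<bar>u x\<bar> powr (q - 2) * u x / norm x powr s * ?\<phi> x = h2 (ln (norm x))"
      using AE_completion[OF AE_lborel_singleton[of "0::'a"]]
    proof eventually_elim
      case (elim x)
      show ?case
      proof
        assume x: "x \<in> ?B"
        define t where "t = ln (norm x)"
        have u: "u x = V t" "0 < V t" using uV[OF x elim] by (auto simp: t_def)
        have \<phi>: "?\<phi> x = F (exp (2 * t))" using sq[OF elim] by (simp add: t_def)
        show "\<bar>u x\<bar> powr (q - 2) * u x / norm x powr s * ?\<phi> x = h2 (ln (norm x))"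
          unfolding u(1) \<phi> np[OF elim] h2_def t_def[symmetric] spV[OF u(2)] by (simp add: exp_minus divide_inverse)
      qed
    qed
  qed auto
  \<comment> \<open>The test function vanishes outside the ball, so the integrals may be taken over
    the whole space.\<close>
  have zero_out: "h (ln (norm x)) = 0" if "x \<notin> ?B" "h = h1 \<or> h = h2" for x :: 'a and h
  proof -
    have x: "R \<le> norm x" "x \<noteq> 0" using that(1) R by auto
    then have "b \<le> x \<bullet> x" using ab(3) power_mono[of R "norm x" 2] R by (simp add: power2_norm_eq_inner)
    then have "b \<le> exp (2 * ln (norm x))" using sq[OF x(2)] by simp
    then have "F (exp (2 * ln (norm x))) = 0" "\<eta> (exp (2 * ln (norm x))) = 0" using out by auto
    then show ?thesis using that(2) by (auto simp: h1_def h2_def)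
  qed
  have tr: "(\<integral>x. k x \<partial>lebesgue_on ?B) = cN * (\<integral>t. exp (N * t) * h t \<partial>lborel)"
    if k: "AE x in lebesgue_on ?B. k x = h (ln (norm x))" "k \<in> borel_measurable (lebesgue_on ?B)" and h: "h = h1 \<or> h = h2" for k h
  proof -
    have [measurable]: "h \<in> borel_measurable borel" using h by auto
    have hm: "(\<lambda>x::'a. h (ln (norm x))) \<in> borel_measurable borel" by measurable
    have "(\<integral>x. k x \<partial>lebesgue_on ?B) = (\<integral>x. h (ln (norm x)) \<partial>lebesgue_on ?B)"
      by (rule integral_cong_AE[OF k(2) _ k(1)])
         (intro measurable_restrict_space1 measurable_completion, use hm in simp)
    also have "\<dots> = (\<integral>x. indicator ?B x *\<^sub>R h (ln (norm x)) \<partial>lebesgue)"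
      by (rule integral_restrict_space) simp
    also have "\<dots> = (\<integral>x. h (ln (norm (x::'a))) \<partial>lebesgue)"
      using zero_out h by (intro Bochner_Integration.integral_cong) (auto simp: indicator_def)
    also have "\<dots> = (\<integral>x. h (ln (norm (x::'a))) \<partial>lborel)" by (rule integral_completion) (use hm in simp)
    also have "\<dots> = (\<integral>t. cN * (exp (N * t) * h t) \<partial>lborel)"
      by (subst integral_ln_norm) (auto simp: cN_def N_def mult.assoc)
    finally show ?thesis by simp
  qed
  have grm: "grad ?\<phi> \<in> borel_measurable borel"
  proof -
    have "continuous_on UNIV (\<lambda>x::'a. (2 * \<eta> (x \<bullet> x)) *\<^sub>R x)" by (rule C1_continuous_D[OF T(3)])
    moreover have "grad ?\<phi> = (\<lambda>x. (2 * \<eta> (x \<bullet> x)) *\<^sub>R x)" by (rule C1_grad[OF T(3)])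
    ultimately show ?thesis by (simp only:) (rule borel_measurable_continuous_onI)
  qed
  have leb: "k \<in> borel_measurable (lebesgue_on ?B)" if "k \<in> borel_measurable borel" for k :: "'a \<Rightarrow> 'b::topological_space"
    using that by (intro measurable_restrict_space1 measurable_completion) simp
  have m\<phi>: "?\<phi> \<in> borel_measurable (lebesgue_on ?B)" by (rule leb) measurable
  have mg: "grad ?\<phi> \<in> borel_measurable (lebesgue_on ?B)" by (rule leb[OF grm])
  have mn: "(\<lambda>x. norm x powr r) \<in> borel_measurable (lebesgue_on ?B)" for r by (rule leb) measurable
  have mu: "(\<lambda>x. \<bar>u x\<bar> powr r) \<in> borel_measurable (lebesgue_on ?B)" for r
    by (rule measurable_abs_powr[OF um])
  have mng: "(\<lambda>x. norm (g x) powr r) \<in> borel_measurable (lebesgue_on ?B)" for r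
    using measurable_abs_powr[OF measurable_compose[OF gm borel_measurable_norm], of r] by simp
  have K1: "(\<lambda>x. norm (g x) powr (p - 2) * (g x \<bullet> grad ?\<phi> x)
              - \<mu> / norm x powr p * \<bar>u x\<bar> powr (p - 2) * u x * ?\<phi> x
              - lam * \<bar>u x\<bar> powr (p - 2) * u x * ?\<phi> x) \<in> borel_measurable (lebesgue_on ?B)"
    by (intro borel_measurable_diff borel_measurable_times borel_measurable_inner borel_measurable_divide
         borel_measurable_const gm um m\<phi> mg mn mu mng)
  have K2: "(\<lambda>x. \<bar>u x\<bar> powr (q - 2) * u x / norm x powr s * ?\<phi> x) \<in> borel_measurable (lebesgue_on ?B)"
    by (intro borel_measurable_times borel_measurable_divide
         borel_measurable_const um m\<phi> mn mu)
  have "cN * (\<integral>t. exp (N * t) * h1 t \<partial>lborel) = cN * (\<integral>t. exp (N * t) * h2 t \<partial>lborel)"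
    using ws[OF T(1)] tr[OF E1 K1] tr[OF E2 K2] by simp
  then have eq: "(\<integral>t. exp (N * t) * h1 t \<partial>lborel) = (\<integral>t. exp (N * t) * h2 t \<partial>lborel)"
    using cN_pos by simp
  let ?c = "ln a / 2" and ?d = "ln b / 2"
  let ?Q1 = "\<lambda>t. exp (N * t) * (\<mu> * exp (- p * t) * V t powr (p - 1) + lam * V t powr (p - 1))"
  let ?Q2 = "\<lambda>t. exp (N * t) * (exp (- s * t) * V t powr (q - 1))"
  have ce: "continuous_on UNIV (\<lambda>t. exp (c * t))" for c :: real by (intro continuous_intros)
  have FC: "continuous_on UNIV (\<lambda>t. F (exp (2 * t)))" by (rule continuous_on_compose2[OF cF ce]) simp
  have \<eta>C: "continuous_on UNIV (\<lambda>t. 2 * exp (2 * t) * \<eta> (exp (2 * t)))"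
    by (intro continuous_on_mult[OF continuous_on_mult[OF continuous_on_const ce]] continuous_on_compose2[OF c\<eta> ce]) simp
  have zF: "F (exp (2 * t)) = 0" if "t \<notin> {?c..?d}" for t
    by (rule pull_out[where \<eta>=F, OF ab(1,2) _ that]) (use out in auto)
  have z\<eta>: "2 * exp (2 * t) * \<eta> (exp (2 * t)) = 0" if "t \<notin> {?c..?d}" for t
    using pull_out[where \<eta>=\<eta>, OF ab(1,2) out(3) that] by simp
  have cV1: "continuous_on UNIV (\<lambda>t. V t powr (p - 1))" and cV2: "continuous_on UNIV (\<lambda>t. V t powr (q - 1))"
    using p pq by (auto intro: V_powr_cont)
  have iQ: "integrable lborel (\<lambda>t. k t * F (exp (2 * t)))" if k: "continuous_on UNIV k" for k
  proof (rule integrable_mult_bounded[OF _ _ FC zF])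
    show "integrable lborel (\<lambda>t. k t * indicator {?c..?d} t)"
      using borel_integrable_compact[of "{?c..?d}" k] continuous_on_subset[OF k] by (simp add: mult.commute)
    show "k \<in> borel_measurable borel" using k by (rule borel_measurable_continuous_onI)
  qed
  have i1: "integrable lborel (\<lambda>t. ?Q1 t * F (exp (2 * t)))" and i2: "integrable lborel (\<lambda>t. ?Q2 t * F (exp (2 * t)))"
    by (rule iQ, intro continuous_on_mult continuous_on_add continuous_on_const ce cV1 cV2)+
  have iA: "integrable lborel (\<lambda>t. A t * (2 * exp (2 * t) * \<eta> (exp (2 * t))))"
    by (rule integrable_mult_bounded[OF A_integrable[of ?c ?d] A_meas \<eta>C z\<eta>])
  have H1: "exp (N * t) * h1 t = A t * (2 * exp (2 * t) * \<eta> (exp (2 * t))) - ?Q1 t * F (exp (2 * t))" for t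
  proof -
    have "exp ((N - p) * t) = exp (N * t) * exp (- p * t)" by (simp add: algebra_simps flip: exp_add)
    then show ?thesis by (simp only: h1_def A_def) (simp add: algebra_simps)
  qed
  have H2: "exp (N * t) * h2 t = ?Q2 t * F (exp (2 * t))" for t by (simp add: h2_def)
  have "(\<integral>t. A t * (2 * exp (2 * t) * \<eta> (exp (2 * t))) \<partial>lborel) - (\<integral>t. ?Q1 t * F (exp (2 * t)) \<partial>lborel) = (\<integral>t. ?Q2 t * F (exp (2 * t)) \<partial>lborel)"
    using eq unfolding H1 H2 Bochner_Integration.integral_diff[OF iA i1] .
  then have "(\<integral>t. A t * (2 * exp (2 * t) * \<eta> (exp (2 * t))) \<partial>lborel) = (\<integral>t. ?Q1 t * F (exp (2 * t)) + ?Q2 t * F (exp (2 * t)) \<partial>lborel)"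
    unfolding Bochner_Integration.integral_add[OF i1 i2] by linarith
  also have "\<dots> = (\<integral>t. Q t * F (exp (2 * t)) \<partial>lborel)"
    by (intro Bochner_Integration.integral_cong refl) (simp add: Q_def algebra_simps)
  finally show ?thesis .
qed

end

section \<open>The Emden-Fowler variables and their decay at the origin\<close>

context radial_weak
begin

definition C where "C = (SOME C. AE t in lborel. t < ln R \<longrightarrow> A t + P t = C)"

lemma AE_C: "AE t in lborel. t < ln R \<longrightarrow> A t + P t = C"
  unfolding C_def by (rule someI_ex) (use M_const in blast)

text \<open>The continuous representative of the flux \<open>A\<close>; solving the definition of
  \<open>A\<close> for the derivative turns it into the continuous representative \<open>K\<close>
  of \<kappa>.\<close>

definition Z :: "real \<Rightarrow> real" where "Z t = C - P t"
definition K :: "real \<Rightarrow> real" where "K t = spow (1 / (p - 1)) (exp (- (N - p) * t) * Z t)"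
definition \<delta> :: real where "\<delta> = (N - p) / p"

lemma \<delta>_pos: "0 < \<delta>" and \<delta>_p: "\<delta> * p = N - p"
  using p pN by (auto simp: \<delta>_def)

lemma AE_K: "AE t in lborel. t < ln R \<longrightarrow> \<kappa> t = K t"
  using AE_C
proof eventually_elim
  case (elim t)
  show ?case
  proof
    assume "t < ln R"
    then have "Z t = exp ((N - p) * t) * spow (p - 1) (\<kappa> t)" using elim by (auto simp: Z_def A_def)
    then have "exp (- (N - p) * t) * Z t = (exp (- (N - p) * t) * exp ((N - p) * t)) * spow (p - 1) (\<kappa> t)" by simp
    also have "exp (- (N - p) * t) * exp ((N - p) * t) = 1"
      by (simp only: exp_add[symmetric] mult_minus_left left_minus exp_zero)
    finally show "\<kappa> t = K t" using p spow_inverse(1)[of "p - 1" "\<kappa> t"] by (simp add: K_def)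
  qed
qed

lemma Z_cont: "continuous_on UNIV Z"
  unfolding Z_def by (intro continuous_on_diff continuous_on_const P_cont)

lemma K_cont: "continuous_on UNIV K"
proof -
  have "continuous_on UNIV (\<lambda>t::real. exp (- (N - p) * t))" by (intro continuous_intros)
  then have "continuous_on UNIV (\<lambda>t. exp (- (N - p) * t) * Z t)" by (rule continuous_on_mult[OF _ Z_cont])
  then show ?thesis unfolding K_def using p by (intro continuous_on_spow) auto
qed

lemma V_increment:
  assumes "c < t"
  shows "V t - V c = (\<integral>x. \<kappa> x * indicator {c..<t} x \<partial>lborel)"
proof -
  have "V t - V c = (\<integral>x. \<kappa> x * indicator {c..} x \<partial>lborel) - (\<integral>x. \<kappa> x * indicator {t..} x \<partial>lborel)"
    using V_eq[of t] V_eq[of c] by simp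
  also have "\<dots> = (\<integral>x. \<kappa> x * indicator {c..} x - \<kappa> x * indicator {t..} x \<partial>lborel)"
    by (rule Bochner_Integration.integral_diff[OF \<kappa>_int \<kappa>_int, symmetric])
  also have "\<dots> = (\<integral>x. \<kappa> x * indicator {c..<t} x \<partial>lborel)"
    using assms by (intro Bochner_Integration.integral_cong) (auto simp: indicator_def)
  finally show ?thesis .
qed

text \<open>Increments of \<open>V\<close> are integrals of \<kappa>, which agrees almost everywhere
  with a continuous function; so \<open>V\<close> is classically differentiable.\<close>

lemma V_deriv:
  assumes t: "t < ln R" shows "(V has_real_derivative K t) (at t)"
proof -
  have "\<exists>J. \<forall>x. - \<infinity> < ereal x \<longrightarrow> ereal x < \<infinity> \<longrightarrow> (J has_vector_derivative K x) (at x)"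
    by (rule einterval_antiderivative) (use K_cont in \<open>auto simp: continuous_on_eq_continuous_at\<close>)
  then obtain J where J: "\<And>x. (J has_real_derivative K x) (at x)"
    by (auto simp: has_real_derivative_iff_has_vector_derivative)
  have Kc: "isCont K x" for x using K_cont by (simp add: continuous_on_eq_continuous_at)
  have [measurable]: "K \<in> borel_measurable borel" using K_cont by (rule borel_measurable_continuous_onI)
  have inc: "V x = V (t - 1) - J (t - 1) + J x" if x: "t - 1 < x" "x < ln R" for x
  proof -
    have "V x - V (t - 1) = (\<integral>s. \<kappa> s * indicator {t - 1..<x} s \<partial>lborel)" by (rule V_increment[OF x(1)])
    also have "\<dots> = (\<integral>s. K s * indicator {t - 1..x} s \<partial>lborel)"
    proof (rule integral_cong_AE)
      show "AE s in lborel. \<kappa> s * indicator {t - 1..<x} s = K s * indicator {t - 1..x} s"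
        using AE_K AE_lborel_singleton[of x]
        by eventually_elim (use x in \<open>auto simp: indicator_def\<close>)
    qed measurable
    also have "\<dots> = J x - J (t - 1)" by (rule integral_FTC_Icc_real[OF _ J Kc]) (use x in simp)
    finally show ?thesis by simp
  qed
  have "((\<lambda>x. V (t - 1) - J (t - 1) + J x) has_real_derivative K t) (at t)"
    by (auto intro!: derivative_eq_intros J)
  then show ?thesis
    by (rule has_field_derivative_transform_within_open[where S="{t - 1<..<ln R}"]) (use t inc in auto)
qed

definition w :: "real \<Rightarrow> real" where "w t = exp (\<delta> * t) * V t"
definition z :: "real \<Rightarrow> real" where "z t = exp (- \<delta> * t) * Z t"

lemma spow_z: "spow (1 / (p - 1)) (z t) = exp (\<delta> * t) * K t"
proof -
  have "z t = (exp (- (N - p) * t) * Z t) * exp (\<delta> * (p - 1) * t)"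
  proof -
    have "- \<delta> * t = - (N - p) * t + \<delta> * (p - 1) * t" unfolding \<delta>_p[symmetric] by (simp add: algebra_simps)
    then have "exp (- \<delta> * t) = exp (- (N - p) * t) * exp (\<delta> * (p - 1) * t)" by (simp only: exp_add)
    then show ?thesis by (simp add: z_def)
  qed
  then have "spow (1 / (p - 1)) (z t) = K t * exp (\<delta> * (p - 1) * t) powr (1 / (p - 1))"
    by (simp add: spow_mult_pos K_def)
  also have "exp (\<delta> * (p - 1) * t) powr (1 / (p - 1)) = exp (\<delta> * t)" using p by (simp add: exp_powr_real)
  finally show ?thesis by (simp add: mult.commute)
qed

lemma w_deriv:
  assumes t: "t < ln R" shows "(w has_real_derivative \<delta> * w t + spow (1 / (p - 1)) (z t)) (at t)"
proof -
  have e: "((\<lambda>t. exp (\<delta> * t)) has_real_derivative exp (\<delta> * t) * \<delta>) (at t)" by (auto intro!: derivative_eq_intros)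
  show ?thesis unfolding w_def[abs_def] spow_z
    by (rule DERIV_cong[OF DERIV_mult[OF e V_deriv[OF t]]]) (simp add: w_def algebra_simps)
qed

text \<open>The relations \<delta> p = N - p and \<delta> q = N - s cancel every power of e^t,
  except that \<open>exp (p * t)\<close> survives in the term with \<open>lam\<close>.\<close>

lemma z_deriv:
  assumes t: "t < ln R"
  shows "(z has_real_derivative - \<delta> * z t - (\<mu> + lam * exp (p * t)) * w t powr (p - 1) - w t powr (q - 1)) (at t)"
proof -
  have e: "((\<lambda>t. exp (- \<delta> * t)) has_real_derivative exp (- \<delta> * t) * (- \<delta>)) (at t)" by (auto intro!: derivative_eq_intros)
  have dZ: "(Z has_real_derivative 0 - Q t) (at t)"
    unfolding Z_def[abs_def] by (intro DERIV_diff DERIV_const P_deriv)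
  have V: "0 < V t" by (rule V_pos[OF t])
  have wp: "w t powr r = exp (\<delta> * r * t) * V t powr r" for r
    using V by (simp add: w_def powr_mult exp_powr_real mult_ac)
  have N: "(N - p) * t = \<delta> * p * t" by (simp only: \<delta>_p)
  have dq: "\<delta> * q = N - s"
  proof -
    have "\<delta> * q * p = (N - s) * p" using q_eq p by (simp add: \<delta>_def)
    then show ?thesis using p by simp
  qed
  have "exp (- \<delta> * t) * (exp (N * t) * exp (- p * t)) = exp (\<delta> * (p - 1) * t)"
  proof -
    have "- \<delta> * t + (N * t + - p * t) = (N - p) * t - \<delta> * t" by (simp add: algebra_simps)
    also have "\<dots> = \<delta> * (p - 1) * t" unfolding N by (simp add: algebra_simps)
    finally show ?thesis unfolding exp_add[symmetric] by simp
  qed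
  moreover have "exp (- \<delta> * t) * exp (N * t) = exp (p * t) * exp (\<delta> * (p - 1) * t)"
  proof -
    have "- \<delta> * t + N * t = p * t + ((N - p) * t - \<delta> * t)" by (simp add: algebra_simps)
    also have "\<dots> = p * t + \<delta> * (p - 1) * t" unfolding N by (simp add: algebra_simps)
    finally show ?thesis unfolding exp_add[symmetric] by simp
  qed
  moreover have "exp (- \<delta> * t) * (exp (N * t) * exp (- s * t)) = exp (\<delta> * (q - 1) * t)"
  proof -
    have "- \<delta> * t + (N * t + - s * t) = (N - s - \<delta>) * t" by (simp add: algebra_simps)
    also have "\<dots> = \<delta> * (q - 1) * t" unfolding dq[symmetric] by (simp add: algebra_simps)
    finally show ?thesis unfolding exp_add[symmetric] by simp
  qed
  ultimately have "exp (- \<delta> * t) * Q t = \<mu> * (exp (\<delta> * (p - 1) * t) * V t powr (p - 1))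
      + lam * (exp (p * t) * exp (\<delta> * (p - 1) * t)) * V t powr (p - 1) + exp (\<delta> * (q - 1) * t) * V t powr (q - 1)"
  proof -
    assume a: "exp (- \<delta> * t) * (exp (N * t) * exp (- p * t)) = exp (\<delta> * (p - 1) * t)"
      "exp (- \<delta> * t) * exp (N * t) = exp (p * t) * exp (\<delta> * (p - 1) * t)"
      "exp (- \<delta> * t) * (exp (N * t) * exp (- s * t)) = exp (\<delta> * (q - 1) * t)"
    have "exp (- \<delta> * t) * Q t = \<mu> * ((exp (- \<delta> * t) * (exp (N * t) * exp (- p * t))) * V t powr (p - 1))
      + lam * (exp (- \<delta> * t) * exp (N * t)) * V t powr (p - 1) + (exp (- \<delta> * t) * (exp (N * t) * exp (- s * t))) * V t powr (q - 1)"
      unfolding Q_def by (simp only: distrib_left mult_ac)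
    then show ?thesis unfolding a .
  qed
  then have eQ: "exp (- \<delta> * t) * Q t = (\<mu> + lam * exp (p * t)) * w t powr (p - 1) + w t powr (q - 1)"
    unfolding wp by (simp add: algebra_simps)
  have "(z has_real_derivative exp (- \<delta> * t) * (- \<delta>) * Z t + (0 - Q t) * exp (- \<delta> * t)) (at t)"
    unfolding z_def[abs_def] by (rule DERIV_mult[OF e dZ])
  then show ?thesis
    by (rule DERIV_cong) (use eQ in \<open>simp add: z_def algebra_simps\<close>)
qed

lemma w_end: "(w \<longlongrightarrow> 0) (at_left (ln R))"
proof -
  have "(V \<longlongrightarrow> V (ln R)) (at (ln R))" using V_cont by (auto simp: continuous_on_def)
  then have "(V \<longlongrightarrow> 0) (at_left (ln R))" using V_out[of "ln R"] by (auto intro: tendsto_within_subset)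
  then have "(w \<longlongrightarrow> exp (\<delta> * ln R) * 0) (at_left (ln R))" unfolding w_def by (intro tendsto_intros)
  then show ?thesis by simp
qed

text \<open>The energy density with respect to dt; left of ln R it equals |z|^(p/(p-1)) almost
  everywhere.\<close>

definition X :: "real \<Rightarrow> real" where "X t = \<bar>\<kappa> t\<bar> powr p * exp ((N - p) * t)"

lemma X_nonneg: "0 \<le> X t" by (simp add: X_def)

lemma X_meas [measurable]: "X \<in> borel_measurable borel"
  unfolding X_def[abs_def] by measurable

lemma X_integrable: "integrable lborel X"
  using \<kappa>_p by (intro integrableI_nonneg) (auto simp: X_def[symmetric] X_nonneg)

text \<open>If |z| stayed above \<open>e\<close> on a half-line, the energy density would be bounded
  below there by a positive constant and could not be integrable.\<close>

lemma z_small: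
  assumes e: "0 < e" shows "\<exists>t<t0. \<bar>z t\<bar> < e"
proof (rule ccontr)
  assume "\<not> (\<exists>t<t0. \<bar>z t\<bar> < e)"
  then have big: "e \<le> \<bar>z t\<bar>" if "t < t0" for t using that by force
  define m where "m = min t0 (ln R)"
  define c where "c = e powr (p / (p - 1))"
  have c: "0 < c" using e by (simp add: c_def)
  have Xz: "AE t in lborel. t < m \<longrightarrow> c \<le> X t"
    using AE_K
  proof eventually_elim
    case (elim t)
    show ?case
    proof
      assume t: "t < m"
      then have \<kappa>: "\<kappa> t = K t" using elim by (simp add: m_def)
      have "X t = (exp (\<delta> * t) * \<bar>K t\<bar>) powr p"
        by (simp add: X_def \<kappa> powr_mult exp_powr_real \<delta>_p[symmetric] mult_ac)
      also have "exp (\<delta> * t) * \<bar>K t\<bar> = \<bar>z t\<bar> powr (1 / (p - 1))"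
        by (simp add: abs_spow[symmetric] spow_z abs_mult)
      also have "(\<bar>z t\<bar> powr (1 / (p - 1))) powr p = \<bar>z t\<bar> powr (p / (p - 1))" by (simp add: powr_powr)
      also have "c \<le> \<dots>" unfolding c_def using big[of t] t e p by (intro powr_mono2) (auto simp: m_def)
      finally show "c \<le> X t" .
    qed
  qed
  have le: "c * real n \<le> (\<integral>t. X t \<partial>lborel)" for n
  proof -
    have "c * real n = (\<integral>t. c * indicator {m - real n<..<m} t \<partial>lborel)" by simp
    also have "\<dots> \<le> (\<integral>t. X t \<partial>lborel)"
    proof (rule integral_mono_AE[OF _ X_integrable])
      show "integrable lborel (\<lambda>t. c * indicator {m - real n<..<m} t)"
        by (intro integrable_mult_right integrable_real_indicator) auto
      show "AE t in lborel. c * indicator {m - real n<..<m} t \<le> X t"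
        using Xz by eventually_elim (auto simp: indicator_def X_nonneg)
    qed
    finally show ?thesis .
  qed
  obtain n where "(\<integral>t. X t \<partial>lborel) / c < real n" using reals_Archimedean2 by blast
  then have "(\<integral>t. X t \<partial>lborel) < c * real n" using c by (simp add: field_simps)
  then show False using le[of n] by simp
qed

lemma X_tail:
  assumes e: "0 < e" shows "\<exists>t1<ln R. (\<integral>t. X t * indicator {..<t1} t \<partial>lborel) \<le> e"
proof -
  have "(\<lambda>n. \<integral>t. X t * indicator {..<- real n} t \<partial>lborel) \<longlonglongrightarrow> integral\<^sup>L lborel (\<lambda>t::real. 0::real)"
  proof (rule integral_dominated_convergence[where w=X])
    show "AE t in lborel. (\<lambda>n. X t * indicator {..<- real n} t) \<longlonglongrightarrow> 0"
    proof (rule AE_I2)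
      fix t
      have "\<forall>\<^sub>F n in sequentially. - t < real n"
        using filterlim_real_sequentially by (simp add: filterlim_at_top_dense)
      then have "\<forall>\<^sub>F n in sequentially. 0 = X t * indicator {..<- real n} t"
        by eventually_elim (auto simp: indicator_def)
      then show "(\<lambda>n. X t * indicator {..<- real n} t) \<longlonglongrightarrow> 0" by (rule Lim_transform_eventually[OF tendsto_const])
    qed
    show "AE t in lborel. norm (X t * indicator {..<- real n} t) \<le> X t" for n
      by (intro AE_I2) (auto simp: indicator_def X_nonneg)
  qed (auto intro: X_integrable)
  then have "\<forall>\<^sub>F n in sequentially. (\<integral>t. X t * indicator {..<- real n} t \<partial>lborel) < e"
    using e by (auto dest!: order_tendstoD(2))
  moreover have "\<forall>\<^sub>F n in sequentially. - ln R < real n"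
    using filterlim_real_sequentially by (simp add: filterlim_at_top_dense)
  ultimately have "\<forall>\<^sub>F n in sequentially. (\<integral>t. X t * indicator {..<- real n} t \<partial>lborel) < e \<and> - ln R < real n"
    by eventually_elim auto
  then obtain n where "(\<integral>t. X t * indicator {..<- real n} t \<partial>lborel) < e" "- ln R < real n"
    unfolding eventually_sequentially by blast
  then show ?thesis by (intro exI[of _ "- real n"]) auto
qed

lemma exp_Icc_integral_le:
  fixes t t1 d :: real
  assumes "t < t1" and d: "0 < d"
  shows "integrable lborel (\<lambda>x. exp (- d * x) * indicator {t..t1} x)"
    and "(\<integral>x. exp (- d * x) * indicator {t..t1} x \<partial>lborel) \<le> exp (- d * t) / d"
proof -
  have B: "has_bochner_integral lborel (\<lambda>x. exp (- d * x) * indicator {t..t1} x) (- exp (- d * t1) / d - (- exp (- d * t) / d))"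
    by (rule has_bochner_integral_FTC_Icc_real[where F="\<lambda>x. - exp (- d * x) / d"]) (use assms in \<open>auto intro!: derivative_eq_intros continuous_intros\<close>)
  then show "integrable lborel (\<lambda>x. exp (- d * x) * indicator {t..t1} x)" by (simp add: has_bochner_integral_iff)
  have "(\<integral>x. exp (- d * x) * indicator {t..t1} x \<partial>lborel) = exp (- d * t) / d - exp (- d * t1) / d"
    using B by (simp add: has_bochner_integral_iff)
  moreover have "0 \<le> exp (- d * t1) / d" using d by simp
  ultimately show "(\<integral>x. exp (- d * x) * indicator {t..t1} x \<partial>lborel) \<le> exp (- d * t) / d" by linarith
qed

text \<open>
  The radial estimate \<open>u(r) = o(r\<^sup>-\<^sup>d)\<close>; Young's inequality in the form \<open>x \<le> h + h\<^sup>1\<^sup>-\<^sup>p x\<^sup>p\<close> replaces Hoelder's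
  inequality.
\<close>

lemma w_upper:
  assumes h: "0 < h" and t: "t < t1" "t1 < ln R"
  shows "w t \<le> exp (\<delta> * t) * V t1 + h / \<delta> + h powr (1 - p) * (\<integral>x. X x * indicator {..<t1} x \<partial>lborel)"
proof -
  let ?I = "\<integral>x. X x * indicator {..<t1} x \<partial>lborel"
  let ?E = "\<lambda>x. exp (- \<delta> * x) * indicator {t..t1} x"
  have iX: "integrable lborel (\<lambda>x. X x * indicator {..<t1} x)"
    by (rule Bochner_Integration.integrable_bound[OF X_integrable]) (auto simp: indicator_def)
  have iE: "integrable lborel ?E" "(\<integral>x. ?E x \<partial>lborel) \<le> exp (- \<delta> * t) / \<delta>"
    using exp_Icc_integral_le[OF t(1) \<delta>_pos] by auto
  have ik: "integrable lborel (\<lambda>x. \<kappa> x * indicator {t..<t1} x)"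
    by (rule Bochner_Integration.integrable_bound[OF integrable_norm[OF \<kappa>_int[of t]]]) (auto simp: indicator_def)
  have "V t - V t1 = - (\<integral>x. \<kappa> x * indicator {t..<t1} x \<partial>lborel)" using V_increment[OF t(1)] by simp
  also have "\<dots> \<le> \<bar>\<integral>x. \<kappa> x * indicator {t..<t1} x \<partial>lborel\<bar>" by (rule abs_ge_minus_self)
  also have "\<dots> \<le> (\<integral>x. \<bar>\<kappa> x * indicator {t..<t1} x\<bar> \<partial>lborel)" by (rule integral_abs_bound)
  also have "\<dots> \<le> (\<integral>x. h * ?E x + exp (- \<delta> * t) * h powr (1 - p) * (X x * indicator {..<t1} x) \<partial>lborel)"
  proof (rule integral_mono[OF integrable_abs[OF ik] Bochner_Integration.integrable_add[OF integrable_mult_right[OF iE(1)] integrable_mult_right[OF iX]]])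
    fix x
    show "\<bar>\<kappa> x * indicator {t..<t1} x\<bar> \<le> h * ?E x + exp (- \<delta> * t) * h powr (1 - p) * (X x * indicator {..<t1} x)"
    proof (cases "x \<in> {t..<t1}")
      case True
      \<comment> \<open>The weight is chosen so that the p-th power is exactly the energy
        density.\<close>
      have "\<bar>\<kappa> x\<bar> * exp (\<delta> * x) \<le> h + h powr (1 - p) * (\<bar>\<kappa> x\<bar> * exp (\<delta> * x)) powr p"
        by (rule le_add_powr) (use h p in auto)
      also have "(\<bar>\<kappa> x\<bar> * exp (\<delta> * x)) powr p = X x"
        by (simp add: X_def powr_mult exp_powr_real \<delta>_p[symmetric] mult_ac)
      finally have "exp (- \<delta> * x) * (\<bar>\<kappa> x\<bar> * exp (\<delta> * x)) \<le> exp (- \<delta> * x) * (h + h powr (1 - p) * X x)"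
        by (rule mult_left_mono) simp
      moreover have "exp (- \<delta> * x) * (\<bar>\<kappa> x\<bar> * exp (\<delta> * x)) = \<bar>\<kappa> x\<bar>" by (simp add: exp_minus)
      moreover have "exp (- \<delta> * x) * (h powr (1 - p) * X x) \<le> exp (- \<delta> * t) * (h powr (1 - p) * X x)"
        using True \<delta>_pos X_nonneg[of x] by (intro mult_right_mono) auto
      ultimately have "\<bar>\<kappa> x\<bar> \<le> h * exp (- \<delta> * x) + exp (- \<delta> * t) * (h powr (1 - p) * X x)"
        by (simp only: distrib_left) (simp only: mult.commute[of _ h])
      then show ?thesis using True by (simp add: mult.assoc)
    next
      case False
      have "0 \<le> h * ?E x" "0 \<le> exp (- \<delta> * t) * h powr (1 - p) * (X x * indicator {..<t1} x)"
        using h X_nonneg by auto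
      then show ?thesis using False by simp
    qed
  qed
  also have "\<dots> = h * (\<integral>x. ?E x \<partial>lborel) + exp (- \<delta> * t) * h powr (1 - p) * ?I"
    by (simp only: Bochner_Integration.integral_add[OF integrable_mult_right[OF iE(1)] integrable_mult_right[OF iX]] integral_mult_right_zero)
  also have "\<dots> \<le> h * (exp (- \<delta> * t) / \<delta>) + exp (- \<delta> * t) * h powr (1 - p) * ?I"
    using h iE(2) by (intro add_right_mono mult_left_mono) auto
  finally have "V t \<le> V t1 + (h * (exp (- \<delta> * t) / \<delta>) + exp (- \<delta> * t) * h powr (1 - p) * ?I)" by simp
  then have "exp (\<delta> * t) * V t \<le> exp (\<delta> * t) * (V t1 + (h * (exp (- \<delta> * t) / \<delta>) + exp (- \<delta> * t) * h powr (1 - p) * ?I))"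
    by (rule mult_left_mono) simp
  also have "\<dots> = exp (\<delta> * t) * V t1 + (exp (\<delta> * t) * exp (- \<delta> * t)) * (h / \<delta>) + (exp (\<delta> * t) * exp (- \<delta> * t)) * (h powr (1 - p) * ?I)"
    by (simp add: algebra_simps)
  also have "exp (\<delta> * t) * exp (- \<delta> * t) = 1" by (simp flip: exp_add)
  finally show ?thesis by (simp add: w_def)
qed

text \<open>The order of choices matters: \<open>h\<close> makes h/delta = e/3, then
  \<open>t1\<close> makes the energy to its left small against h^(p-1), and finally t -> -infinity
  removes the term with \<open>V t1\<close>.\<close>

lemma w_bot: "(w \<longlongrightarrow> 0) at_bot"
proof (rule tendstoI)
  fix e :: real assume e: "0 < e"
  define h where "h = e * \<delta> / 3"
  have h: "0 < h" "h / \<delta> = e / 3" using e \<delta>_pos by (auto simp: h_def)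
  have hp: "0 < h powr (1 - p)" using h by simp
  obtain t1 where t1: "t1 < ln R" "(\<integral>t. X t * indicator {..<t1} t \<partial>lborel) \<le> e / 3 / h powr (1 - p)"
    using X_tail[of "e / 3 / h powr (1 - p)"] e hp by auto
  have I: "h powr (1 - p) * (\<integral>t. X t * indicator {..<t1} t \<partial>lborel) \<le> e / 3"
    using t1(2) hp by (simp add: field_simps)
  have "((\<lambda>t. exp (\<delta> * t) * V t1) \<longlongrightarrow> 0 * V t1) at_bot"
    by (intro tendsto_intros filterlim_compose[OF exp_at_bot] filterlim_tendsto_pos_mult_at_bot[OF tendsto_const \<delta>_pos] filterlim_ident)
  then have "\<forall>\<^sub>F t in at_bot. exp (\<delta> * t) * V t1 < e / 3"
    by (rule order_tendstoD(2)) (use e in simp)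
  with eventually_gt_at_bot[of t1] show "\<forall>\<^sub>F t in at_bot. dist (w t) 0 < e"
  proof eventually_elim
    case (elim t)
    have "0 \<le> w t" using V_nonneg[of t] by (simp add: w_def)
    then show ?case using w_upper[OF h(1) elim(1) t1(1)] elim(2) I h(2) by (simp add: dist_real_def)
  qed
qed

lemma emden_fowler: "emden_fowler p q \<delta> \<mu> lam (ln R) w z"
proof
  show "0 < w t" if "t < ln R" for t using V_pos[OF that] by (simp add: w_def)
qed (use p pq \<delta>_pos w_deriv z_deriv w_end w_bot z_small in auto)

end

section \<open>From positive radial solutions to the system, and conclusion\<close>

lemma positive_radial_solution_emden_fowler:
  fixes u :: "'a::euclidean_space \<Rightarrow> real"
  assumes p: "1 < p" "p < real DIM('a)" and s: "s < p" and R: "0 < R"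
    and sol: "positive_radial_solution p s \<mu> lam R u"
  obtains w z where
    "emden_fowler p (critical_exponent DIM('a) p s) ((real DIM('a) - p) / p) \<mu> lam (ln R) w z"
    "\<And>x. x \<in> ball 0 R - {0} \<Longrightarrow> w (ln (norm x)) = exp ((real DIM('a) - p) / p * ln (norm x)) * u x"
proof -
  let ?N = "real DIM('a)" and ?q = "critical_exponent DIM('a) p s" and ?B = "ball (0::'a) R"
  let ?U = "\<lambda>x. if x \<in> ?B - {0} then u x else 0"
  have cont: "continuous_on (?B - {0}) u" and rad: "\<And>x y. x \<in> ?B \<Longrightarrow> y \<in> ?B \<Longrightarrow> norm x = norm y \<Longrightarrow> u x = u y"
    and pos: "\<And>x. x \<in> ?B - {0} \<Longrightarrow> 0 < u x" and ws: "weak_solution p s \<mu> lam ?B u"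
    using sol unfolding positive_radial_solution_def by blast+
  obtain g where W: "W0_with_grad p ?B u g"
    and weak: "\<And>\<phi>. \<phi> \<in> test_functions ?B \<Longrightarrow>
         (\<integral>x. norm (g x) powr (p - 2) * (g x \<bullet> grad \<phi> x)
              - \<mu> / norm x powr p * \<bar>u x\<bar> powr (p - 2) * u x * \<phi> x
              - lam * \<bar>u x\<bar> powr (p - 2) * u x * \<phi> x \<partial>lebesgue_on ?B) =
         (\<integral>x. \<bar>u x\<bar> powr (?q - 2) * u x / norm x powr s * \<phi> x \<partial>lebesgue_on ?B)"
    using ws unfolding weak_solution_def by blast
  obtain G f where GW: "radial_W0 p R ?U G f" and Gg: "AE x in lebesgue. x \<in> ?B \<longrightarrow> G x = g x"
    using radial_W0_of_W0_with_grad[OF W p(1) R cont rad] by blast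
  interpret radial_W0_dim p R ?U G f ?N "?N * unit_ball_vol ?N"
    using GW by (intro radial_W0_dim.intro radial_W0_dim_axioms.intro) auto
  obtain \<kappa> where \<kappa>: "\<kappa> \<in> borel_measurable borel"
    "AE x in lborel. G x = (\<kappa> (ln (norm x)) / (norm x)\<^sup>2) *\<^sub>R x"
    "\<And>a. integrable lborel (\<lambda>t. \<kappa> t * indicator {a..} t)"
    "\<And>a. a < ln R \<Longrightarrow> V a = - (\<integral>t. \<kappa> t * indicator {a..} t \<partial>lborel)"
    "\<And>t. ln R \<le> t \<Longrightarrow> \<kappa> t = 0"
    "(\<integral>\<^sup>+t. ennreal (\<bar>\<kappa> t\<bar> powr p * exp ((?N - p) * t)) \<partial>lborel) < \<infinity>"
    using radial_profile by blast
  have q_eq: "(?N - p) * ?q = (?N - s) * p" using assms(1,2) by (simp add: critical_exponent_def)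
  have pq: "p < ?q" using assms(1-3) by (simp add: critical_exponent_def field_simps)
  have Vpos: "0 < V t" if "t < ln R" for t
  proof -
    have "exp t < R" using that R by (metis exp_less_cancel_iff exp_ln)
    then have "exp t *\<^sub>R e0 \<in> ?B - {0}" using e0_Basis by (auto simp: nonzero_Basis)
    then show ?thesis unfolding V_def using pos by simp
  qed
  interpret radial_kappa p R ?U G f ?N "?N * unit_ball_vol ?N" \<kappa> s \<mu> lam ?q
    by unfold_locales (use \<kappa> assms(2) pq Vpos in auto)
  have um: "u \<in> borel_measurable (lebesgue_on ?B)" and gm: "g \<in> borel_measurable (lebesgue_on ?B)"
    using W unfolding W0_with_grad_def by blast+
  interpret radial_weak p R ?U G f ?N "?N * unit_ball_vol ?N" \<kappa> s \<mu> lam ?q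
  proof (unfold_locales, rule q_eq, goal_cases)
    case (1 F \<eta> a b)
    show ?case by (rule weak_radial_form[OF _ Gg \<kappa>(2) gm um weak 1]) auto
  qed
  show ?thesis
  proof (rule that)
    show "emden_fowler p ?q ((?N - p) / p) \<mu> lam (ln R) w z"
      using emden_fowler unfolding \<delta>_def .
    fix x assume x: "x \<in> ?B - {0}"
    then have "V (ln (norm x)) = u x" using U_eq_V[of x] by simp
    then show "w (ln (norm x)) = exp ((?N - p) / p * ln (norm x)) * u x"
      unfolding w_def \<delta>_def by (simp only:)
  qed
qed

theorem theorem1p2:
  fixes p s \<mu> lam R :: real
  assumes "2 \<le> DIM('a::euclidean_space)"
    and "1 < p" and "p < real DIM('a)"
    and "\<mu> < ((real DIM('a) - p) / p) powr p"
    and "0 \<le> s" and "s < p"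
    and "0 < R"
  shows "(lam \<le> 0 \<longrightarrow> \<not> (\<exists>u :: 'a \<Rightarrow> real. positive_radial_solution p s \<mu> lam R u)) \<and>
         (0 < lam \<longrightarrow>
           (\<forall>u v :: 'a \<Rightarrow> real.
              positive_radial_solution p s \<mu> lam R u \<longrightarrow> positive_radial_solution p s \<mu> lam R v \<longrightarrow>
              (\<forall>x\<in>ball 0 R - {0}. u x = v x)))"
proof (intro conjI impI allI ballI notI)
  assume "lam \<le> 0" "\<exists>u :: 'a \<Rightarrow> real. positive_radial_solution p s \<mu> lam R u"
  then obtain u :: "'a \<Rightarrow> real" where "positive_radial_solution p s \<mu> lam R u" by blast
  then obtain w z where "emden_fowler p (critical_exponent DIM('a) p s) ((real DIM('a) - p) / p) \<mu> lam (ln R) w z"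
    using positive_radial_solution_emden_fowler[OF assms(2,3,6,7)] by metis
  then show False using emden_fowler.lam_pos \<open>lam \<le> 0\<close> by fastforce
next
  fix u v :: "'a \<Rightarrow> real" and x :: 'a
  assume u: "positive_radial_solution p s \<mu> lam R u" and v: "positive_radial_solution p s \<mu> lam R v"
    and x: "x \<in> ball 0 R - {0}"
  obtain w1 z1 where w1: "emden_fowler p (critical_exponent DIM('a) p s) ((real DIM('a) - p) / p) \<mu> lam (ln R) w1 z1"
    "\<And>x. x \<in> ball 0 R - {0} \<Longrightarrow> w1 (ln (norm x)) = exp ((real DIM('a) - p) / p * ln (norm x)) * u x"
    using positive_radial_solution_emden_fowler[OF assms(2,3,6,7) u] by metis
  obtain w2 z2 where w2: "emden_fowler p (critical_exponent DIM('a) p s) ((real DIM('a) - p) / p) \<mu> lam (ln R) w2 z2"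
    "\<And>x. x \<in> ball 0 R - {0} \<Longrightarrow> w2 (ln (norm x)) = exp ((real DIM('a) - p) / p * ln (norm x)) * v x"
    using positive_radial_solution_emden_fowler[OF assms(2,3,6,7) v] by metis
  interpret emden_fowler_pair p "critical_exponent DIM('a) p s" "(real DIM('a) - p) / p" \<mu> lam "ln R" w1 z1 w2 z2
    using w1(1) w2(1) by (rule emden_fowler_pair.intro)
  have "ln (norm x) < ln R" using x assms(7) by (simp add: ln_less_cancel_iff)
  then have "w2 (ln (norm x)) = w1 (ln (norm x))" by (rule w_eq)
  then show "u x = v x" using w1(2)[OF x] w2(2)[OF x] by simp
qed

end
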